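(* Let $G$ be a finite abelian group of order $n\geq 2$. (1) If $n$ has prime divisors congruent to $2$ mod $3$, and $p$ is the smallest such prime, then the maximum size of a $3$-incomplete subset of $G$ is $(p+1)n/(3p)$, and $S(G,3)=\{n-n/p\}$. (2) If $n$ is divisible by $3$ but has no divisors congruent to $2$ mod $3$, then the maximum size of a $3$-incomplete subset of $G$ is $n/3$. Moreover, every element of $S(G,3)$ is of the form $n-n/d$ or $n-2n/d$ with $d$ a divisor of $n$ that is divisible by $3$, and all such integers occur, with the exceptions of $2n/3$ and of $n-2n/d$ when the highest power of $3$ dividing $d$ exceeds the highest power of $3$ dividing the exponent $\kappa$ of $G$. That is, $$S(G,3)=\{n-n/d : d\mid n,\ 3\mid d,\ d\neq 3\}\cup\{n-2n/d : d\mid n,\ 1\leq \nu_3(d)\leq \nu_3(\kappa)\}.$$ (3) If all divisors of $n$ are congruent to $1$ mod $3$, then the maximum size of a $3$-incomplete subset of $G$ is $(n-1)/3$. Moreover, $S(G,3)=\{n-3,n-1\}$, unless $G$ is an elementary abelian $7$-group, in which case $S(G,3)=\{n-3\}$.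
   Context: Let $G$ be a finite abelian group, written additively. For a positive integer $h$ and a nonempty subset $A\subseteq G$, $hA=\{a_1+\cdots+a_h : a_1,\dots,a_h\in A\}$ is the set of sums of $h$ not necessarily distinct elements of $A$. A nonempty subset $A$ is $h$-complete if $hA=G$ and $h$-incomplete if $hA\neq G$. The $h$-critical number is $\chi(G,h)=\min\{m\geq 1 : \text{every } A\subseteq G \text{ with } |A|\geq m \text{ satisfies } hA=G\}$; thus $\chi(G,h)-1$ is the maximum size of an $h$-incomplete subset. Define $S(G,h)=\{|hA| : A\subset G,\ |A|=\chi(G,h)-1,\ hA\neq G\}$, the set of sizes of $hA$ as $A$ ranges over the $h$-incomplete subsets of $G$ of maximum size. For a positive integer $t$, $\nu_3(t)$ denotes the exponent of $3$ in the prime factorization of $t$. *)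

theory Defs
  imports "HOL-Algebra.Algebra" "HOL-Computational_Algebra.Primes"
begin

text \<open>HOL-Algebra writes an abstract commutative group multiplicatively, so the
  \<open>h\<close>-fold sumset \<open>hA\<close> of an additively written group appears here as a set of products.
  For \<open>G\<close> a commutative group and \<open>A\<close> not contained in its carrier the value is
  irrelevant.\<close>

definition hfold :: "('a, 'b) monoid_scheme \<Rightarrow> nat \<Rightarrow> 'a set \<Rightarrow> 'a set"
  where "hfold G h A = {finprod G a {..<h} | a. a \<in> {..<h} \<rightarrow> A}"

definition h_incomplete :: "('a, 'b) monoid_scheme \<Rightarrow> nat \<Rightarrow> 'a set \<Rightarrow> bool"
  where "h_incomplete G h A \<longleftrightarrow> A \<noteq> {} \<and> A \<subseteq> carrier G \<and> hfold G h A \<noteq> carrier G"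

definition max_incomplete_size :: "('a, 'b) monoid_scheme \<Rightarrow> nat \<Rightarrow> nat"
  where "max_incomplete_size G h = Max {card A | A. h_incomplete G h A}"

definition critical_number :: "('a, 'b) monoid_scheme \<Rightarrow> nat \<Rightarrow> nat"
  where "critical_number G h =
    (LEAST m. m \<ge> 1 \<and> (\<forall>A. A \<subseteq> carrier G \<and> card A \<ge> m \<longrightarrow> hfold G h A = carrier G))"

definition incomplete_sizes :: "('a, 'b) monoid_scheme \<Rightarrow> nat \<Rightarrow> nat set"
  where "incomplete_sizes G h =
    {card (hfold G h A) | A. h_incomplete G h A \<and> card A = critical_number G h - 1}"

definition group_exponent :: "('a, 'b) monoid_scheme \<Rightarrow> nat"
  where "group_exponent G = (LEAST m. m > 0 \<and> (\<forall>x\<in>carrier G. x [^]\<^bsub>G\<^esub> m = \<one>\<^bsub>G\<^esub>))"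

definition elementary_abelian :: "nat \<Rightarrow> ('a, 'b) monoid_scheme \<Rightarrow> bool"
  where "elementary_abelian p G \<longleftrightarrow>
    Factorial_Ring.prime p \<and> comm_group G \<and> (\<forall>x\<in>carrier G - {\<one>\<^bsub>G\<^esub>}. group.ord G x = p)"

end

theory Submission
  imports Defs
begin

text \<open>Kneser's theorem, applied to \<open>A + 2A\<close> and \<open>A + A\<close> modulo the stabilizer \<open>H\<close> of \<open>3A\<close>, bounds
  \<open>|A|\<close> in terms of the order \<open>d\<close> of \<open>G/H\<close> and leaves very few possible values of \<open>|3A|\<close>.

  If \<open>3A\<close> misses exactly two cosets of \<open>H\<close>, with difference \<open>t\<close>, then \<open>2A\<close> is disjoint from two
  translates of \<open>-A\<close>, so \<open>A\<close> is nearly invariant under \<open>t\<close>: up to full cosets of the group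
  generated by \<open>H\<close> and \<open>t\<close>, it consists of one or two progressions with difference \<open>t\<close>.  The end points
  of these progressions decide the rest.

  In an elementary abelian 7-group, written additively, with \<open>0 \<notin> 3A\<close> every line through the origin meets \<open>A\<close> in exactly
  two points.  Counting on affine lines shows that in each plane \<open>A\<close> contains full cosets of a unique
  line, and a line that is minimal in this sense accounts for three elements missing from \<open>3A\<close>.

  The extremal sets of each size are built from arithmetic progressions in a cyclic subquotient
  together with a union of cosets of a subgroup.\<close>

section \<open>Kneser's theorem\<close>

text \<open>Counted in cosets of \<open>H\<close>, Kneser's bound reads
  \<open>3 * s \<le> r + 2\<close> with \<open>r < d\<close>, where \<open>s\<close> and
  \<open>r\<close> are the numbers of cosets that make up \<open>A + H\<close> and
  \<open>3A\<close>. The residue of \<open>d\<close> modulo 3 decides how large \<open>3 * s\<close>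
  can be: at most \<open>d + 1\<close> for residue 2, in which case \<open>d\<close> has a prime
  factor of the same kind, and otherwise at most \<open>d\<close> or \<open>d - 1\<close>. The
  obstacle is that an extremal \<open>A\<close> may still miss one coset, two, or (for residue 1)
  three, and Kneser's theorem alone does not tell which of these occur. Two missing cosets force an
  element whose order modulo \<open>H\<close> carries the full power of 3 in \<open>d\<close>; this
  is how the exponent of \<open>G\<close> enters. For residue 1 a single missing element comes from
  the exponents \<open>0, ..., k - 2, k\<close> modulo \<open>3 * k + 1\<close>. This needs
  \<open>k \<ge> 3\<close>, and the failing value \<open>k = 2\<close> is order 7: hence the
  exceptional role of elementary abelian 7-groups.\<close>

locale finite_comm_group = comm_group G for G (structure) +
  assumes finite_carrier [simp, intro]: "finite (carrier G)"
begin

section \<open>Stabilizers and unions of cosets\<close>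

definition stab :: "'a set \<Rightarrow> 'a set"
  where "stab C = {g \<in> carrier G. \<forall>c\<in>C. g \<otimes> c \<in> C}"

definition periodic :: "'a set \<Rightarrow> 'a set \<Rightarrow> bool"
  where "periodic H C \<longleftrightarrow> (\<forall>h\<in>H. \<forall>c\<in>C. h \<otimes> c \<in> C)"

lemma periodicD: "periodic H C \<Longrightarrow> h \<in> H \<Longrightarrow> c \<in> C \<Longrightarrow> h \<otimes> c \<in> C"
  by (simp add: periodic_def)

lemma periodic_stab: "periodic (stab C) C"
  by (simp add: periodic_def stab_def)

lemma finite_subset_carrier [simp]: "C \<subseteq> carrier G \<Longrightarrow> finite C"
  using finite_subset by blast

lemma inj_on_mult: "g \<in> carrier G \<Longrightarrow> C \<subseteq> carrier G \<Longrightarrow> inj_on (\<lambda>c. g \<otimes> c) C"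
  by (rule inj_onI) (simp add: subset_iff)

lemma card_mult_image [simp]:
  "g \<in> carrier G \<Longrightarrow> C \<subseteq> carrier G \<Longrightarrow> card ((\<lambda>c. g \<otimes> c) ` C) = card C"
  by (simp add: card_image inj_on_mult)

lemma mult_inv_cancel [simp]:
  "x \<in> carrier G \<Longrightarrow> y \<in> carrier G \<Longrightarrow> x \<otimes> (inv x \<otimes> y) = y"
  "x \<in> carrier G \<Longrightarrow> y \<in> carrier G \<Longrightarrow> inv x \<otimes> (x \<otimes> y) = y"
  by (simp_all flip: m_assoc)

text \<open>Reordering a product can separate an element from its inverse; these rules cancel the
  pair across the terms in between.\<close>

lemma cancel_ac:
  assumes "x \<in> carrier G" "y \<in> carrier G" "z \<in> carrier G" "u \<in> carrier G" "v \<in> carrier G"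
  shows "x \<otimes> (y \<otimes> inv x) = y" "x \<otimes> (y \<otimes> (inv x \<otimes> z)) = y \<otimes> z"
    "x \<otimes> (y \<otimes> (z \<otimes> inv x)) = y \<otimes> z" "x \<otimes> (y \<otimes> (z \<otimes> (inv x \<otimes> u))) = y \<otimes> (z \<otimes> u)"
    "x \<otimes> (y \<otimes> (z \<otimes> (u \<otimes> inv x))) = y \<otimes> (z \<otimes> u)"
    "x \<otimes> (y \<otimes> (z \<otimes> (u \<otimes> (inv x \<otimes> v)))) = y \<otimes> (z \<otimes> (u \<otimes> v))"
proof -
  have *: "x \<otimes> (a \<otimes> inv x) = a" "x \<otimes> (a \<otimes> (inv x \<otimes> b)) = a \<otimes> b"
    if "a \<in> carrier G" "b \<in> carrier G" for a b
    using that assms by (simp_all add: m_lcomm[of x])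
  show "x \<otimes> (y \<otimes> inv x) = y" "x \<otimes> (y \<otimes> (inv x \<otimes> z)) = y \<otimes> z"
    using * assms by auto
  show "x \<otimes> (y \<otimes> (z \<otimes> inv x)) = y \<otimes> z" "x \<otimes> (y \<otimes> (z \<otimes> (inv x \<otimes> u))) = y \<otimes> (z \<otimes> u)"
    using *[of "y \<otimes> z" u] assms by (auto simp: m_assoc)
  show "x \<otimes> (y \<otimes> (z \<otimes> (u \<otimes> inv x))) = y \<otimes> (z \<otimes> u)"
    "x \<otimes> (y \<otimes> (z \<otimes> (u \<otimes> (inv x \<otimes> v)))) = y \<otimes> (z \<otimes> (u \<otimes> v))"
    using *[of "y \<otimes> (z \<otimes> u)" v] assms by (auto simp: m_assoc)
qed

lemmas ac_inv = m_ac inv_mult cancel_ac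

lemma subgroup_stab:
  assumes C: "C \<subseteq> carrier G"
  shows "subgroup (stab C) G"
proof
  show "stab C \<subseteq> carrier G" by (auto simp: stab_def)
  show "\<one> \<in> stab C" using C by (auto simp: stab_def)
  show "x \<otimes> y \<in> stab C" if "x \<in> stab C" "y \<in> stab C" for x y
  proof -
    have "x \<otimes> y \<otimes> c \<in> C" if "c \<in> C" for c
    proof -
      have "c \<in> carrier G" using C that by auto
      then show ?thesis
        using that \<open>x \<in> stab C\<close> \<open>y \<in> stab C\<close> by (auto simp: stab_def m_assoc)
    qed
    then show ?thesis using that by (auto simp: stab_def)
  qed
  show "inv x \<in> stab C" if x: "x \<in> stab C" for x
  proof -
    have xc: "x \<in> carrier G" and sub: "(\<lambda>c. x \<otimes> c) ` C \<subseteq> C"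
      using x by (auto simp: stab_def)
    have surj: "(\<lambda>c. x \<otimes> c) ` C = C"
      using endo_inj_surj[OF _ sub inj_on_mult[OF xc C]] C by simp
    have "inv x \<otimes> c \<in> C" if c: "c \<in> C" for c
    proof -
      obtain b where b: "b \<in> C" "c = x \<otimes> b" using surj c by blast
      then show ?thesis using xc C by auto
    qed
    then show ?thesis using xc by (auto simp: stab_def)
  qed
qed

lemma subgroup_finite: "subgroup H G \<Longrightarrow> finite H"
  by (simp add: subgroup.subset)

lemma subgroup_card_pos: "subgroup H G \<Longrightarrow> 0 < card H"
  using subgroup_finite subgroup.one_closed card_gt_0_iff by blast

lemma periodic_inv:
  assumes "subgroup H G" "periodic H C" "h \<in> H" "c \<in> carrier G" "h \<otimes> c \<in> C"
  shows "c \<in> C"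
proof -
  have "h \<in> carrier G" "inv h \<in> H"
    using assms subgroup.mem_carrier subgroup.m_inv_closed by metis+
  with assms have "inv h \<otimes> (h \<otimes> c) \<in> C" by (blast intro: periodicD)
  with \<open>h \<in> carrier G\<close> assms show ?thesis by simp
qed

lemma periodic_Diff:
  assumes "subgroup H G" "periodic H C" "periodic H D" "C \<subseteq> carrier G"
  shows "periodic H (C - D)"
  unfolding periodic_def
  using assms periodic_inv[OF assms(1,3)] by (auto simp: periodic_def)

lemma periodic_carrier: "subgroup H G \<Longrightarrow> periodic H (carrier G)"
  by (auto simp: periodic_def subgroup.mem_carrier)

lemma periodic_coset:
  assumes "subgroup H G" "x \<in> carrier G" shows "periodic H (H #> x)"
proof -
  have "h \<otimes> (k \<otimes> x) = h \<otimes> k \<otimes> x" if "h \<in> H" "k \<in> H" for h k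
    using that assms by (simp add: m_assoc subgroup.mem_carrier)
  then show ?thesis
    using assms unfolding periodic_def r_coset_def by (force intro: subgroup.m_closed)
qed

lemma card_r_coset [simp]:
  assumes "H \<subseteq> carrier G" "x \<in> carrier G" shows "card (H #> x) = card H"
proof -
  have "H #> x = (\<lambda>h. x \<otimes> h) ` H" 
    using assms m_comm unfolding r_coset_def by blast
  with assms show ?thesis by simp
qed

lemma card_dvd_periodic:
  assumes H: "subgroup H G" and C: "C \<subseteq> carrier G" and p: "periodic H C"
  shows "card H dvd card C"
proof -
  have fH: "H \<subseteq> carrier G" using H by (rule subgroup.subset)
  have in_cos: "H #> x \<subseteq> C" if "x \<in> C" for x
    using periodicD[OF p _ that] by (auto simp: r_coset_def)
  have self: "x \<in> H #> x" if "x \<in> C" for x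
    using that C H rcos_self by blast
  have U: "\<Union>((\<lambda>x. H #> x) ` C) = C"
    using in_cos self by blast
  have disj: "pairwise disjnt ((\<lambda>x. H #> x) ` C)"
  proof (clarsimp simp: pairwise_def)
    fix x y assume xy: "x \<in> C" "y \<in> C" "H #> x \<noteq> H #> y"
    show "disjnt (H #> x) (H #> y)"
    proof (rule ccontr)
      assume "\<not> disjnt (H #> x) (H #> y)"
      then obtain z where "z \<in> H #> x" "z \<in> H #> y" by (auto simp: disjnt_def)
      then have "H #> x = H #> z" "H #> y = H #> z"
        using repr_independence[OF _ _ H] xy C by blast+
      with xy show False by simp
    qed
  qed
  have "card (\<Union>((\<lambda>x. H #> x) ` C)) = sum card ((\<lambda>x. H #> x) ` C)"
    using C fH by (intro card_Union_disjoint disj) (auto intro!: finite_subset_carrier simp: r_coset_def)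
  also have "\<dots> = sum (\<lambda>_. card H) ((\<lambda>x. H #> x) ` C)"
  proof (rule sum.cong[OF refl])
    fix y assume "y \<in> (\<lambda>x. H #> x) ` C"
    then obtain x where "x \<in> carrier G" "y = H #> x" using C by blast
    then show "card y = card H" using fH by simp
  qed
  finally show ?thesis using U by simp
qed

section \<open>Merging two sets with large stabilizers\<close>

lemma card_set_mult_times_card_Int:
  assumes H1: "subgroup H1 G" and H2: "subgroup H2 G"
    and S: "S \<subseteq> H1" "periodic (H1 \<inter> H2) S" and T: "T \<subseteq> H2" "periodic (H1 \<inter> H2) T"
  shows "card (S <#> T) * card (H1 \<inter> H2) = card S * card T"
proof -
  let ?K = "H1 \<inter> H2"
  have c1: "H1 \<subseteq> carrier G" and c2: "H2 \<subseteq> carrier G" using H1 H2 by (auto dest: subgroup.subset)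
  have K: "subgroup ?K G" using H1 H2 by (rule subgroups_Inter_pair)
  let ?f = "\<lambda>(s, t). s \<otimes> t"
  have fin: "finite S" "finite T" using S T c1 c2 by (auto intro!: finite_subset_carrier)
  have im: "?f ` (S \<times> T) = S <#> T" by (auto simp: set_mult_def)
  \<comment> \<open>The fibre over \<open>s \<otimes> t\<close> consists of the pairs
    \<open>(k \<otimes> s, inv k \<otimes> t)\<close> with \<open>k\<close> in
    \<open>H1 \<inter> H2\<close>; periodicity keeps them in \<open>S \<times> T\<close>.\<close>
  have fib: "card {p \<in> S \<times> T. ?f p = y} = card ?K" if y: "y \<in> S <#> T" for y
  proof -
    obtain s t where st: "s \<in> S" "t \<in> T" "y = s \<otimes> t" using y unfolding set_mult_def by blast
    then have sc: "s \<in> carrier G" "t \<in> carrier G" using S T c1 c2 by auto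
    have "bij_betw (\<lambda>k. (k \<otimes> s, inv k \<otimes> t)) ?K {p \<in> S \<times> T. ?f p = y}"
      unfolding bij_betw_def
    proof
      show "inj_on (\<lambda>k. (k \<otimes> s, inv k \<otimes> t)) ?K"
      proof (rule inj_onI)
        fix k k' assume "k \<in> ?K" "k' \<in> ?K" "(k \<otimes> s, inv k \<otimes> t) = (k' \<otimes> s, inv k' \<otimes> t)"
        then show "k = k'" using sc c1 by (simp add: subset_iff)
      qed
      show "(\<lambda>k. (k \<otimes> s, inv k \<otimes> t)) ` ?K = {p \<in> S \<times> T. ?f p = y}"
      proof (intro equalityI subsetI)
        fix p assume "p \<in> (\<lambda>k. (k \<otimes> s, inv k \<otimes> t)) ` ?K"
        then obtain k where k: "k \<in> ?K" "p = (k \<otimes> s, inv k \<otimes> t)" by auto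
        have kc: "k \<in> carrier G" using k c1 by auto
        have "k \<otimes> s \<otimes> (inv k \<otimes> t) = s \<otimes> t"
          using kc sc by (simp add: ac_inv)
        moreover have "inv k \<in> ?K" by (rule subgroup.m_inv_closed[OF K k(1)])
        ultimately show "p \<in> {p \<in> S \<times> T. ?f p = y}"
          using k st periodicD[OF S(2)] periodicD[OF T(2)] by (simp del: Int_iff)
      next
        fix p assume "p \<in> {p \<in> S \<times> T. ?f p = y}"
        then obtain s' t' where p: "p = (s', t')" "s' \<in> S" "t' \<in> T" "s' \<otimes> t' = s \<otimes> t"
          using st by auto
        have sc': "s' \<in> carrier G" "t' \<in> carrier G" using p S T c1 c2 by auto
        define k where "k = s' \<otimes> inv s"
        have "s' = s \<otimes> t \<otimes> inv t'"
          using p(4) sc sc' by (simp add: inv_solve_right)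
        then have "k = t \<otimes> inv t'" using sc sc' by (simp add: k_def ac_inv)
        moreover have "t \<otimes> inv t' \<in> H2"
          using st(2) p(3) T(1) by (intro subgroup.m_closed[OF H2] subgroup.m_inv_closed[OF H2]) auto
        moreover have "k \<in> H1" unfolding k_def
          using st(1) p(2) S(1) by (intro subgroup.m_closed[OF H1] subgroup.m_inv_closed[OF H1]) auto
        moreover have "k \<otimes> s = s'" unfolding k_def using sc sc' by (simp add: m_assoc)
        moreover have "inv k \<otimes> t = t'"
          using \<open>k = t \<otimes> inv t'\<close> sc sc' by (simp add: ac_inv)
        ultimately show "p \<in> (\<lambda>k. (k \<otimes> s, inv k \<otimes> t)) ` ?K" using p by (intro image_eqI[of _ _ k]) auto
      qed
    qed
    then show ?thesis by (simp add: bij_betw_same_card)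
  qed
  have "card (S \<times> T) = (\<Sum>y\<in>S <#> T. card {p \<in> S \<times> T. ?f p = y})"
    using card_eq_sum[of "S \<times> T"] sum.image_gen[of "S \<times> T" "\<lambda>_. 1::nat" ?f] fin by (simp add: im)
  also have "\<dots> = card (S <#> T) * card ?K" using fib by simp
  finally show ?thesis by (simp add: card_cartesian_product)
qed

text \<open>Within a coset of \<open>H1 H2\<close> the sets \<open>C1\<close> and \<open>C2\<close> are unions of rows and of columns of a grid
  with cells of size \<open>|H1 \<inter> H2|\<close>; \<open>P\<close> and \<open>Q\<close> record which rows and columns occur.\<close>

lemma kneser_union_aux:
  assumes C: "C1 \<subseteq> carrier G" "C2 \<subseteq> carrier G"
    and H: "subgroup H1 G" "subgroup H2 G" and P: "periodic H1 C1" "periodic H2 C2"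
    and x: "x \<in> C2 - C1"
    and l1: "card (C2 - C1) + card (H1 \<inter> H2) < card H1"
    and l2: "card (C1 - C2) + card (H1 \<inter> H2) < card H2"
  shows "card H2 < card H1"
proof -
  let ?K = "H1 \<inter> H2"
  have K: "subgroup ?K G" using H by (rule subgroups_Inter_pair)
  have c: "H1 \<subseteq> carrier G" "H2 \<subseteq> carrier G" using H by (auto dest: subgroup.subset)
  have xc: "x \<in> carrier G" using x C by auto
  define Q where "Q = {h \<in> H1. x \<otimes> h \<in> C2}"
  define P where "P = {h \<in> H2. x \<otimes> h \<in> C1}"
  have eq: "x \<otimes> (k \<otimes> h) = k \<otimes> (x \<otimes> h)" if "k \<in> carrier G" "h \<in> carrier G" for k h
    using that xc by (simp add: m_lcomm)
  have perK: "periodic ?K Q" "periodic ?K P"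
  proof -
    show "periodic ?K Q" unfolding periodic_def
    proof (intro ballI)
      fix k h assume kh: "k \<in> ?K" "h \<in> Q"
      then have "k \<in> carrier G" "h \<in> carrier G" using c by (auto simp: Q_def)
      then show "k \<otimes> h \<in> Q" using kh H P(2) eq[of k h]
        by (auto simp: Q_def periodicD intro: subgroup.m_closed)
    qed
    show "periodic ?K P" unfolding periodic_def
    proof (intro ballI)
      fix k h assume kh: "k \<in> ?K" "h \<in> P"
      then have "k \<in> carrier G" "h \<in> carrier G" using c by (auto simp: P_def)
      then show "k \<otimes> h \<in> P" using kh H P(1) eq[of k h]
        by (auto simp: P_def periodicD intro: subgroup.m_closed)
    qed
  qed
  have perKH: "periodic ?K H1" "periodic ?K H2"
    using H by (auto simp: periodic_def intro: subgroup.m_closed)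
  have pd: "periodic ?K (H2 - P)" "periodic ?K (H1 - Q)"
    using periodic_Diff[OF K] perK perKH c by auto
  have e1: "card (Q <#> (H2 - P)) * card ?K = card Q * card (H2 - P)"
    by (rule card_set_mult_times_card_Int) (use H perK pd Q_def in auto)
  have e2: "card ((H1 - Q) <#> P) * card ?K = card (H1 - Q) * card P"
    by (rule card_set_mult_times_card_Int) (use H perK pd P_def in auto)
  have sub1: "(\<lambda>y. x \<otimes> y) ` (Q <#> (H2 - P)) \<subseteq> C2 - C1"
  proof
    fix z assume "z \<in> (\<lambda>y. x \<otimes> y) ` (Q <#> (H2 - P))"
    then obtain q h where qh: "q \<in> H1" "x \<otimes> q \<in> C2" "h \<in> H2" "x \<otimes> h \<notin> C1" "z = x \<otimes> (q \<otimes> h)"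
      by (auto simp: set_mult_def Q_def P_def)
    have qc: "q \<in> carrier G" "h \<in> carrier G" using qh c by auto
    have "z = h \<otimes> (x \<otimes> q)" "z = q \<otimes> (x \<otimes> h)" using qh qc xc by (simp_all add: m_ac)
    then show "z \<in> C2 - C1"
      using periodicD[OF \<open>periodic H2 C2\<close> \<open>h \<in> H2\<close> \<open>x \<otimes> q \<in> C2\<close>]
        periodic_inv[OF H(1) \<open>periodic H1 C1\<close> \<open>q \<in> H1\<close>, of "x \<otimes> h"] qh qc xc by auto
  qed
  have sub2: "(\<lambda>y. x \<otimes> y) ` ((H1 - Q) <#> P) \<subseteq> C1 - C2"
  proof
    fix z assume "z \<in> (\<lambda>y. x \<otimes> y) ` ((H1 - Q) <#> P)"
    then obtain q h where qh: "q \<in> H1" "x \<otimes> q \<notin> C2" "h \<in> H2" "x \<otimes> h \<in> C1" "z = x \<otimes> (q \<otimes> h)"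
      by (auto simp: set_mult_def Q_def P_def)
    have qc: "q \<in> carrier G" "h \<in> carrier G" using qh c by auto
    have "z = h \<otimes> (x \<otimes> q)" "z = q \<otimes> (x \<otimes> h)" using qh qc xc by (simp_all add: m_ac)
    then show "z \<in> C1 - C2"
      using periodicD[OF \<open>periodic H1 C1\<close> \<open>q \<in> H1\<close> \<open>x \<otimes> h \<in> C1\<close>]
        periodic_inv[OF H(2) \<open>periodic H2 C2\<close> \<open>h \<in> H2\<close>, of "x \<otimes> q"] qh qc xc by auto
  qed
  have sc: "Q <#> (H2 - P) \<subseteq> carrier G" "(H1 - Q) <#> P \<subseteq> carrier G"
    using c by (auto simp: set_mult_def Q_def P_def)
  have b1: "card (Q <#> (H2 - P)) \<le> card (C2 - C1)"
    using card_mono[OF _ sub1] C sc xc by (simp add: finite_subset_carrier)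
  have b2: "card ((H1 - Q) <#> P) \<le> card (C1 - C2)"
    using card_mono[OF _ sub2] C sc xc by (simp add: finite_subset_carrier)
  let ?k = "card ?K"
  have k0: "0 < ?k" using K by (rule subgroup_card_pos)
  have PQc: "P \<subseteq> carrier G" "Q \<subseteq> carrier G" using c by (auto simp: P_def Q_def)
  obtain u v u' v' where uv: "card Q = ?k * u" "card P = ?k * v" "card (H1 - Q) = ?k * u'" "card (H2 - P) = ?k * v'"
  proof -
    have "?k dvd card Q" "?k dvd card P" "?k dvd card (H1 - Q)" "?k dvd card (H2 - P)"
      using perK pd PQc c by (auto intro!: card_dvd_periodic[OF K])
    then show ?thesis using that by (auto elim!: dvdE)
  qed
  have h1: "card H1 = ?k * (u + u')"
  proof -
    have "Q \<subseteq> H1" by (auto simp: Q_def)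
    then have "card H1 = card Q + card (H1 - Q)"
      using card_Diff_subset[of Q H1] card_mono[of H1 Q] c PQc by simp
    then show ?thesis using uv by (simp add: distrib_left)
  qed
  have h2: "card H2 = ?k * (v + v')"
  proof -
    have "P \<subseteq> H2" by (auto simp: P_def)
    then have "card H2 = card P + card (H2 - P)"
      using card_Diff_subset[of P H2] card_mono[of H2 P] c PQc by simp
    then show ?thesis using uv by (simp add: distrib_left)
  qed
  have "\<one> \<in> Q" using x xc H by (auto simp: Q_def subgroup.one_closed)
  then have "card Q \<noteq> 0" using PQc by auto
  then have u: "u \<ge> 1" using uv by (cases u) auto
  have "\<one> \<in> H2 - P" using x xc H by (auto simp: P_def subgroup.one_closed)
  then have "card (H2 - P) \<noteq> 0" using c by auto
  then have v': "v' \<ge> 1" using uv by (cases v') auto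
  have q1: "?k * (u * v') \<le> card (C2 - C1)"
    using b1 e1 k0 by (simp add: uv mult.assoc mult.left_commute)
  have q2: "?k * (u' * v) \<le> card (C1 - C2)"
    using b2 e2 k0 by (simp add: uv mult.assoc mult.left_commute)
  have "?k * (u * v' + 1) < ?k * (u + u')" "?k * (u' * v + 1) < ?k * (v + v')"
    using q1 q2 l1 l2 h1 h2 by (simp_all add: distrib_left)
  then have r: "u * v' + 1 < u + u'" "u' * v + 1 < v + v'" by (simp_all only: mult_less_cancel1)
  \<comment> \<open>As \<open>u\<close> and \<open>v'\<close> are positive, the first inequality of
    \<open>r\<close> forces \<open>v' < u'\<close>; a positive \<open>v\<close> would turn the
    second into \<open>u' < v'\<close>.\<close>
  have "v = 0"
  proof (rule ccontr)
    assume "v \<noteq> 0"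
    obtain a where a: "u = Suc a" using u by (cases u) auto
    obtain b where b: "v' = Suc b" using v' by (cases v') auto
    obtain d where d: "v = Suc d" using \<open>v \<noteq> 0\<close> by (cases v) auto
    show False
    proof (cases u')
      case 0 then show ?thesis using r a b by simp
    next
      case (Suc e)
      then show ?thesis using r a b d by simp
    qed
  qed
  then have "v' < u + u'" using r u by (cases u) auto
  then show ?thesis using h1 h2 \<open>v = 0\<close> k0 by simp
qed

text \<open>A failure would make both differences of \<open>C1\<close> and \<open>C2\<close> so
  small that \<open>kneser_union_aux\<close> applies in both orders, with contradictory comparisons
  of the two stabilizers. The intersection of the stabilizers enters because it stabilizes the
  union.\<close>

lemma kneser_union:
  assumes C: "C1 \<subseteq> carrier G" "C2 \<subseteq> carrier G"
    and N: "N \<le> card C1 + card (stab C1)" "N \<le> card C2 + card (stab C2)"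
  shows "N \<le> card (C1 \<union> C2) + card (stab (C1 \<union> C2))"
proof (rule ccontr)
  assume neg: "\<not> ?thesis"
  let ?H1 = "stab C1" and ?H2 = "stab C2"
  have H: "subgroup ?H1 G" "subgroup ?H2 G" using C subgroup_stab by auto
  have "?H1 \<inter> ?H2 \<subseteq> stab (C1 \<union> C2)" by (auto simp: stab_def)
  moreover have "finite (stab (C1 \<union> C2))" by (simp add: stab_def)
  ultimately have K: "card (?H1 \<inter> ?H2) \<le> card (stab (C1 \<union> C2))" by (rule card_mono[rotated])
  have fin: "finite C1" "finite C2" using C by auto
  have "card (C1 \<union> C2) = card C1 + card (C2 - C1)" "card (C1 \<union> C2) = card C2 + card (C1 - C2)"
    using card_Un_disjoint[of C1 "C2 - C1"] card_Un_disjoint[of C2 "C1 - C2"] fin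
    by (simp_all add: Un_commute)
  then have l1: "card (C2 - C1) + card (?H1 \<inter> ?H2) < card ?H1"
    and l2: "card (C1 - C2) + card (?H1 \<inter> ?H2) < card ?H2"
    using N neg K by linarith+
  have "C2 - C1 \<noteq> {}"
  proof
    assume "C2 - C1 = {}"
    then have "C1 \<union> C2 = C1" by auto
    then show False using neg N by simp
  qed
  moreover have "C1 - C2 \<noteq> {}"
  proof
    assume "C1 - C2 = {}"
    then have "C1 \<union> C2 = C2" by auto
    then show False using neg N by simp
  qed
  ultimately obtain x y where "x \<in> C2 - C1" "y \<in> C1 - C2" by blast
  then have "card ?H2 < card ?H1" "card ?H1 < card ?H2"
    using kneser_union_aux[OF C H periodic_stab periodic_stab _ l1 l2, of x]
      kneser_union_aux[OF C(2,1) H(2,1) periodic_stab periodic_stab, of y] l1 l2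
    by (auto simp: Int_commute)
  then show False by simp
qed

text \<open>Dyson's e-transform \<open>(A \<union> e b\<inverse> B, B \<inter> b e\<inverse> A)\<close> keeps \<open>|A| + |B|\<close> and shrinks \<open>B\<close>, unless
  \<open>b\<inverse> B\<close> already stabilizes \<open>A\<close>.\<close>

lemma kneser_element:
  assumes "A \<subseteq> carrier G" "B \<subseteq> carrier G" "a \<in> A" "b \<in> B"
  shows "\<exists>C \<subseteq> A <#> B. a \<otimes> b \<in> C \<and> card A + card B \<le> card C + card (stab C)"
  using assms
proof (induction "card B" arbitrary: A B rule: less_induct)
  case less
  note A = less.prems(1) and B = less.prems(2) and a = less.prems(3) and b = less.prems(4)
  have ac: "a \<in> carrier G" and bc: "b \<in> carrier G" using A B a b by auto
  let ?tr = "\<lambda>e. (\<lambda>y. e \<otimes> inv b \<otimes> y) ` B"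
  show ?case
  proof (cases "\<exists>e\<in>A. \<not> ?tr e \<subseteq> A")
    case True
    then obtain e where e: "e \<in> A" "\<not> ?tr e \<subseteq> A" by blast
    have ec: "e \<in> carrier G" using e A by auto
    let ?g = "e \<otimes> inv b"
    have gc: "?g \<in> carrier G" using ec bc by simp
    define A' where "A' = A \<union> ?tr e"
    define B' where "B' = {y \<in> B. ?g \<otimes> y \<in> A}"
    have imB': "(\<lambda>y. ?g \<otimes> y) ` B' = A \<inter> ?tr e" by (auto simp: B'_def)
    have B'c: "B' \<subseteq> carrier G" using B by (auto simp: B'_def)
    have trc: "?tr e \<subseteq> carrier G" using gc B by auto
    have "B' \<noteq> B" using e by (auto simp: B'_def)
    then have lt: "card B' < card B" using B by (intro psubset_card_mono) (auto simp: B'_def)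
    have "card A' + card B' = card A + card B"
      using card_Un_Int[of A "?tr e"] imB' card_mult_image[OF gc B'c] card_mult_image[OF gc B] A trc
      unfolding A'_def by simp
    moreover have A'c: "A' \<subseteq> carrier G" using A trc by (simp add: A'_def)
    moreover have aA': "a \<in> A'" using a by (simp add: A'_def)
    moreover have bB': "b \<in> B'" using b e ec bc by (simp add: B'_def m_assoc)
    moreover have "A' <#> B' \<subseteq> A <#> B"
    proof
      fix z assume "z \<in> A' <#> B'"
      then obtain x y where xy: "x \<in> A'" "y \<in> B" "?g \<otimes> y \<in> A" "z = x \<otimes> y"
        by (auto simp: set_mult_def B'_def)
      show "z \<in> A <#> B"
      proof (cases "x \<in> A")
        case True then show ?thesis using xy by (auto simp: set_mult_def)
      next
        case False
        then obtain w where w: "w \<in> B" "x = ?g \<otimes> w" using xy by (auto simp: A'_def)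
        have "w \<in> carrier G" "y \<in> carrier G" using w xy B by auto
        then have "z = (?g \<otimes> y) \<otimes> w" using w xy gc by (simp add: m_ac)
        then show ?thesis using w xy by (auto simp: set_mult_def)
      qed
    qed
    ultimately show ?thesis using less.hyps[OF lt A'c B'c aA' bB'] by (metis subset_trans)
  next
    case False
    define C where "C = (\<lambda>y. b \<otimes> y) ` A"
    have "C \<subseteq> A <#> B"
    proof
      fix z assume "z \<in> C"
      then obtain e where e: "e \<in> A" "z = b \<otimes> e" by (auto simp: C_def)
      then have "z = e \<otimes> b" using A bc m_comm by blast
      then show "z \<in> A <#> B" using e b by (auto simp: set_mult_def)
    qed
    moreover have "a \<otimes> b \<in> C" unfolding C_def by (intro image_eqI[of _ _ a] m_comm ac bc a)
    moreover have "card C = card A" using A bc by (simp add: C_def)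
    moreover have "(\<lambda>y. inv b \<otimes> y) ` B \<subseteq> stab C"
    proof
      fix g assume "g \<in> (\<lambda>y. inv b \<otimes> y) ` B"
      then obtain y where y: "y \<in> B" "g = inv b \<otimes> y" by auto
      have yc: "y \<in> carrier G" using y B by auto
      have "g \<otimes> c \<in> C" if c: "c \<in> C" for c
      proof -
        obtain e where e: "e \<in> A" "c = b \<otimes> e" using c by (auto simp: C_def)
        have ec: "e \<in> carrier G" using e A by auto
        have "g \<otimes> c = b \<otimes> (e \<otimes> inv b \<otimes> y)" using e y ec yc bc by (simp add: m_ac)
        moreover have "e \<otimes> inv b \<otimes> y \<in> A" using False e y by auto
        ultimately show ?thesis by (auto simp: C_def)
      qed
      then show "g \<in> stab C" using y yc bc by (auto simp: stab_def)
    qed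
    then have "card ((\<lambda>y. inv b \<otimes> y) ` B) \<le> card (stab C)"
      by (rule card_mono[rotated]) (simp add: stab_def)
    then have "card B \<le> card (stab C)" using B bc by simp
    ultimately show ?thesis by (intro exI[of _ C]) auto
  qed
qed

text \<open>Each product lies in a subset of \<open>A <#> B\<close> that meets the bound
  (\<open>kneser_element\<close>), and unions of such subsets meet it again
  (\<open>kneser_union\<close>). The sets enter with their own sizes rather than as unions of
  cosets, so \<open>kneser_triple\<close> first passes to a union of cosets.\<close>

theorem kneser:
  assumes A: "A \<subseteq> carrier G" "A \<noteq> {}" and B: "B \<subseteq> carrier G" "B \<noteq> {}"
  shows "card A + card B \<le> card (A <#> B) + card (stab (A <#> B))"
proof -
  let ?N = "card A + card B"
  have ABc: "A <#> B \<subseteq> carrier G" using A B by (auto simp: set_mult_def)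
  have "\<forall>z\<in>A <#> B. \<exists>C \<subseteq> A <#> B. z \<in> C \<and> ?N \<le> card C + card (stab C)"
  proof
    fix z assume "z \<in> A <#> B"
    then obtain a b where "a \<in> A" "b \<in> B" "z = a \<otimes> b" by (auto simp: set_mult_def)
    then show "\<exists>C \<subseteq> A <#> B. z \<in> C \<and> ?N \<le> card C + card (stab C)"
      using kneser_element[OF A(1) B(1)] by simp
  qed
  then obtain F where F: "\<And>z. z \<in> A <#> B \<Longrightarrow> F z \<subseteq> A <#> B \<and> z \<in> F z \<and> ?N \<le> card (F z) + card (stab (F z))"
    by metis
  have "?N \<le> card (\<Union>(F ` Z)) + card (stab (\<Union>(F ` Z)))"
    if "finite Z" "Z \<noteq> {}" "Z \<subseteq> A <#> B" for Z
    using that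
  proof (induction Z rule: finite_ne_induct)
    case (singleton z) then show ?case using F[of z] by simp
  next
    case (insert z Z)
    have "\<Union>(F ` Z) \<subseteq> carrier G" "F z \<subseteq> carrier G" using insert F ABc by blast+
    then show ?case using kneser_union[of "F z" "\<Union>(F ` Z)" ?N] insert F[of z] by simp
  qed
  moreover have "\<Union>(F ` (A <#> B)) = A <#> B" using F by blast
  moreover have "A <#> B \<noteq> {}" using A B by (auto simp: set_mult_def)
  ultimately show ?thesis by (metis ABc finite_subset_carrier order_refl)
qed

end

section \<open>Cyclic extensions of subgroups\<close>

context finite_comm_group
begin

text \<open>The order of the image of \<open>x\<close> in the quotient by \<open>M\<close>; a
  positive exponent exists because \<open>G\<close> is finite (\<open>relord_props\<close>).\<close>

definition relord :: "'a set \<Rightarrow> 'a \<Rightarrow> nat"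
  where "relord M x = (LEAST l. 0 < l \<and> x [^] l \<in> M)"

text \<open>The preimage in \<open>adj M x\<close> of a set of residues modulo
  \<open>relord M x\<close>: the cyclic quotient of \<open>adj M x\<close> by \<open>M\<close> is
  handled through exponents alone, of which only the residues matter
  (\<open>blk_mod\<close>).\<close>

definition blk :: "'a set \<Rightarrow> 'a \<Rightarrow> nat set \<Rightarrow> 'a set"
  where "blk M x I = {x [^] i \<otimes> m | i m. i \<in> I \<and> m \<in> M}"

text \<open>The subgroup generated by \<open>M\<close> and \<open>x\<close>; nonnegative exponents
  suffice because inverses are powers in a finite group.\<close>

definition adj :: "'a set \<Rightarrow> 'a \<Rightarrow> 'a set"
  where "adj M x = blk M x UNIV"

lemma blkI: "i \<in> I \<Longrightarrow> m \<in> M \<Longrightarrow> x [^] i \<otimes> m \<in> blk M x I"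
  by (auto simp: blk_def)

lemma blkE:
  assumes "z \<in> blk M x I"
  obtains i m where "i \<in> I" "m \<in> M" "z = x [^] i \<otimes> m"
  using assms by (auto simp: blk_def)

lemma subgroup_nat_pow: "subgroup M G \<Longrightarrow> m \<in> M \<Longrightarrow> m [^] (i::nat) \<in> M"
  by (induction i) (auto intro: subgroup.m_closed subgroup.one_closed)

context
  fixes M x
  assumes M: "subgroup M G" and x: "x \<in> carrier G"
begin

lemma member_carrier: "m \<in> M \<Longrightarrow> m \<in> carrier G"
  using M by (rule subgroup.mem_carrier)

lemma relord_props: "0 < relord M x" "x [^] relord M x \<in> M"
proof -
  have "x [^] order G \<in> M" using pow_order_eq_1[OF x] M subgroup.one_closed by simp
  moreover have "0 < order G" by (simp add: order_gt_0_iff_finite)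
  ultimately have "0 < relord M x \<and> x [^] relord M x \<in> M"
    unfolding relord_def by (intro LeastI[of "\<lambda>l. 0 < l \<and> x [^] l \<in> M" "order G"] conjI)
  then show "0 < relord M x" "x [^] relord M x \<in> M" by auto
qed

lemma pow_mem_iff: "x [^] i \<in> M \<longleftrightarrow> relord M x dvd i"
proof -
  let ?l = "relord M x"
  have red: "x [^] i \<in> M \<longleftrightarrow> x [^] (i mod ?l) \<in> M" for i
  proof -
    have "x [^] i = x [^] (?l * (i div ?l)) \<otimes> x [^] (i mod ?l)"
      using x by (simp add: nat_pow_mult)
    also have "x [^] (?l * (i div ?l)) = (x [^] ?l) [^] (i div ?l)" using x by (simp add: nat_pow_pow)
    finally have e: "x [^] i = (x [^] ?l) [^] (i div ?l) \<otimes> x [^] (i mod ?l)" .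
    have "(x [^] ?l) [^] (i div ?l) \<in> M" using relord_props subgroup_nat_pow M by blast
    then show ?thesis unfolding e
      using x M subgroup.m_closed[OF M] periodic_inv[OF M, of M "(x [^] ?l) [^] (i div ?l)" "x [^] (i mod ?l)"]
      by (auto simp: periodic_def)
  qed
  have "x [^] (i mod ?l) \<in> M \<longleftrightarrow> i mod ?l = 0"
  proof
    assume a: "x [^] (i mod ?l) \<in> M"
    show "i mod ?l = 0"
    proof (rule ccontr)
      assume "i mod ?l \<noteq> 0"
      then have "?l \<le> i mod ?l" using a unfolding relord_def by (intro Least_le) auto
      then show False using mod_less_divisor[OF relord_props(1), of i] by simp
    qed
  next
    assume "i mod ?l = 0" then show "x [^] (i mod ?l) \<in> M" using M subgroup.one_closed by simp
  qed
  with red show ?thesis by (simp add: dvd_eq_mod_eq_0)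
qed

lemma pow_mult_eq_imp_mod_eq:
  assumes "x [^] i \<otimes> m = x [^] j \<otimes> m'" "m \<in> M" "m' \<in> M"
  shows "i mod relord M x = j mod relord M x"
proof -
  have *: "i mod relord M x = j mod relord M x"
    if "x [^] i \<otimes> m = x [^] j \<otimes> m'" "m \<in> M" "m' \<in> M" "j \<le> i" for i j m m'
  proof -
    obtain k where k: "i = j + k" using \<open>j \<le> i\<close> le_Suc_ex by blast
    have c: "m \<in> carrier G" "m' \<in> carrier G" using that member_carrier by auto
    have "x [^] j \<otimes> (x [^] k \<otimes> m) = x [^] j \<otimes> m'" using that(1) c x by (simp add: k m_assoc flip: nat_pow_mult)
    then have "x [^] k \<otimes> m = m'" using c x by simp
    then have "x [^] k = m' \<otimes> inv m" using c x by (simp add: inv_solve_right)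
    then have "x [^] k \<in> M" using that M by (simp add: subgroup.m_closed subgroup.m_inv_closed)
    then have "relord M x dvd k" by (simp add: pow_mem_iff)
    then show ?thesis by (auto simp: k elim!: dvdE)
  qed
  show ?thesis
    using *[of i m j m'] *[of j m' i m] assms by (cases "j \<le> i") auto
qed

lemma pow_mod: "\<exists>m\<in>M. x [^] i = x [^] (i mod relord M x) \<otimes> m"
proof -
  let ?l = "relord M x"
  have "x [^] i = x [^] (i mod ?l) \<otimes> x [^] (?l * (i div ?l))"
    using x by (simp add: nat_pow_mult)
  moreover have "x [^] (?l * (i div ?l)) \<in> M" by (simp add: pow_mem_iff)
  ultimately show ?thesis by blast
qed

lemma mem_blk_iff:
  assumes "m \<in> M"
  shows "x [^] i \<otimes> m \<in> blk M x I \<longleftrightarrow> i mod relord M x \<in> (\<lambda>i. i mod relord M x) ` I"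
proof
  assume "x [^] i \<otimes> m \<in> blk M x I"
  then obtain j m' where j: "j \<in> I" "m' \<in> M" "x [^] i \<otimes> m = x [^] j \<otimes> m'" by (rule blkE)
  then have "i mod relord M x = j mod relord M x" using pow_mult_eq_imp_mod_eq assms by blast
  then show "i mod relord M x \<in> (\<lambda>i. i mod relord M x) ` I" using j by (metis imageI)
next
  assume "i mod relord M x \<in> (\<lambda>i. i mod relord M x) ` I"
  then obtain j where j: "j \<in> I" "i mod relord M x = j mod relord M x" by auto
  obtain a where a: "a \<in> M" "x [^] i = x [^] (i mod relord M x) \<otimes> a" using pow_mod by blast
  obtain b where b: "b \<in> M" "x [^] j = x [^] (i mod relord M x) \<otimes> b" using pow_mod j by metis
  have c: "a \<in> carrier G" "b \<in> carrier G" "m \<in> carrier G" using a b assms member_carrier by auto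
  have "x [^] i \<otimes> m = x [^] j \<otimes> (a \<otimes> inv b \<otimes> m)"
    unfolding a(2) b(2) using c x by (simp add: ac_inv)
  moreover have "a \<otimes> inv b \<otimes> m \<in> M"
    using a b assms M by (simp add: subgroup.m_closed subgroup.m_inv_closed)
  ultimately show "x [^] i \<otimes> m \<in> blk M x I" using j by (simp add: blkI)
qed

lemma blk_subset: "blk M x I \<subseteq> carrier G"
  using x by (auto simp: blk_def member_carrier)

lemma blk_mod: "blk M x ((\<lambda>i. i mod relord M x) ` I) = blk M x I"
proof -
  have "z \<in> blk M x ((\<lambda>i. i mod relord M x) ` I) \<longleftrightarrow> z \<in> blk M x I" for z
  proof (cases "z \<in> blk M x UNIV")
    case True
    then obtain i m where "z = x [^] (i::nat) \<otimes> m" "m \<in> M" by (elim blkE)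
    then show ?thesis by (simp add: mem_blk_iff image_image)
  next
    case False
    then show ?thesis by (auto simp: blk_def)
  qed
  then show ?thesis by blast
qed

lemma card_blk: "card (blk M x I) = card ((\<lambda>i. i mod relord M x) ` I) * card M"
proof -
  let ?J = "(\<lambda>i. i mod relord M x) ` I"
  have "blk M x ?J = (\<lambda>(i, m). x [^] i \<otimes> m) ` (?J \<times> M)" by (auto simp: blk_def)
  moreover have "inj_on (\<lambda>(i, m). x [^] i \<otimes> m) (?J \<times> M)"
  proof (rule inj_onI)
    fix p q assume pq: "p \<in> ?J \<times> M" "q \<in> ?J \<times> M"
      and "(\<lambda>(i, m). x [^] i \<otimes> m) p = (\<lambda>(i, m). x [^] i \<otimes> m) q"
    then have e: "x [^] fst p \<otimes> snd p = x [^] fst q \<otimes> snd q" by (simp add: case_prod_beta)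
    from pq have "snd p \<in> M" "snd q \<in> M" by auto
    then have "fst p mod relord M x = fst q mod relord M x" using e pow_mult_eq_imp_mod_eq by blast
    then have f: "fst p = fst q" using pq by auto
    have "snd p = snd q" using e \<open>snd p \<in> M\<close> \<open>snd q \<in> M\<close> x by (simp add: f member_carrier)
    with f show "p = q" by (simp add: prod_eq_iff)
  qed
  ultimately have "card (blk M x ?J) = card (?J \<times> M)" by (simp add: card_image)
  then show ?thesis by (simp add: blk_mod card_cartesian_product)
qed

lemma card_blk_lessThan:
  assumes "\<And>i. i \<in> I \<Longrightarrow> i < relord M x" shows "card (blk M x I) = card I * card M"
proof -
  have "(\<lambda>i. i mod relord M x) ` I = (\<lambda>i. i) ` I"
    by (rule image_cong[OF refl]) (simp add: assms)
  then show ?thesis by (simp add: card_blk)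
qed

lemma blk_mult: "blk M x I <#> blk M x J = blk M x {i + j | i j. i \<in> I \<and> j \<in> J}"
proof (intro equalityI subsetI)
  fix z assume "z \<in> blk M x I <#> blk M x J"
  then obtain a b where ab: "a \<in> blk M x I" "b \<in> blk M x J" "z = a \<otimes> b"
    by (auto simp: set_mult_def)
  obtain i m where im: "i \<in> I" "m \<in> M" "a = x [^] i \<otimes> m" using ab(1) by (rule blkE)
  obtain j m' where jm: "j \<in> J" "m' \<in> M" "b = x [^] j \<otimes> m'" using ab(2) by (rule blkE)
  have ij: "i \<in> I" "j \<in> J" "m \<in> M" "m' \<in> M" "z = (x [^] i \<otimes> m) \<otimes> (x [^] j \<otimes> m')"
    using ab im jm by auto
  then have "z = x [^] (i + j) \<otimes> (m \<otimes> m')"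
    using x by (simp add: member_carrier m_ac flip: nat_pow_mult)
  moreover have "m \<otimes> m' \<in> M" using ij(3,4) by (rule subgroup.m_closed[OF M])
  ultimately show "z \<in> blk M x {i + j | i j. i \<in> I \<and> j \<in> J}"
    using ij(1,2) by (auto intro!: blkI)
next
  fix z assume "z \<in> blk M x {i + j | i j. i \<in> I \<and> j \<in> J}"
  then obtain k m where "k \<in> {i + j | i j. i \<in> I \<and> j \<in> J}" "m \<in> M" "z = x [^] k \<otimes> m"
    by (rule blkE)
  then obtain i j where ij: "i \<in> I" "j \<in> J" "m \<in> M" "z = x [^] (i + j) \<otimes> m" by blast
  then have "z = (x [^] i \<otimes> m) \<otimes> (x [^] j \<otimes> \<one>)"
    using x by (simp add: member_carrier m_ac flip: nat_pow_mult)
  then show "z \<in> blk M x I <#> blk M x J"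
    using blkI[OF ij(1,3), of x] blkI[OF ij(2) subgroup.one_closed[OF M], of x]
    by (auto simp: set_mult_def)
qed

lemma periodic_blk: "periodic M (blk M x I)"
  unfolding periodic_def
proof (intro ballI)
  fix h c assume "h \<in> M" "c \<in> blk M x I"
  then obtain i m where im: "i \<in> I" "m \<in> M" "c = x [^] i \<otimes> m" by (elim blkE)
  then have "h \<otimes> c = x [^] i \<otimes> (h \<otimes> m)" using x \<open>h \<in> M\<close> by (simp add: member_carrier m_ac)
  moreover have "h \<otimes> m \<in> M" using \<open>h \<in> M\<close> im(2) by (rule subgroup.m_closed[OF M])
  ultimately show "h \<otimes> c \<in> blk M x I" using im by (simp add: blkI)
qed

lemma subset_adj: "M \<subseteq> adj M x"
proof
  fix m assume "m \<in> M"
  then have "x [^] (0::nat) \<otimes> m \<in> adj M x" unfolding adj_def by (intro blkI) auto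
  then show "m \<in> adj M x" using \<open>m \<in> M\<close> by (simp add: member_carrier)
qed

lemma pow_mem_adj: "x [^] (i::nat) \<in> adj M x"
proof -
  have "x [^] i \<otimes> \<one> \<in> adj M x" unfolding adj_def
    using subgroup.one_closed[OF M] by (intro blkI) auto
  then show ?thesis using x by simp
qed

lemma mem_adj: "x \<in> adj M x"
  using pow_mem_adj[of 1] x by simp

lemma adj_eq: "adj M x = blk M x {..<relord M x}"
proof -
  have "(\<lambda>i. i mod relord M x) ` UNIV = {..<relord M x}"
  proof (intro equalityI subsetI)
    fix i assume "i \<in> {..<relord M x}"
    then have "i = i mod relord M x" by simp
    then show "i \<in> (\<lambda>i. i mod relord M x) ` UNIV" by blast
  qed (use relord_props(1) in auto)
  then show ?thesis unfolding adj_def using blk_mod[of UNIV] by simp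
qed

lemma card_adj: "card (adj M x) = relord M x * card M"
  using card_blk_lessThan[of "{..<relord M x}"] by (simp add: adj_eq)

lemma subgroup_adj: "subgroup (adj M x) G"
proof
  show "adj M x \<subseteq> carrier G" by (simp add: adj_def blk_subset)
  show "\<one> \<in> adj M x" using subset_adj subgroup.one_closed[OF M] by blast
  show mult: "a \<otimes> b \<in> adj M x" if "a \<in> adj M x" "b \<in> adj M x" for a b
  proof -
    have "a \<otimes> b \<in> adj M x <#> adj M x" using that by (auto simp: set_mult_def)
    also have "\<dots> \<subseteq> adj M x" unfolding adj_def blk_mult by (auto simp: blk_def)
    finally show ?thesis .
  qed
  show "inv a \<in> adj M x" if a: "a \<in> adj M x" for a
  proof -
    have ac: "a \<in> carrier G" using a blk_subset by (auto simp: adj_def)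
    have p: "a [^] i \<in> adj M x" for i :: nat
    proof (induction i)
      case 0 show ?case using subset_adj subgroup.one_closed[OF M] by auto
    next
      case (Suc i) then show ?case using mult[OF _ a] by simp
    qed
    obtain k where k: "order G = Suc k" using order_gt_0_iff_finite gr0_implies_Suc by blast
    have "a [^] k \<otimes> a = \<one>" using pow_order_eq_1[OF ac] by (simp add: k)
    then have "a [^] k = inv a" using ac by (metis inv_equality nat_pow_closed)
    then show ?thesis using p by metis
  qed
qed

lemma adj_subset:
  assumes "subgroup N G" "M \<subseteq> N" "x \<in> N" shows "adj M x \<subseteq> N"
proof
  fix z assume "z \<in> adj M x"
  then obtain i :: nat and m where im: "m \<in> M" "z = x [^] i \<otimes> m" unfolding adj_def by (elim blkE)
  have "x [^] i \<in> N" "m \<in> N" using assms subgroup_nat_pow im by auto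
  then show "z \<in> N" unfolding im(2) by (rule subgroup.m_closed[OF assms(1)])
qed

lemma relord_eqI_prime:
  assumes "Factorial_Ring.prime p" "x [^] p \<in> M" "x \<notin> M"
  shows "relord M x = p"
proof -
  have "relord M x dvd p" using assms pow_mem_iff by blast
  moreover have "relord M x \<noteq> 1" using assms(3) x relord_props(2) by auto
  ultimately show ?thesis using assms(1) prime_nat_iff by blast
qed

end

lemma subgroup_card_dvd: "subgroup M G \<Longrightarrow> card M dvd order G"
  using lagrange[of M] by (metis dvd_triv_right)

lemma subgroup_one: "subgroup {\<one>} G"
  by (rule triv_subgroup)

section \<open>Subgroups of prescribed order\<close>

lemma exists_prime_step:
  assumes L: "subgroup L G" and N: "subgroup N G" and "L \<subset> N"
  obtains x q where "x \<in> N" "x \<notin> L" "Factorial_Ring.prime q" "x [^] (q::nat) \<in> L"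
proof -
  obtain y where y: "y \<in> N" "y \<notin> L" using assms(3) by blast
  have yc: "y \<in> carrier G" using N y(1) by (rule subgroup.mem_carrier)
  let ?l = "relord L y"
  have "?l \<noteq> 1" using relord_props(2)[OF L yc] y yc by auto
  then obtain q where q: "Factorial_Ring.prime q" "q dvd ?l" using prime_factor_nat by blast
  \<comment> \<open>The power \<open>y [^] k\<close> has the prime order \<open>q\<close> modulo
    \<open>L\<close>.\<close>
  then obtain k where k: "?l = q * k" by blast
  have "0 < k" "k < ?l" using relord_props(1)[OF L yc] k prime_gt_1_nat[OF q(1)] by (auto intro: gr0I)
  then have "\<not> ?l dvd k" using dvd_imp_le by fastforce
  then have "y [^] k \<notin> L" by (simp add: pow_mem_iff[OF L yc])
  moreover have "(y [^] k) [^] q \<in> L" using relord_props(2)[OF L yc] k yc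
    by (simp add: nat_pow_pow mult.commute)
  moreover have "y [^] k \<in> N" using N y(1) by (rule subgroup_nat_pow)
  ultimately show ?thesis using that q by blast
qed

lemma exists_prime_step_index:
  assumes M: "subgroup M G" and p: "Factorial_Ring.prime (p::nat)" and d: "p * card M dvd order G"
  obtains x where "x \<in> carrier G" "x \<notin> M" "x [^] p \<in> M"
proof -
  have nM: "M \<lhd> G" using M by (rule subgroup_imp_normal)
  interpret Q: group "G Mod M" using nM by (rule normal.factorgroup_is_group)
  have fin: "finite (carrier (G Mod M))" by (simp add: carrier_FactGroup)
  have ca: "carrier (G Mod M) = rcosets M" by (simp add: FactGroup_def)
  have "card (rcosets M) * card M = order G" using lagrange[OF M] by (simp add: mult.commute)
  then have "p dvd card (rcosets M)"
    using d subgroup_card_pos[OF M] by (metis dvd_times_right_cancel_iff neq0_conv)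
  then obtain m where "order (G Mod M) = p ^ 1 * m" by (auto simp: order_def ca)
  \<comment> \<open>Sylow's theorem with exponent 1 gives a subgroup of order \<open>p\<close> in
    the quotient; any coset in it other than \<open>M\<close> supplies \<open>x\<close>.\<close>
  from sylow_thm[OF p Q.is_group this fin]
  obtain H where H: "subgroup H (G Mod M)" "card H = p" by auto
  have "\<not> H \<subseteq> {M}"
  proof
    assume "H \<subseteq> {M}"
    then have "card H \<le> 1" using card_mono[of "{M}" H] by simp
    then show False using H prime_gt_1_nat[OF p] by simp
  qed
  then obtain Y where Y: "Y \<in> H" "Y \<noteq> M" by blast
  then have Yc: "Y \<in> carrier (G Mod M)" using subgroup.mem_carrier[OF H(1)] by simp
  then obtain x where x: "x \<in> carrier G" "Y = M #> x" by (auto simp: carrier_FactGroup)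
  interpret H: group "(G Mod M)\<lparr>carrier := H\<rparr>" using H(1) Q.is_group by (rule subgroup.subgroup_is_group)
  have "Y [^]\<^bsub>(G Mod M)\<lparr>carrier := H\<rparr>\<^esub> p = \<one>\<^bsub>G Mod M\<^esub>"
    using H.pow_order_eq_1[of Y] Y H by (simp add: order_def)
  then have "Y [^]\<^bsub>G Mod M\<^esub> p = M" by (simp flip: Q.nat_pow_consistent)
  then have "M #> (x [^] p) = M" using normal.FactGroup_pow[OF nM x(1)] x by simp
  then have "x [^] p \<in> M" using coset_join1[OF _ _ M] x(1) by simp
  moreover have "x \<notin> M" using Y x coset_join2[OF x(1) M] by auto
  ultimately show ?thesis using that x by blast
qed

text \<open>The converse of Lagrange's theorem relative to \<open>M\<close>, for abelian groups:
  adjoin an element of prime relative order for one prime factor of \<open>k\<close> at a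
  time.\<close>

lemma exists_supergroup:
  assumes "subgroup M G" "card M * k dvd order G"
  shows "\<exists>N. subgroup N G \<and> M \<subseteq> N \<and> card N = card M * k"
  using assms
proof (induction k arbitrary: M rule: less_induct)
  case (less k)
  note M = less.prems(1) and d = less.prems(2)
  have "k \<noteq> 0" using d order_gt_0_iff_finite by (metis dvd_0_left_iff finite_carrier mult_0_right neq0_conv)
  show ?case
  proof (cases "k = 1")
    case True then show ?thesis using M by auto
  next
    case False
    then obtain p where p: "Factorial_Ring.prime p" "p dvd k" using prime_factor_nat by blast
    then obtain j where j: "k = p * j" by blast
    have "p * card M dvd order G" using d by (auto simp: j ac_simps elim: dvd_mult_left)
    then obtain x where x: "x \<in> carrier G" "x \<notin> M" "x [^] p \<in> M"
      using exists_prime_step_index[OF M p(1)] by blast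
    have c: "card (adj M x) = p * card M"
      using card_adj[OF M x(1)] relord_eqI_prime[OF M x(1) p(1) x(3,2)] by simp
    have "j < k" using j \<open>k \<noteq> 0\<close> prime_gt_1_nat[OF p(1)] by simp
    moreover have "card (adj M x) * j dvd order G" using d by (simp add: c j ac_simps)
    ultimately obtain N where "subgroup N G" "adj M x \<subseteq> N" "card N = card (adj M x) * j"
      using less.IH subgroup_adj[OF M x(1)] by blast
    then show ?thesis using subset_adj[OF M x(1)] by (auto simp: c j ac_simps)
  qed
qed

lemma exists_subgroup_card:
  assumes "k dvd order G" obtains N where "subgroup N G" "card N = k"
  using exists_supergroup[OF subgroup_one, of k] assms by auto

end

section \<open>Incomplete sets, and orders with a prime divisor congruent to 2 modulo 3\<close>

text \<open>A prime factor congruent to 1 can be split off without changing the residue, and one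
  congruent to 0 cannot occur, so repeated splitting must meet a factor congruent to 2.\<close>

lemma exists_prime_factor_2_mod_3:
  "(d::nat) mod 3 = 2 \<Longrightarrow> \<exists>q. Factorial_Ring.prime q \<and> q dvd d \<and> q mod 3 = 2"
proof (induction d rule: less_induct)
  case (less d)
  then have "d \<noteq> 1" "d \<noteq> 0" by auto
  then obtain q where q: "Factorial_Ring.prime q" "q dvd d" using prime_factor_nat by blast
  then obtain e where e: "d = q * e" by blast
  have eq: "(q mod 3) * (e mod 3) mod 3 = 2" using less.prems by (simp add: e mod_mult_eq)
  have "q mod 3 = 0 \<or> q mod 3 = 1 \<or> q mod 3 = 2" by linarith
  then show ?case
  proof (elim disjE)
    assume "q mod 3 = 1"
    then have "e mod 3 = 2" using eq by simp
    moreover have "e < d" using e \<open>d \<noteq> 0\<close> prime_gt_1_nat[OF q(1)] by simp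
    ultimately show ?thesis using less.IH[of e] e by auto
  qed (use eq q in auto)
qed

lemma triple_sums_lessThan:
  assumes "1 \<le> k"
  shows "{i + j | i j. i \<in> {i + j | i j. i \<in> {..<k} \<and> j \<in> {..<k}} \<and> j \<in> {..<k}} = {..<3 * k - 2 :: nat}"
    (is "?L = ?R")
proof (intro equalityI subsetI)
  fix m assume m: "m \<in> ?R"
  \<comment> \<open>Greedy splitting: each summand takes as much of \<open>m\<close> as the bound
    \<open>k - 1\<close> allows.\<close>
  define i where "i = min m (k - 1)"
  define j where "j = min (m - i) (k - 1)"
  define l where "l = m - i - j"
  have "i < k" "j < k" "l < k" "m = (i + j) + l"
    using m assms by (auto simp: i_def j_def l_def)
  then show "m \<in> ?L" by blast
qed (use assms in auto)

lemma singleton_image_Collect: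
  assumes "P a" "\<And>x. P x \<Longrightarrow> f x = c" shows "{f x | x. P x} = {c}"
  using assms by auto

context finite_comm_group
begin

section \<open>Threefold sumsets and the critical number\<close>

definition triple :: "'a set \<Rightarrow> 'a set"
  where "triple A = A <#> A <#> A"

lemma mem_triple_iff: "z \<in> triple A \<longleftrightarrow> (\<exists>a\<in>A. \<exists>b\<in>A. \<exists>c\<in>A. z = a \<otimes> b \<otimes> c)"
  by (auto simp: triple_def set_mult_def)

lemma tripleI: "a \<in> A \<Longrightarrow> b \<in> A \<Longrightarrow> c \<in> A \<Longrightarrow> a \<otimes> b \<otimes> c \<in> triple A"
  by (auto simp: mem_triple_iff)

lemma set_multI: "a \<in> A \<Longrightarrow> b \<in> B \<Longrightarrow> a \<otimes> b \<in> A <#> B"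
  by (auto simp: set_mult_def)

lemma triple_mono: "A \<subseteq> B \<Longrightarrow> triple A \<subseteq> triple B"
  unfolding mem_triple_iff subset_iff by blast

lemma set_mult_subset: "A \<subseteq> carrier G \<Longrightarrow> B \<subseteq> carrier G \<Longrightarrow> A <#> B \<subseteq> carrier G"
  by (auto simp: set_mult_def)

lemma triple_subset: "A \<subseteq> carrier G \<Longrightarrow> triple A \<subseteq> carrier G"
  by (simp add: triple_def set_mult_subset)

lemma hfold_3:
  assumes A: "A \<subseteq> carrier G" shows "hfold G 3 A = triple A"
proof -
  have fp: "finprod G a {..<3} = a 0 \<otimes> a 1 \<otimes> a 2" if "a \<in> {..<3::nat} \<rightarrow> carrier G" for a
  proof -
    have e: "{..<3::nat} = insert 0 (insert 1 {2})" by auto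
    have c: "a 0 \<in> carrier G" "a 1 \<in> carrier G" "a 2 \<in> carrier G" using that by auto
    show ?thesis unfolding e using c by (simp add: m_assoc)
  qed
  show ?thesis
  proof (intro equalityI subsetI)
    fix z assume "z \<in> hfold G 3 A"
    then obtain a where a: "a \<in> {..<3::nat} \<rightarrow> A" "z = finprod G a {..<3}" by (auto simp: hfold_def)
    then have "z = a 0 \<otimes> a 1 \<otimes> a 2" using fp A by (auto simp: Pi_iff subset_iff)
    moreover have "a 0 \<in> A" "a 1 \<in> A" "a 2 \<in> A" using a by auto
    ultimately show "z \<in> triple A" by (auto simp: mem_triple_iff)
  next
    fix z assume "z \<in> triple A"
    then obtain u v w where uvw: "u \<in> A" "v \<in> A" "w \<in> A" "z = u \<otimes> v \<otimes> w" by (auto simp: mem_triple_iff)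
    define a where "a = (\<lambda>i::nat. if i = 0 then u else if i = 1 then v else w)"
    have "a \<in> {..<3} \<rightarrow> A" using uvw by (auto simp: a_def)
    moreover have "a \<in> {..<3} \<rightarrow> carrier G" using uvw A by (auto simp: a_def)
    then have "finprod G a {..<3} = a 0 \<otimes> a 1 \<otimes> a 2" by (rule fp)
    moreover have "a 0 = u" "a 1 = v" "a 2 = w" by (simp_all add: a_def)
    ultimately have "z = finprod G a {..<3}" using uvw(4) by simp
    with \<open>a \<in> {..<3} \<rightarrow> A\<close> show "z \<in> hfold G 3 A" by (auto simp: hfold_def)
  qed
qed

abbreviation incomplete :: "'a set \<Rightarrow> bool"
  where "incomplete \<equiv> h_incomplete G 3"

lemma incomplete_iff: "incomplete A \<longleftrightarrow> A \<noteq> {} \<and> A \<subseteq> carrier G \<and> triple A \<noteq> carrier G"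
  unfolding h_incomplete_def using hfold_3 by auto

text \<open>Reduces the maximum and the critical number to an upper bound and one set attaining it:
  every larger set is complete, so \<open>critical_number G 3 - 1\<close> is
  \<open>N\<close>.\<close>

lemma max_incomplete_characterization:
  assumes ub: "\<And>A. incomplete A \<Longrightarrow> card A \<le> N" and ex: "incomplete A0" "card A0 = N"
  shows "max_incomplete_size G 3 = N"
    and "incomplete_sizes G 3 = {card (triple A) | A. incomplete A \<and> card A = N}"
proof -
  have fin: "finite {card A |A. incomplete A}"
    by (rule finite_subset[of _ "{..N}"]) (use ub in auto)
  show "max_incomplete_size G 3 = N"
    unfolding max_incomplete_size_def by (rule Max_eqI[OF fin]) (use ub ex in auto)
  have "critical_number G 3 = N + 1"
    unfolding critical_number_def
  proof (rule Least_equality)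
    show "1 \<le> N + 1 \<and> (\<forall>A. A \<subseteq> carrier G \<and> N + 1 \<le> card A \<longrightarrow> hfold G 3 A = carrier G)"
    proof (intro conjI allI impI)
      fix A assume A: "A \<subseteq> carrier G \<and> N + 1 \<le> card A"
      show "hfold G 3 A = carrier G"
      proof (rule ccontr)
        assume "hfold G 3 A \<noteq> carrier G"
        moreover have "A \<noteq> {}" using A by auto
        ultimately have "incomplete A" using A by (auto simp: h_incomplete_def)
        then show False using ub A by fastforce
      qed
    qed simp
  next
    fix m assume m: "1 \<le> m \<and> (\<forall>A. A \<subseteq> carrier G \<and> m \<le> card A \<longrightarrow> hfold G 3 A = carrier G)"
    then have "\<not> m \<le> N" using ex by (auto simp: h_incomplete_def)
    then show "N + 1 \<le> m" by simp
  qed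
  then show "incomplete_sizes G 3 = {card (triple A) | A. incomplete A \<and> card A = N}"
    unfolding incomplete_sizes_def
    by (intro Collect_cong ex_cong1) (auto simp: hfold_3 incomplete_iff)
qed

section \<open>Kneser's bound for threefold sums\<close>

lemma stab_set_mult: "C \<subseteq> carrier G \<Longrightarrow> D \<subseteq> carrier G \<Longrightarrow> stab C \<subseteq> stab (C <#> D)"
proof
  fix g assume cd: "C \<subseteq> carrier G" "D \<subseteq> carrier G" and g: "g \<in> stab C"
  then have gc: "g \<in> carrier G" by (simp add: stab_def)
  have "g \<otimes> z \<in> C <#> D" if z: "z \<in> C <#> D" for z
  proof -
    obtain c d where c: "c \<in> C" "d \<in> D" "z = c \<otimes> d" using z by (auto simp: set_mult_def)
    then have "g \<otimes> z = (g \<otimes> c) \<otimes> d" using cd gc by (simp add: m_assoc subset_iff)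
    moreover have "g \<otimes> c \<in> C" using g c by (simp add: stab_def)
    ultimately show ?thesis using c by (auto simp: set_mult_def)
  qed
  then show "g \<in> stab (C <#> D)" using gc by (simp add: stab_def)
qed

text \<open>Enlarging \<open>A\<close> to a union of cosets of \<open>H\<close> leaves
  \<open>3A\<close> unchanged. The stabilizer of \<open>2B\<close> lies in that of
  \<open>3B\<close>, which is \<open>H\<close>, so both uses of Kneser's theorem, on
  \<open>B + B\<close> and on \<open>2B + B\<close>, lose at most \<open>card H\<close>.\<close>

lemma kneser_triple:
  assumes A: "A \<subseteq> carrier G" "A \<noteq> {}"
  defines "H \<equiv> stab (triple A)" and "B \<equiv> A <#> stab (triple A)"
  shows "subgroup H G" "A \<subseteq> B" "B \<subseteq> carrier G" "periodic H B" "triple B = triple A"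
    "2 * card B \<le> card (B <#> B) + card H" "3 * card B \<le> card (triple A) + 2 * card H"
proof -
  show H: "subgroup H G" unfolding H_def using A triple_subset subgroup_stab by blast
  have Hc: "H \<subseteq> carrier G" using H by (rule subgroup.subset)
  have B_eq: "B = A <#> H" by (simp add: B_def H_def)
  show AB: "A \<subseteq> B"
  proof
    fix a assume a: "a \<in> A"
    then have "a = a \<otimes> \<one>" using A by auto
    then show "a \<in> B" unfolding B_eq using a subgroup.one_closed[OF H] by (auto simp: set_mult_def)
  qed
  show Bc: "B \<subseteq> carrier G" unfolding B_eq using A(1) Hc by (rule set_mult_subset)
  show pB: "periodic H B" unfolding periodic_def
  proof (intro ballI)
    fix h b assume h: "h \<in> H" "b \<in> B"
    then obtain a k where ak: "a \<in> A" "k \<in> H" "b = a \<otimes> k" by (auto simp: B_eq set_mult_def)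
    have "h \<otimes> b = a \<otimes> (h \<otimes> k)" using ak h A Hc by (simp add: m_lcomm subset_iff)
    moreover have "h \<otimes> k \<in> H" using h(1) ak(2) by (rule subgroup.m_closed[OF H])
    ultimately show "h \<otimes> b \<in> B" using ak by (auto simp: B_eq set_mult_def)
  qed
  show tB: "triple B = triple A"
  proof
    show "triple A \<subseteq> triple B" using AB by (rule triple_mono)
    show "triple B \<subseteq> triple A"
    proof
      fix z assume "z \<in> triple B"
      then obtain a b c h k l where abc: "a \<in> A" "b \<in> A" "c \<in> A" "h \<in> H" "k \<in> H" "l \<in> H"
        "z = (a \<otimes> h) \<otimes> (b \<otimes> k) \<otimes> (c \<otimes> l)" by (auto simp: mem_triple_iff B_eq set_mult_def)
      have cc: "a \<in> carrier G" "b \<in> carrier G" "c \<in> carrier G" "h \<in> carrier G" "k \<in> carrier G" "l \<in> carrier G"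
        using abc A Hc by auto
      have "z = (h \<otimes> k \<otimes> l) \<otimes> (a \<otimes> b \<otimes> c)" using abc(7) cc by (simp add: m_ac)
      moreover have "h \<otimes> k \<otimes> l \<in> H" using abc by (intro subgroup.m_closed[OF H])
      moreover have "a \<otimes> b \<otimes> c \<in> triple A" using abc by (intro tripleI)
      ultimately show "z \<in> triple A" using periodic_stab[of "triple A"] by (auto simp: periodic_def H_def)
    qed
  qed
  have BBc: "B <#> B \<subseteq> carrier G" using Bc Bc by (rule set_mult_subset)
  have Bne: "B \<noteq> {}" using AB A by auto
  have BBne: "B <#> B \<noteq> {}" using Bne by (auto simp: set_mult_def)
  have HB: "H = stab (triple B)" by (simp add: H_def tB)
  have "stab (B <#> B) \<subseteq> stab (triple B)" unfolding triple_def
    by (rule stab_set_mult[OF BBc Bc])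
  then have "stab (B <#> B) \<subseteq> H" by (simp add: HB)
  then have "card (stab (B <#> B)) \<le> card H" using Hc by (intro card_mono) auto
  then show "2 * card B \<le> card (B <#> B) + card H" using kneser[OF Bc Bne Bc Bne] by linarith
  moreover have "card (B <#> B) + card B \<le> card (triple A) + card H"
    using kneser[OF BBc BBne Bc Bne, folded triple_def] by (simp add: H_def tB)
  ultimately show "3 * card B \<le> card (triple A) + 2 * card H" by linarith
qed

text \<open>Counts in cosets of \<open>H\<close>: \<open>d\<close> is the index, \<open>s\<close>
  and \<open>r\<close> are the numbers of cosets in \<open>B\<close> and in \<open>3A\<close>. The
  bound on \<open>3 * s\<close> together with \<open>r < d\<close> is the arithmetic core of all
  three cases.\<close>

lemma incomplete_parameters:
  assumes A: "incomplete A"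
  defines "H \<equiv> stab (triple A)" and "B \<equiv> A <#> stab (triple A)"
  obtains d s r where "order G = card H * d" "card B = card H * s" "card (triple A) = card H * r"
    "0 < r" "r < d" "3 * s \<le> r + 2" "card A \<le> card H * s" "0 < card H"
proof -
  have Ac: "A \<subseteq> carrier G" "A \<noteq> {}" "triple A \<noteq> carrier G" using A by (auto simp: incomplete_iff)
  note k = kneser_triple[OF Ac(1,2), folded H_def B_def]
  have Tc: "triple A \<subseteq> carrier G" using Ac(1) by (rule triple_subset)
  have h0: "0 < card H" using k(1) by (rule subgroup_card_pos)
  have pT: "periodic H (triple A)" unfolding H_def by (rule periodic_stab)
  obtain d where d: "order G = card H * d" using subgroup_card_dvd[OF k(1)] by blast
  obtain s where s: "card B = card H * s" using card_dvd_periodic[OF k(1,3,4)] by blast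
  obtain r where r: "card (triple A) = card H * r" using card_dvd_periodic[OF k(1) Tc pT] by blast
  have "card (triple A) < order G" unfolding order_def using Tc Ac(3) by (intro psubset_card_mono) auto
  then have rd: "r < d" using h0 by (simp add: d r)
  have "triple A \<noteq> {}" using Ac(2) by (auto simp: triple_def set_mult_def)
  then have r0: "0 < r" using r Tc by (intro gr0I) auto
  have "card H * (3 * s) \<le> card H * (r + 2)" using k(7) by (simp add: s r distrib_left mult.left_commute)
  then have "3 * s \<le> r + 2" using h0 by (simp only: mult_le_cancel1)
  moreover have "card A \<le> card H * s" using card_mono[OF _ k(2)] k(3) s by simp
  ultimately show ?thesis using that d s r rd r0 h0 by blast
qed

text \<open>Since \<open>r < d\<close>, the number \<open>3 * s\<close> is at most
  \<open>d + 1\<close>, with equality only for \<open>d\<close> congruent to 2. Such a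
  \<open>d\<close> has a prime factor congruent to 2, hence \<open>d \<ge> p\<close>, and
  \<open>h * (d + 1)\<close> exceeds \<open>order G\<close> by only \<open>h = order G / d\<close>.
  Equality forces \<open>d = p\<close> and a single missing coset.\<close>

lemma incomplete_card_le_prime:
  assumes A: "incomplete A"
    and p: "Factorial_Ring.prime p" "p dvd order G" "p mod 3 = 2"
    and pmin: "\<And>q. Factorial_Ring.prime q \<Longrightarrow> q dvd order G \<Longrightarrow> q mod 3 = 2 \<Longrightarrow> p \<le> q"
  shows "3 * p * card A \<le> (p + 1) * order G"
    and "3 * p * card A = (p + 1) * order G \<Longrightarrow> card (triple A) = order G - order G div p"
proof -
  obtain d s r where o: "order G = card (stab (triple A)) * d" and t: "card (triple A) = card (stab (triple A)) * r"
    and r: "0 < r" "r < d" "3 * s \<le> r + 2" and cA: "card A \<le> card (stab (triple A)) * s"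
    and h0: "0 < card (stab (triple A))"
    using incomplete_parameters[OF A] by metis
  define h where "h = card (stab (triple A))"
  note o = o[folded h_def] and t = t[folded h_def] and cA = cA[folded h_def] and h0 = h0[folded h_def]
  have p0: "0 < p" using p(1) prime_gt_0_nat by blast
  have c1: "3 * p * card A \<le> p * h * (3 * s)" using mult_le_mono2[OF cA, of "3 * p"] by (simp add: ac_simps)
  show "3 * p * card A \<le> (p + 1) * order G"
    and "3 * p * card A = (p + 1) * order G \<Longrightarrow> card (triple A) = order G - order G div p"
  proof -
    have "d mod 3 = 2 \<or> 3 * s \<le> d" using r by presburger
    then consider "d mod 3 = 2" | "3 * s \<le> d" by blast
    then have "3 * p * card A \<le> (p + 1) * order G \<and>
      (3 * p * card A = (p + 1) * order G \<longrightarrow> card (triple A) = order G - order G div p)"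
    proof cases
      case 1
      obtain q where q: "Factorial_Ring.prime q" "q dvd d" "q mod 3 = 2"
        using exists_prime_factor_2_mod_3[OF 1] by blast
      have "p \<le> q" using pmin[OF q(1) _ q(3)] q(2) by (simp add: o)
      moreover have "q \<le> d" using q(2) r by (intro dvd_imp_le) auto
      ultimately have pd: "p \<le> d" by simp
      have c2: "p * h * (3 * s) \<le> p * h * (d + 1)" using r by (intro mult_le_mono2) linarith
      have c3: "p * h * (d + 1) = p * order G + h * p" by (simp add: o algebra_simps)
      have c4: "(p + 1) * order G = p * order G + h * d" by (simp add: o algebra_simps)
      have c5: "h * p \<le> h * d" using pd by simp
      have "card (triple A) = order G - order G div p" if e: "3 * p * card A = (p + 1) * order G"
      proof -
        have "h * p = h * d" "p * h * (3 * s) = p * h * (d + 1)" using c1 c2 c3 c4 c5 e by linarith+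
        then have "p = d" "3 * s = d + 1" using h0 p0 by (simp_all only: mult_cancel1) auto
        then have "r = d - 1" using r by linarith
        then have "card (triple A) = h * d - h" by (simp add: t diff_mult_distrib2)
        then show ?thesis using \<open>p = d\<close> p0 by (simp add: o)
      qed
      then show ?thesis using c1 c2 c3 c4 c5 by linarith
    next
      case 2
      have "p * h * (3 * s) \<le> p * h * d" using 2 by (rule mult_le_mono2)
      also have "\<dots> = p * order G" by (simp add: o)
      also have "\<dots> < (p + 1) * order G" using r h0 by (simp add: o)
      finally show ?thesis using c1 by linarith
    qed
    then show "3 * p * card A \<le> (p + 1) * order G"
      and "3 * p * card A = (p + 1) * order G \<Longrightarrow> card (triple A) = order G - order G div p" by auto
  qed
qed

section \<open>Extremal progressions of cosets\<close>

lemma triple_blk: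
  assumes "subgroup M G" "x \<in> carrier G"
  shows "triple (blk M x I) = blk M x {i + j | i j. i \<in> {i + j | i j. i \<in> I \<and> j \<in> I} \<and> j \<in> I}"
  unfolding triple_def by (simp only: blk_mult[OF assms])

lemma triple_blk_lessThan:
  assumes "subgroup M G" "x \<in> carrier G" "1 \<le> k"
  shows "triple (blk M x {..<k}) = blk M x {..<3 * k - 2}"
  by (simp only: triple_blk[OF assms(1,2)] triple_sums_lessThan[OF assms(3)])

theorem incomplete_sizes_2_mod_3:
  assumes p: "Factorial_Ring.prime p" "p dvd order G" "p mod 3 = 2"
    and pmin: "\<And>q. Factorial_Ring.prime q \<Longrightarrow> q dvd order G \<Longrightarrow> q mod 3 = 2 \<Longrightarrow> p \<le> q"
  shows "3 * p * max_incomplete_size G 3 = (p + 1) * order G"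
    "incomplete_sizes G 3 = {order G - order G div p}"
proof -
  have p0: "0 < p" using p(1) prime_gt_0_nat by blast
  obtain h where h: "order G = p * h" using p(2) by blast
  have h0: "0 < h" using order_gt_0_iff_finite h by (intro gr0I) auto
  obtain H where H: "subgroup H G" "card H = h" using exists_subgroup_card[of h] h by auto
  obtain x where x: "x \<in> carrier G" "x \<notin> H" "x [^] p \<in> H"
    using exists_prime_step_index[OF H(1) p(1)] h H(2) by auto
  have l: "relord H x = p" using relord_eqI_prime[OF H(1) x(1) p(1) x(3,2)] .
  \<comment> \<open>The threefold sums of a progression of \<open>k\<close> cosets fill
    \<open>3 * k - 2 = p - 1\<close> cosets, one short of all \<open>p\<close>.\<close>
  define k where "k = (p + 1) div 3"
  have k: "3 * k = p + 1" "1 \<le> k" "k \<le> p" unfolding k_def using p(3) p0 by presburger+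
  define A where "A = blk H x {..<k}"
  have Ac: "A \<subseteq> carrier G" unfolding A_def using H(1) x(1) by (rule blk_subset)
  have cA: "card A = k * h" unfolding A_def using card_blk_lessThan[OF H(1) x(1), of "{..<k}"] k H l by simp
  have tA: "triple A = blk H x {..<p - 1}" unfolding A_def using triple_blk_lessThan[OF H(1) x(1) k(2)] k by simp
  then have "card (triple A) = (p - 1) * h" using card_blk_lessThan[OF H(1) x(1), of "{..<p - 1}"] l H(2) by simp
  moreover have "(p - 1) * h < order G" using h0 p0 by (simp add: h)
  ultimately have "triple A \<noteq> carrier G" by (auto simp: order_def)
  moreover have "A \<noteq> {}" using cA k h0 by auto
  ultimately have incA: "incomplete A" using Ac by (simp add: incomplete_iff)
  have "3 * p * (k * h) = p * h * (3 * k)" by (simp add: ac_simps)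
  then have e: "3 * p * (k * h) = (p + 1) * order G" unfolding k(1) by (simp add: h ac_simps)
  have ub: "card C \<le> k * h" if "incomplete C" for C
  proof -
    have "3 * p * card C \<le> 3 * p * (k * h)" unfolding e
      by (rule incomplete_card_le_prime(1)[OF that p pmin])
    then have "card C \<le> k * h \<or> 3 * p = 0" by (simp only: mult_le_cancel1) blast
    then show ?thesis using p0 by simp
  qed
  have m: "max_incomplete_size G 3 = k * h"
    "incomplete_sizes G 3 = {card (triple C) | C. incomplete C \<and> card C = k * h}"
    by (rule max_incomplete_characterization[OF ub incA cA], assumption)+
  show "3 * p * max_incomplete_size G 3 = (p + 1) * order G" using m(1) e by simp
  show "incomplete_sizes G 3 = {order G - order G div p}"
  proof -
    have "card (triple C) = order G - order G div p" if "incomplete C" "card C = k * h" for C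
      by (rule incomplete_card_le_prime(2)[OF that(1) p pmin]) (simp_all only: that(2) e)
    then show ?thesis unfolding m(2)
      by (intro singleton_image_Collect[where a = A]) (simp_all add: incA cA)
  qed
qed

text \<open>Any subset of \<open>M\<close> may be added to \<open>B\<close>: it does not change which elements outside \<open>M\<close> are threefold
  sums, so the sets with few missing sums can be constructed inside \<open>M\<close>.\<close>

definition outer_part :: "'a set \<Rightarrow> 'a set \<Rightarrow> bool"
  where "outer_part M B \<longleftrightarrow> B \<subseteq> carrier G - M \<and> periodic M B \<and> 3 * card B + card M = order G \<and>
    B <#> (B \<union> M) <#> (B \<union> M) = carrier G - M"

text \<open>One prime at a time: in an extension \<open>N\<close> of \<open>M\<close> of index
  \<open>p = 3 * k + 1\<close>, the levels 1 to \<open>k\<close> form a third of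
  \<open>N - M\<close>, and an outer part of \<open>N\<close> takes care of what lies outside
  \<open>N\<close>. The congruence on the primes makes these thirds exact.\<close>

lemma exists_outer_part:
  assumes "subgroup M G" "\<And>p. Factorial_Ring.prime p \<Longrightarrow> p dvd order G div card M \<Longrightarrow> p mod 3 = 1"
  shows "\<exists>B. outer_part M B"
  using assms
proof (induction "order G div card M" arbitrary: M rule: less_induct)
  case less
  note M = less.prems(1)
  have Mc: "M \<subseteq> carrier G" using M by (rule subgroup.subset)
  have one: "\<one> \<in> M" using M by (rule subgroup.one_closed)
  obtain d where d: "order G = card M * d" using subgroup_card_dvd[OF M] by blast
  have M0: "0 < card M" using M by (rule subgroup_card_pos)
  have d0: "0 < d" using d order_gt_0_iff_finite by (intro gr0I) auto
  have dd: "order G div card M = d" using M0 by (simp add: d)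
  show ?case
  proof (cases "d = 1")
    case True
    then have "M = carrier G" using Mc d by (intro card_subset_eq) (auto simp: order_def)
    then have "outer_part M {}" using True d by (auto simp: outer_part_def periodic_def set_mult_def)
    then show ?thesis by blast
  next
    case False
    then obtain p where p: "Factorial_Ring.prime p" "p dvd d" using prime_factor_nat by blast
    have p3: "p mod 3 = 1" using less.prems(2) p dd by simp
    have p1: "1 < p" using p(1) by (rule prime_gt_1_nat)
    obtain e where e: "d = p * e" using p(2) by blast
    have "p * card M dvd order G" by (simp add: d e)
    then obtain x where x: "x \<in> carrier G" "x \<notin> M" "x [^] p \<in> M"
      using exists_prime_step_index[OF M p(1)] by blast
    have l: "relord M x = p" using relord_eqI_prime[OF M x(1) p(1) x(3,2)] .
    define N where "N = adj M x"
    have N: "subgroup N G" "M \<subseteq> N" "card N = p * card M" "N \<subseteq> carrier G"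
      using subgroup_adj[OF M x(1)] subset_adj[OF M x(1)] card_adj[OF M x(1)] l subgroup.subset
      by (auto simp: N_def)
    have "order G div card N = e" using M0 p1 by (simp add: d e N(3) ac_simps)
    moreover have "e < d" using e d0 p1 by simp
    ultimately obtain C where C: "outer_part N C"
      using less.hyps[of N] N(1) dd less.prems(2) e by (metis dvd_mult)
    define k where "k = (p - 1) div 3"
    have k: "p = 3 * k + 1" "1 \<le> k" using p3 p1 unfolding k_def by presburger+
    define D where "D = blk M x {1..k}"
    have Dc: "D \<subseteq> carrier G" unfolding D_def by (rule blk_subset[OF M x(1)])
    have cD: "card D = k * card M" unfolding D_def
      using card_blk_lessThan[OF M x(1), of "{1..k}"] l k by simp
    have Mblk: "M = blk M x {0}" using Mc by (force simp: blk_def)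
    have DM: "D \<union> M = blk M x {..k}"
    proof -
      have "D \<union> M = blk M x {1..k} \<union> blk M x {0}" using Mblk by (simp add: D_def)
      also have "\<dots> = blk M x ({1..k} \<union> {0})" unfolding blk_def by blast
      also have "{1..k} \<union> {0} = {..k}" by auto
      finally show ?thesis .
    qed
    have "D <#> (D \<union> M) <#> (D \<union> M) = blk M x {1..<p}"
    proof -
      \<comment> \<open>Levels add without wrapping around: one summand from 1 to \<open>k\<close>
        and two from 0 to \<open>k\<close> reach exactly 1 to \<open>3 * k = p - 1\<close>, all
        levels except that of \<open>M\<close>.\<close>
      have "{i + j | i j. i \<in> {i + j | i j. i \<in> {1..k} \<and> j \<in> {..k}} \<and> j \<in> {..k}} = {1..<p}" (is "?L = ?R")
      proof (intro equalityI subsetI)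
        fix m assume m: "m \<in> ?R"
        define i where "i = min m k"
        define j where "j = min (m - i) k"
        define t where "t = m - i - j"
        have "i \<in> {1..k}" "j \<in> {..k}" "t \<in> {..k}" "m = (i + j) + t"
          using m k by (auto simp: i_def j_def t_def)
        then show "m \<in> ?L" by blast
      qed (use k in auto)
      then show ?thesis unfolding DM unfolding D_def by (simp only: blk_mult[OF M x(1)])
    qed
    also have "blk M x {1..<p} = N - M"
    proof -
      have "z \<in> blk M x {1..<p} \<longleftrightarrow> z \<in> N \<and> z \<notin> M" for z
      proof (cases "z \<in> N")
        case True
        then obtain i :: nat and m where im: "m \<in> M" "z = x [^] i \<otimes> m" unfolding N_def adj_def by (elim blkE)
        have a: "(\<lambda>i. i mod p) ` {1..<p} = {1..<p}" by (force intro!: image_eqI)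
        have "z \<in> M \<longleftrightarrow> z \<in> blk M x {0}" using Mblk by simp
        also have "\<dots> \<longleftrightarrow> i mod p = 0" by (simp add: im(2) mem_blk_iff[OF M x(1) im(1)] l)
        finally show ?thesis using True p1 by (simp add: im(2) mem_blk_iff[OF M x(1) im(1)] l a Suc_le_eq)
      next
        case False
        then show ?thesis by (auto simp: N_def adj_def blk_def)
      qed
      then show ?thesis by auto
    qed
    finally have DDD: "D <#> (D \<union> M) <#> (D \<union> M) = N - M" .
    have DN: "D \<subseteq> N - M"
    proof
      fix z assume z: "z \<in> D"
      then have "z \<otimes> \<one> \<otimes> \<one> \<in> D <#> (D \<union> M) <#> (D \<union> M)" using one unfolding set_mult_def by blast
      then show "z \<in> N - M" using z Dc DDD by auto
    qed
    have Cp: "C \<subseteq> carrier G - N" "periodic N C" "3 * card C + card N = order G"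
      "C <#> (C \<union> N) <#> (C \<union> N) = carrier G - N" using C by (auto simp: outer_part_def)
    have "outer_part M (C \<union> D)"
      unfolding outer_part_def
    proof (intro conjI)
      show "C \<union> D \<subseteq> carrier G - M" using Cp(1) DN Dc N by auto
      show "periodic M (C \<union> D)"
        using Cp(2) N(2) periodic_blk[OF M x(1)] unfolding D_def by (auto simp: periodic_def)
      have "C \<subseteq> carrier G" "C \<inter> D = {}" using Cp(1) DN by auto
      then have "card (C \<union> D) = card C + card D" using Dc by (intro card_Un_disjoint) simp_all
      then show "3 * card (C \<union> D) + card M = order G" using cD Cp(3) N(3) k by (simp add: algebra_simps)
      show "(C \<union> D) <#> (C \<union> D \<union> M) <#> (C \<union> D \<union> M) = carrier G - M" (is "?L = ?R")
      proof (intro equalityI subsetI)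
        fix z assume "z \<in> ?L"
        then obtain a b c where abc: "a \<in> C \<union> D" "b \<in> C \<union> D \<union> M" "c \<in> C \<union> D \<union> M" "z = a \<otimes> b \<otimes> c"
          by (auto simp: set_mult_def)
        have car: "a \<in> carrier G" "b \<in> carrier G" "c \<in> carrier G" using abc Cp(1) Dc Mc by auto
        have *: "u \<otimes> v \<otimes> w \<in> carrier G - N" if uvw: "u \<in> C" "v \<in> C \<union> N" "w \<in> C \<union> N" for u v w
          unfolding Cp(4)[symmetric] set_mult_def using uvw by blast
        have bN: "b \<in> C \<union> N" "c \<in> C \<union> N" "a \<in> C \<union> N" using abc DN N by auto
        consider "a \<in> C" | "b \<in> C" | "c \<in> C" | "a \<in> D" "b \<in> D \<union> M" "c \<in> D \<union> M" using abc by auto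
        then have "z \<in> carrier G - N \<or> z \<in> N - M"
        proof cases
          case 1 then show ?thesis using * bN abc by simp
        next
          case 2 then show ?thesis using *[of b a c] bN abc car by (simp add: m_comm)
        next
          case 3 then show ?thesis using *[of c a b] bN abc car by (simp add: m_ac)
        next
          case 4
          then have "a \<otimes> b \<otimes> c \<in> D <#> (D \<union> M) <#> (D \<union> M)" unfolding set_mult_def by blast
          then show ?thesis using abc DDD by simp
        qed
        then show "z \<in> ?R" using N by auto
      next
        fix z assume z: "z \<in> ?R"
        show "z \<in> ?L"
        proof (cases "z \<in> N")
          case True
          then have "z \<in> D <#> (D \<union> M) <#> (D \<union> M)" using z DDD by simp
          moreover have "D <#> (D \<union> M) <#> (D \<union> M) \<subseteq> ?L" by (intro mono_set_mult) auto
          ultimately show ?thesis by blast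
        next
          case False
          \<comment> \<open>\<open>C\<close> is invariant under \<open>N\<close>, so a summand from
            \<open>N\<close> can be moved into the one from \<open>C\<close>, leaving
            \<open>\<one>\<close>, an element of \<open>M\<close>, in its place.\<close>
          have absorb: "\<exists>a'\<in>C. \<exists>b'\<in>C \<union> M. a \<otimes> b = a' \<otimes> b'" if ab: "a \<in> C" "b \<in> C \<union> N" for a b
          proof (cases "b \<in> C")
            case True then show ?thesis using ab by blast
          next
            case False
            then have "b \<in> N" using ab by simp
            then have "b \<otimes> a \<in> C" using periodicD[OF Cp(2) _ ab(1)] by simp
            moreover have "a \<in> carrier G" "b \<in> carrier G" using ab(1) Cp(1) \<open>b \<in> N\<close> N by auto
            then have "a \<otimes> b = (b \<otimes> a) \<otimes> \<one>" by (simp add: m_comm)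
            ultimately show ?thesis using one by blast
          qed
          have "z \<in> C <#> (C \<union> N) <#> (C \<union> N)" using z False Cp(4) by auto
          then obtain a b c where abc: "a \<in> C" "b \<in> C \<union> N" "c \<in> C \<union> N" "z = a \<otimes> b \<otimes> c"
            by (auto simp: set_mult_def)
          obtain a' b' where ab': "a' \<in> C" "b' \<in> C \<union> M" "a \<otimes> b = a' \<otimes> b'" using absorb abc by blast
          obtain a'' c' where ac': "a'' \<in> C" "c' \<in> C \<union> M" "a' \<otimes> c = a'' \<otimes> c'" using absorb ab'(1) abc(3) by blast
          have car: "a \<in> carrier G" "b \<in> carrier G" "c \<in> carrier G" "a' \<in> carrier G" "b' \<in> carrier G"
            "a'' \<in> carrier G" "c' \<in> carrier G" using abc ab' ac' Cp(1) Mc N(4) by auto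
          have "z = (a' \<otimes> c) \<otimes> b'" using abc(4) ab'(3) car by (simp add: m_ac)
          also have "\<dots> = a'' \<otimes> c' \<otimes> b'" using ac'(3) by simp
          finally show ?thesis using ab' ac' by (auto intro!: set_multI)
        qed
      qed
    qed
    then show ?thesis by blast
  qed
qed

text \<open>A threefold sum with a term in \<open>B\<close> stays outside \<open>M\<close> and one
  without stays inside, so the two parts do not interfere. The former still cover everything outside
  \<open>M\<close>, although only \<open>A\<close> and not all of \<open>M\<close> is at hand,
  because \<open>B\<close> is invariant under \<open>M\<close>.\<close>

lemma outer_part_triple:
  assumes M: "subgroup M G" and B: "outer_part M B" and A: "A \<subseteq> M" "A \<noteq> {}"
  shows "triple (A \<union> B) = triple A \<union> (carrier G - M)"
    and "card (triple (A \<union> B)) = card (triple A) + (order G - card M)"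
    and "3 * card (A \<union> B) + card M = 3 * card A + order G"
    and "triple A \<noteq> M \<Longrightarrow> incomplete (A \<union> B)"
proof -
  have Mc: "M \<subseteq> carrier G" using M by (rule subgroup.subset)
  have Bp: "B \<subseteq> carrier G - M" "periodic M B" "3 * card B + card M = order G"
      "B <#> (B \<union> M) <#> (B \<union> M) = carrier G - M" using B by (auto simp: outer_part_def)
  have tAM: "triple A \<subseteq> M"
    using A(1) by (auto simp: mem_triple_iff intro!: subgroup.m_closed[OF M])
  show t: "triple (A \<union> B) = triple A \<union> (carrier G - M)"
  proof (intro equalityI subsetI)
    fix z assume "z \<in> triple (A \<union> B)"
    then obtain a b c where abc: "a \<in> A \<union> B" "b \<in> A \<union> B" "c \<in> A \<union> B" "z = a \<otimes> b \<otimes> c"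
      by (auto simp: mem_triple_iff)
    have car: "a \<in> carrier G" "b \<in> carrier G" "c \<in> carrier G" using abc Bp(1) A Mc by auto
    have *: "u \<otimes> v \<otimes> w \<in> carrier G - M" if uvw: "u \<in> B" "v \<in> A \<union> B" "w \<in> A \<union> B" for u v w
    proof -
      have "v \<in> B \<union> M" "w \<in> B \<union> M" using uvw A by auto
      then show ?thesis using uvw(1) unfolding Bp(4)[symmetric] set_mult_def by blast
    qed
    consider "a \<in> B" | "b \<in> B" | "c \<in> B" | "a \<in> A" "b \<in> A" "c \<in> A" using abc by auto
    then show "z \<in> triple A \<union> (carrier G - M)"
    proof cases
      case 1 then show ?thesis using *[of a b c] abc by simp
    next
      case 2 then show ?thesis using *[of b a c] abc car by (simp add: m_comm)
    next
      case 3 then show ?thesis using *[of c a b] abc car by (simp add: m_ac)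
    next
      case 4 then show ?thesis using abc tripleI by simp
    qed
  next
    fix z assume "z \<in> triple A \<union> (carrier G - M)"
    moreover have "triple A \<subseteq> triple (A \<union> B)" by (simp add: triple_mono)
    moreover have "z \<in> triple (A \<union> B)" if "z \<in> carrier G - M"
    proof -
      obtain a0 where a0: "a0 \<in> A" using A by blast
      have a0c: "a0 \<in> M" "a0 \<in> carrier G" using a0 A Mc by auto
      \<comment> \<open>The summand \<open>b\<close> from \<open>M\<close> is moved into the one
        from \<open>B\<close>, and the fixed element \<open>a0\<close> of \<open>A\<close> takes its
        place.\<close>
      have absorb: "\<exists>a'\<in>B. \<exists>b'\<in>A \<union> B. a \<otimes> b = a' \<otimes> b'" if ab: "a \<in> B" "b \<in> B \<union> M" for a b
      proof (cases "b \<in> B")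
        case True then show ?thesis using ab by blast
      next
        case False
        then have "b \<in> M" using ab by simp
        then have "b \<otimes> inv a0 \<in> M" using a0c M by (simp add: subgroup.m_closed subgroup.m_inv_closed)
        then have "(b \<otimes> inv a0) \<otimes> a \<in> B" using periodicD[OF Bp(2) _ ab(1)] by simp
        moreover have "a \<in> carrier G" "b \<in> carrier G" using ab(1) Bp(1) \<open>b \<in> M\<close> Mc by auto
        then have "a \<otimes> b = ((b \<otimes> inv a0) \<otimes> a) \<otimes> a0" using a0c by (simp add: ac_inv)
        ultimately show ?thesis using a0 by blast
      qed
      have "z \<in> B <#> (B \<union> M) <#> (B \<union> M)" using that Bp(4) by auto
      then obtain a b c where abc: "a \<in> B" "b \<in> B \<union> M" "c \<in> B \<union> M" "z = a \<otimes> b \<otimes> c"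
        by (auto simp: set_mult_def)
      obtain a' b' where ab': "a' \<in> B" "b' \<in> A \<union> B" "a \<otimes> b = a' \<otimes> b'" using absorb abc by blast
      obtain a'' c' where ac': "a'' \<in> B" "c' \<in> A \<union> B" "a' \<otimes> c = a'' \<otimes> c'" using absorb ab'(1) abc(3) by blast
      have car: "a \<in> carrier G" "b \<in> carrier G" "c \<in> carrier G" "a' \<in> carrier G" "b' \<in> carrier G"
        "a'' \<in> carrier G" "c' \<in> carrier G" using abc ab' ac' Bp(1) Mc A by auto
      have "z = (a' \<otimes> c) \<otimes> b'" using abc(4) ab'(3) car by (simp add: m_ac)
      also have "\<dots> = a'' \<otimes> c' \<otimes> b'" using ac'(3) by simp
      finally show ?thesis using ab' ac' by (auto simp: mem_triple_iff)
    qed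
    ultimately show "z \<in> triple (A \<union> B)" by blast
  qed
  have Tc: "triple A \<subseteq> carrier G" using tAM Mc by blast
  have "card (triple (A \<union> B)) = card (triple A) + card (carrier G - M)"
    unfolding t using tAM Tc by (intro card_Un_disjoint) auto
  then show "card (triple (A \<union> B)) = card (triple A) + (order G - card M)"
    using Mc by (simp add: card_Diff_subset order_def)
  have "A \<subseteq> carrier G" "B \<subseteq> carrier G" "A \<inter> B = {}" using A Bp(1) Mc by auto
  then have "card (A \<union> B) = card A + card B" by (intro card_Un_disjoint) simp_all
  then show "3 * card (A \<union> B) + card M = 3 * card A + order G" using Bp(3) by simp
  show "incomplete (A \<union> B)" if ne: "triple A \<noteq> M"
  proof -
    obtain y where "y \<in> M" "y \<notin> triple A" using ne tAM by blast
    then have "y \<in> carrier G" "y \<notin> triple (A \<union> B)" using Mc t by auto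
    then show ?thesis using A Bp(1) Mc by (auto simp: incomplete_iff)
  qed
qed

end

section \<open>Orders divisible by 3\<close>

context finite_comm_group
begin

lemma order_pos [simp]: "0 < order G"
  by (simp add: order_gt_0_iff_finite)

section \<open>Coset arithmetic\<close>

lemma periodic_adj:
  assumes "periodic H C" "t \<in> carrier G" "subgroup H G" "C \<subseteq> carrier G" "\<And>c. c \<in> C \<Longrightarrow> t \<otimes> c \<in> C"
  shows "periodic (adj H t) C"
proof -
  have p: "t [^] i \<otimes> c \<in> C" if c: "c \<in> C" for c and i :: nat
  proof (induction i)
    case 0 then show ?case using c assms(4) by auto
  next
    case (Suc i)
    have "c \<in> carrier G" using c assms(4) by auto
    then have "t [^] Suc i \<otimes> c = t \<otimes> (t [^] i \<otimes> c)" using assms(2) by (simp add: m_ac)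
    then show ?case using assms(5)[OF Suc] by simp
  qed
  show ?thesis unfolding periodic_def
  proof (intro ballI)
    fix h c assume h: "h \<in> adj H t" "c \<in> C"
    obtain i :: nat and m where im: "m \<in> H" "h = t [^] i \<otimes> m" using h(1) unfolding adj_def by (elim blkE)
    have "m \<in> carrier G" "c \<in> carrier G" using im assms(3,4) h(2) subgroup.mem_carrier by auto
    then have "h \<otimes> c = t [^] i \<otimes> (m \<otimes> c)" using assms(2) by (simp add: im(2) m_assoc)
    then show "h \<otimes> c \<in> C" using p periodicD[OF assms(1) im(1) h(2)] by simp
  qed
qed

lemma r_coset_subset_periodic:
  "periodic H C \<Longrightarrow> x \<in> C \<Longrightarrow> H #> x \<subseteq> C"
  by (auto simp: r_coset_def periodic_def)

lemma periodic_card_eq_coset: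
  assumes "periodic H C" "C \<subseteq> carrier G" "H \<subseteq> carrier G" "x \<in> C" "card C \<le> card H"
  shows "C = H #> x"
proof -
  have "x \<in> carrier G" using assms by auto
  then have "H #> x = C"
    using assms r_coset_subset_periodic[OF assms(1,4)] by (intro card_seteq) auto
  then show ?thesis by simp
qed

lemma mem_r_coset_iff:
  assumes "subgroup H G" "x \<in> carrier G" "y \<in> carrier G"
  shows "y \<in> H #> x \<longleftrightarrow> y \<otimes> inv x \<in> H"
proof
  assume "y \<in> H #> x"
  then obtain h where h: "h \<in> H" "y = h \<otimes> x" by (auto simp: r_coset_def)
  then show "y \<otimes> inv x \<in> H" using assms subgroup.mem_carrier[OF assms(1) h(1)] by (simp add: m_assoc)
next
  assume h: "y \<otimes> inv x \<in> H"
  have "y = (y \<otimes> inv x) \<otimes> x" using assms by (simp add: m_assoc)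
  then show "y \<in> H #> x" using h unfolding r_coset_def by blast
qed

lemma r_coset_sym:
  assumes "subgroup H G" "x \<in> carrier G" "y \<in> carrier G" "y \<in> H #> x" shows "x \<in> H #> y"
proof -
  have "inv (y \<otimes> inv x) \<in> H"
    using assms mem_r_coset_iff[OF assms(1-3)] by (intro subgroup.m_inv_closed) auto
  moreover have "inv (y \<otimes> inv x) = x \<otimes> inv y" using assms by (simp add: inv_mult m_comm)
  ultimately show ?thesis using assms by (simp add: mem_r_coset_iff)
qed

lemma r_coset_mult:
  assumes "subgroup H G" "x \<in> carrier G" "y \<in> carrier G" "a \<in> H #> x" "b \<in> H #> y"
  shows "a \<otimes> b \<in> H #> (x \<otimes> y)"
proof -
  obtain h k where hk: "h \<in> H" "k \<in> H" "a = h \<otimes> x" "b = k \<otimes> y" using assms(4,5) by (auto simp: r_coset_def)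
  have c: "h \<in> carrier G" "k \<in> carrier G" using hk(1,2) subgroup.mem_carrier[OF assms(1)] by auto
  have "a \<otimes> b = (h \<otimes> k) \<otimes> (x \<otimes> y)" using hk c assms by (simp add: m_ac)
  moreover have "h \<otimes> k \<in> H" using hk(1,2) by (rule subgroup.m_closed[OF assms(1)])
  ultimately show ?thesis unfolding r_coset_def by blast
qed

text \<open>If \<open>3A\<close> misses only the cosets of \<open>x\<close> and \<open>y = x - t\<close>, then \<open>A\<close> is, up to full cosets of the
  group generated by \<open>H\<close> and \<open>t\<close>, an arithmetic progression with difference \<open>t\<close>.  Comparing the
  first and last terms of the progression with the gap in \<open>3A\<close> determines its length.\<close>

lemma two_missing_cosets_index:
  assumes H: "subgroup H G" and A: "A \<subseteq> carrier G" and pA: "periodic H A"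
    and st: "stab (triple A) \<subseteq> H" and miss: "card (triple A) + 2 * card H = order G"
    and kn: "2 * card A \<le> card (A <#> A) + card H" and third: "3 * card A = order G"
    and d: "order G = card H * d" and odd: "\<not> 2 dvd order G"
  shows "\<exists>t\<in>carrier G. \<exists>c. d = relord H t * c \<and> \<not> 3 dvd c"
proof -
  let ?T = "triple A"
  have Hc: "H \<subseteq> carrier G" using H by (rule subgroup.subset)
  have h0: "0 < card H" using H by (rule subgroup_card_pos)
  have Tc: "?T \<subseteq> carrier G" using A by (rule triple_subset)
  have pT: "periodic H ?T"
    unfolding periodic_def
  proof (intro ballI)
    fix h z assume h: "h \<in> H" "z \<in> ?T"
    then obtain a b c where abc: "a \<in> A" "b \<in> A" "c \<in> A" "z = a \<otimes> b \<otimes> c" by (auto simp: mem_triple_iff)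
    have "h \<otimes> z = (h \<otimes> a) \<otimes> b \<otimes> c" using abc h A Hc by (simp add: m_assoc subset_iff)
    moreover have "h \<otimes> a \<in> A" using pA h abc by (simp add: periodicD)
    ultimately show "h \<otimes> z \<in> ?T" using abc by (simp add: tripleI)
  qed
  define W where "W = carrier G - ?T"
  have Xc: "W \<subseteq> carrier G" by (auto simp: W_def)
  have pX: "periodic H W" unfolding W_def using H periodic_carrier pT by (intro periodic_Diff) auto
  have cX: "card W = 2 * card H"
    using miss Tc by (simp add: W_def card_Diff_subset order_def)
  then have "W \<noteq> {}" using h0 by auto
  then obtain x where x: "x \<in> W" by blast
  have xc: "x \<in> carrier G" using x Xc by auto
  have Hx: "H #> x \<subseteq> W" using pX x by (rule r_coset_subset_periodic)
  define Y where "Y = W - (H #> x)"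
  have "card Y = card H"
    unfolding Y_def using Hx xc Hc cX Xc by (subst card_Diff_subset) (auto intro: finite_subset_carrier)
  moreover have pY: "periodic H Y" unfolding Y_def
    using H pX periodic_coset[OF H xc] Xc by (intro periodic_Diff)
  moreover have Yc: "Y \<subseteq> carrier G" using Xc by (auto simp: Y_def)
  moreover have "Y \<noteq> {}" using \<open>card Y = card H\<close> h0 by auto
  ultimately obtain y where y: "y \<in> Y" "Y = H #> y"
    using periodic_card_eq_coset[OF pY Yc Hc] by auto
  have yc: "y \<in> carrier G" using y Yc by auto
  have W_eq: "z \<in> ?T \<longleftrightarrow> z \<notin> H #> x \<and> z \<notin> H #> y" if "z \<in> carrier G" for z
    using that y(2) Hx unfolding Y_def W_def by blast
  define t where "t = x \<otimes> inv y"
  have tc: "t \<in> carrier G" using xc yc by (simp add: t_def)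
  have tx: "x = t \<otimes> y" using xc yc by (simp add: t_def m_assoc)
  have tH: "t \<notin> H"
  proof
    assume "t \<in> H"
    then have "x \<in> H #> y" using xc yc H by (simp add: mem_r_coset_iff t_def)
    then have "y \<in> H #> x" using H xc yc r_coset_sym by blast
    then show False using y(1) by (simp add: Y_def)
  qed
  let ?l = "relord H t"
  have l0: "0 < ?l" using relord_props[OF H tc] by simp
  have "?l * card H dvd order G" using subgroup_card_dvd[OF subgroup_adj[OF H tc]] by (simp add: card_adj[OF H tc])
  then have ld: "?l dvd d" using h0 by (simp add: d mult.commute)
  have "?l \<noteq> 1" using tH pow_mem_iff[OF H tc, of 1] tc by auto
  \<comment> \<open>The order of \<open>G\<close> is odd, so \<open>t\<close> and
    \<open>t \<otimes> t\<close> both lie outside \<open>H\<close>; hence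
    \<open>t \<otimes> x\<close> and \<open>inv t \<otimes> y\<close> are in neither of the missing
    cosets.\<close>
  moreover have "?l \<noteq> 2" using ld odd d by (metis dvd_mult dvd_trans)
  ultimately have l2: "\<not> ?l dvd 2" "2 \<le> ?l" using l0 by (auto dest: dvd_imp_le simp: le_Suc_eq numeral_2_eq_2)
  have t2: "t \<otimes> t \<notin> H" using l2 pow_mem_iff[OF H tc, of 2] tc by (simp add: numeral_2_eq_2)
  have tcos: "t \<otimes> u \<notin> H #> u" "t \<otimes> (t \<otimes> u) \<notin> H #> u" if "u \<in> carrier G" for u
    using that tc H tH t2 by (simp_all add: mem_r_coset_iff m_assoc)
  have tcan: "t \<otimes> u \<in> H #> (t \<otimes> v) \<longleftrightarrow> u \<in> H #> v" if "u \<in> carrier G" "v \<in> carrier G" for u v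
    using that tc H by (simp add: mem_r_coset_iff ac_inv)
  define tA where "tA = (\<lambda>a. t \<otimes> a) ` A"
  have tAc: "tA \<subseteq> carrier G" using A tc by (auto simp: tA_def)
  have ctA: "card tA = card A" using A tc by (simp add: tA_def)
  have ptA: "periodic H tA"
    unfolding periodic_def
  proof (intro ballI)
    fix h z assume h: "h \<in> H" "z \<in> tA"
    then obtain a where a: "a \<in> A" "z = t \<otimes> a" by (auto simp: tA_def)
    have "h \<otimes> z = t \<otimes> (h \<otimes> a)" using a h A Hc tc by (simp add: m_lcomm subset_iff)
    then show "h \<otimes> z \<in> tA" unfolding tA_def using periodicD[OF pA h(1) a(1)] by simp
  qed
  have fin: "finite A" "finite tA" using A tAc by auto
  \<comment> \<open>In additive notation: \<open>2A\<close> avoids \<open>x - A\<close> and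
    \<open>y - A\<close>, and the latter is \<open>x - tA\<close> because \<open>x = t + y\<close>.
    Both must fit into the room that Kneser's bound for \<open>2A\<close> leaves.\<close>
  have bound: "card (A \<union> tA) \<le> card A + card H"
  proof -
    let ?R = "(\<lambda>u. x \<otimes> inv u) ` (A \<union> tA)"
    have "inj_on (\<lambda>u. x \<otimes> inv u) (A \<union> tA)"
      using A tAc xc by (intro inj_onI) (metis (no_types, lifting) Un_iff inv_closed inv_inv l_cancel subsetD)
    then have cR: "card ?R = card (A \<union> tA)" by (rule card_image)
    have "x \<otimes> inv u \<notin> A <#> A" if u: "u \<in> A \<union> tA" for u
    proof
      assume "x \<otimes> inv u \<in> A <#> A"
      then obtain a b where ab: "a \<in> A" "b \<in> A" "x \<otimes> inv u = a \<otimes> b" by (auto simp: set_mult_def)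
      have uc: "u \<in> carrier G" "a \<otimes> b \<in> carrier G" using u ab A tAc by auto
      have xu: "a \<otimes> b \<otimes> u = x" unfolding ab(3)[symmetric] using uc xc by (simp add: m_assoc)
      show False
      proof (cases "u \<in> A")
        case True
        then have "x \<in> ?T" using xu tripleI[OF ab(1,2)] by metis
        then show False using x by (simp add: W_def)
      next
        case False
        then obtain c where c: "c \<in> A" "u = t \<otimes> c" using u by (auto simp: tA_def)
        then have "t \<otimes> (a \<otimes> b \<otimes> c) = t \<otimes> y" using xu uc tc A by (simp add: tx m_lcomm subset_iff)
        then have "y = a \<otimes> b \<otimes> c" using c(1) uc tc A yc by (simp add: subset_iff)
        then have "y \<in> ?T" using tripleI[OF ab(1,2) c(1)] by simp
        then show False using y(1) by (simp add: W_def Y_def)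
      qed
    qed
    then have dis: "(A <#> A) \<inter> ?R = {}" by blast
    have "card (A <#> A) + card ?R = card ((A <#> A) \<union> ?R)"
      using dis fin set_mult_subset[OF A A] by (intro card_Un_disjoint[symmetric]) simp_all
    also have "\<dots> \<le> order G" unfolding order_def
    proof (rule card_mono[OF finite_carrier])
      show "(A <#> A) \<union> ?R \<subseteq> carrier G" using A tAc xc set_mult_subset[OF A A] by auto
    qed
    finally show ?thesis using cR kn third by linarith
  qed
  have cE: "card (tA - A) \<le> card H" "card (A - tA) \<le> card H"
    using bound ctA card_Un_disjoint[of A "tA - A"] card_Un_disjoint[of tA "A - tA"] fin
    by (simp_all add: Un_commute)
  have "tA - A \<noteq> {}"
  proof
    assume "tA - A = {}"
    then have "t \<in> stab A" using tc by (auto simp: stab_def tA_def)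
    then have "t \<in> stab ?T" unfolding triple_def
      using stab_set_mult[OF A A] stab_set_mult[OF set_mult_subset[OF A A] A] by blast
    then show False using st tH by blast
  qed
  then have "card (tA - A) \<noteq> 0" using fin by simp
  moreover have "card (tA - A) = card (A - tA)"
    using ctA card_Un_disjoint[of A "tA - A"] card_Un_disjoint[of tA "A - tA"] fin
    by (simp add: Un_commute)
  ultimately have "card (A - tA) \<noteq> 0" by metis
  then obtain f where f: "f \<in> A" "f \<notin> tA" by (metis DiffE card.empty ex_in_conv)
  have fc: "f \<in> carrier G" using f A by auto
  have entr: "A - tA = H #> f"
    using periodic_card_eq_coset[OF periodic_Diff[OF H pA ptA A] _ Hc, of f] A f cE by auto
  have tpow: "t [^] Suc i \<otimes> f = t \<otimes> (t [^] i \<otimes> f)" for i :: nat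
    using tc fc by (simp add: m_ac)
  have tpc: "t [^] i \<otimes> f \<in> carrier G" for i :: nat using tc fc by simp
  have "t [^] (?l - 1) \<otimes> f \<notin> A"
  proof
    assume a: "t [^] (?l - 1) \<otimes> f \<in> A"
    have "t [^] ?l \<otimes> f = t \<otimes> (t [^] (?l - 1) \<otimes> f)" using tpow[of "?l - 1"] l0 by simp
    then have "t [^] ?l \<otimes> f \<in> tA" using a by (auto simp: tA_def)
    moreover have "t [^] ?l \<otimes> f \<in> H #> f"
      using relord_props(2)[OF H tc] unfolding r_coset_def by blast
    ultimately show False using entr by blast
  qed
  then have ex: "\<exists>j::nat. t [^] j \<otimes> f \<notin> A" by blast
  \<comment> \<open>\<open>r\<close> is the length of the progression that starts at the entry
    \<open>f\<close> and leaves \<open>A\<close> at \<open>z\<close>.\<close>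
  define r where "r = (LEAST j::nat. t [^] j \<otimes> f \<notin> A)"
  have r1: "t [^] r \<otimes> f \<notin> A" unfolding r_def using ex by (rule LeastI_ex)
  have r2: "t [^] i \<otimes> f \<in> A" if "i < r" for i
    using not_less_Least[of i "\<lambda>j. t [^] j \<otimes> f \<notin> A"] that unfolding r_def by simp
  have rl: "r \<le> ?l - 1" unfolding r_def by (rule Least_le) fact
  have r0: "0 < r" using r1 f fc by (intro gr0I) auto
  define z where "z = t [^] r \<otimes> f"
  have zc: "z \<in> carrier G" using tpc by (simp add: z_def)
  have "z \<in> tA - A"
  proof -
    have "z = t \<otimes> (t [^] (r - 1) \<otimes> f)" using tpow[of "r - 1"] r0 by (simp add: z_def)
    moreover have "t [^] (r - 1) \<otimes> f \<in> A" using r2 r0 by simp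
    ultimately show ?thesis using r1 by (auto simp: tA_def z_def)
  qed
  then have exit: "tA - A = H #> z"
    using periodic_card_eq_coset[OF periodic_Diff[OF H ptA pA tAc] _ Hc, of z] tAc cE by auto
  \<comment> \<open>The element \<open>u\<close> just before the gap is a threefold sum while
    \<open>t \<otimes> u = y\<close> is not, so each of its terms is a last one and moves to the
    exit coset under \<open>t\<close>. Dually, in \<open>ex2\<close>, each term of
    \<open>t \<otimes> x\<close> is a first one.\<close>
  have ex1: "t \<otimes> x \<in> H #> (z \<otimes> z \<otimes> z)"
  proof -
    define u where "u = inv t \<otimes> y"
    have uc: "u \<in> carrier G" and tu: "t \<otimes> u = y" using tc yc by (simp_all add: u_def)
    have "u \<notin> H #> x" "u \<notin> H #> y"
      using tcos[OF uc] r_coset_sym[OF H _ uc] xc yc tc by (auto simp: tx simp flip: tu)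
    then have "u \<in> ?T" using W_eq uc by simp
    then obtain a b c where abc: "a \<in> A" "b \<in> A" "c \<in> A" "u = a \<otimes> b \<otimes> c" by (auto simp: mem_triple_iff)
    have ac: "a \<in> carrier G" "b \<in> carrier G" "c \<in> carrier G" using abc A by auto
    have "y \<notin> ?T" using y by (simp add: W_def Y_def)
    then have "t \<otimes> a \<notin> A" "t \<otimes> b \<notin> A" "t \<otimes> c \<notin> A"
      using tripleI[of "t \<otimes> a" A b c] tripleI[of a A "t \<otimes> b" c] tripleI[of a A b "t \<otimes> c"] abc ac tu tc
      by (auto simp: m_ac)
    then have *: "t \<otimes> a \<in> H #> z" "t \<otimes> b \<in> H #> z" "t \<otimes> c \<in> H #> z"
      using abc exit by (auto simp: tA_def)
    have "t \<otimes> x = (t \<otimes> a) \<otimes> (t \<otimes> b) \<otimes> (t \<otimes> c)"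
      unfolding tx tu[symmetric] abc(4) using ac tc by (simp add: m_ac)
    then show ?thesis using r_coset_mult[OF H _ _ r_coset_mult[OF H zc zc *(1,2)] *(3)] zc by simp
  qed
  have ex2: "t \<otimes> x \<in> H #> (f \<otimes> f \<otimes> f)"
  proof -
    have "t \<otimes> x \<notin> H #> x" "t \<otimes> x \<notin> H #> y" using tcos[OF xc] tcos[OF yc] by (auto simp: tx)
    then have "t \<otimes> x \<in> ?T" using W_eq tc xc by simp
    then obtain a b c where abc: "a \<in> A" "b \<in> A" "c \<in> A" "t \<otimes> x = a \<otimes> b \<otimes> c" by (auto simp: mem_triple_iff)
    have ac: "a \<in> carrier G" "b \<in> carrier G" "c \<in> carrier G" using abc A by auto
    have xT: "x \<notin> ?T" using x by (simp add: W_def)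
    have "u \<in> H #> f" if u: "u \<in> A" "v \<in> A" "w \<in> A" "t \<otimes> x = u \<otimes> v \<otimes> w" for u v w
    proof -
      have uc: "u \<in> carrier G" "v \<in> carrier G" "w \<in> carrier G" using u A by auto
      have "u \<notin> tA"
      proof
        assume "u \<in> tA"
        then obtain u' where u': "u' \<in> A" "u = t \<otimes> u'" by (auto simp: tA_def)
        have u'c: "u' \<in> carrier G" using u' A by auto
        have "t \<otimes> x = t \<otimes> (u' \<otimes> v \<otimes> w)" using u(4) u'(2) u'c uc tc by (simp add: m_assoc)
        then have "x = u' \<otimes> v \<otimes> w" using u'c uc tc xc by simp
        then show False using xT tripleI[OF u'(1) u(2,3)] by simp
      qed
      then show ?thesis using entr u by blast
    qed
    then have *: "a \<in> H #> f" "b \<in> H #> f" "c \<in> H #> f"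
      using abc ac by (simp_all add: m_ac)
    then show ?thesis unfolding abc(4) using r_coset_mult[OF H _ _ r_coset_mult[OF H fc fc *(1,2)] *(3)] fc by simp
  qed
  have "z \<otimes> z \<otimes> z \<in> H #> (f \<otimes> f \<otimes> f)"
    using ex1 ex2 repr_independence[OF ex1 _ H] repr_independence[OF ex2 _ H] zc fc rcos_self[OF _ H, of "z \<otimes> z \<otimes> z"] by simp
  moreover have "z \<otimes> z \<otimes> z \<otimes> inv (f \<otimes> f \<otimes> f) = t [^] (3 * r)"
  proof -
    have "3 * r = r + r + r" by simp
    then have "t [^] (3 * r) = t [^] r \<otimes> t [^] r \<otimes> t [^] r" using tc by (simp only: nat_pow_mult)
    moreover have "z \<otimes> z \<otimes> z = t [^] r \<otimes> t [^] r \<otimes> t [^] r \<otimes> (f \<otimes> f \<otimes> f)"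
      unfolding z_def using tc fc by (simp add: m_ac)
    ultimately show ?thesis using tc fc by (simp add: m_assoc)
  qed
  ultimately have "t [^] (3 * r) \<in> H" using zc fc H by (simp add: mem_r_coset_iff)
  then obtain c0 where c0: "3 * r = ?l * c0" by (auto simp: pow_mem_iff[OF H tc])
  \<comment> \<open>\<open>r < ?l\<close> leaves only \<open>c0 = 1\<close> and
    \<open>c0 = 2\<close>, so \<open>c0 + 3 * q\<close> is prime to 3.\<close>
  have "c0 < 3"
  proof (rule ccontr)
    assume "\<not> c0 < 3"
    then have "?l * 3 \<le> ?l * c0" by simp
    then show False using c0 rl l0 by linarith
  qed
  moreover have "c0 \<noteq> 0" using c0 r0 by (intro notI) simp
  ultimately have c03: "\<not> 3 dvd c0 + 3 * q" for q by presburger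
  define I where "I = (\<lambda>u. f \<otimes> u) ` blk H t {..<r}"
  have Bc: "blk H t {..<r} \<subseteq> carrier G" by (rule blk_subset[OF H tc])
  have Ic: "I \<subseteq> carrier G" using Bc fc by (auto simp: I_def)
  have cI: "card I = r * card H"
    unfolding I_def using card_mult_image[OF fc Bc] card_blk_lessThan[OF H tc, of "{..<r}"] rl l0 by auto
  have I_iff: "u \<in> I \<longleftrightarrow> (\<exists>i<r. u \<in> H #> (t [^] i \<otimes> f))" for u
  proof -
    have comm: "f \<otimes> (t [^] i \<otimes> h) = h \<otimes> (t [^] i \<otimes> f)" if "h \<in> H" for h and i :: nat
      using that Hc fc tc by (simp add: m_ac subset_iff)
    show ?thesis
    proof
      assume "u \<in> I"
      then obtain b where b: "b \<in> blk H t {..<r}" "u = f \<otimes> b" by (auto simp: I_def)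
      obtain i h where ih: "i \<in> {..<r}" "h \<in> H" "b = t [^] i \<otimes> h" using b(1) by (rule blkE)
      have "u = h \<otimes> (t [^] i \<otimes> f)" using comm[OF ih(2)] b(2) ih(3) by simp
      then have "u \<in> H #> (t [^] i \<otimes> f)" using ih(2) by (auto simp: r_coset_def)
      then show "\<exists>i<r. u \<in> H #> (t [^] i \<otimes> f)" using ih(1) by auto
    next
      assume "\<exists>i<r. u \<in> H #> (t [^] i \<otimes> f)"
      then obtain i h where ih: "i < r" "h \<in> H" "u = h \<otimes> (t [^] i \<otimes> f)" by (auto simp: r_coset_def)
      then have "u = f \<otimes> (t [^] i \<otimes> h)" using comm by simp
      then show "u \<in> I" unfolding I_def using blkI[of i "{..<r}" h H t] ih by auto
    qed
  qed
  have pI: "periodic H I"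
    unfolding periodic_def
  proof (intro ballI)
    fix h c assume h: "h \<in> H" "c \<in> I"
    then obtain i where i: "i < r" "c \<in> H #> (t [^] i \<otimes> f)" using I_iff by auto
    then show "h \<otimes> c \<in> I"
      using periodicD[OF periodic_coset[OF H tpc] h(1) i(2)] I_iff by auto
  qed
  have IA: "I \<subseteq> A"
  proof
    fix u assume "u \<in> I"
    then obtain i where "i < r" "u \<in> H #> (t [^] i \<otimes> f)" using I_iff by auto
    then show "u \<in> A" using r_coset_subset_periodic[OF pA r2[of i]] by auto
  qed
  \<comment> \<open>What remains of \<open>A\<close> is closed under \<open>t\<close> and so
    consists of a multiple of \<open>?l\<close> cosets, say \<open>?l * q\<close>; three times the
    total number of cosets in \<open>A\<close> is then \<open>d = ?l * (c0 + 3 * q)\<close>.\<close>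
  have pR: "periodic (adj H t) (A - I)"
  proof (rule periodic_adj[OF periodic_Diff[OF H pA pI A] tc H])
    show "A - I \<subseteq> carrier G" using A by auto
    fix a assume a: "a \<in> A - I"
    have ac: "a \<in> carrier G" using a A by auto
    have "t \<otimes> a \<in> A"
    proof (rule ccontr)
      assume "t \<otimes> a \<notin> A"
      then have "t \<otimes> a \<in> H #> z" using exit a by (auto simp: tA_def)
      moreover have "z = t \<otimes> (t [^] (r - 1) \<otimes> f)" using tpow[of "r - 1"] r0 by (simp add: z_def)
      ultimately have "a \<in> H #> (t [^] (r - 1) \<otimes> f)" using tcan[OF ac tpc] by simp
      then show False using a r0 unfolding Diff_iff I_iff by (metis diff_less zero_less_one)
    qed
    moreover have "t \<otimes> a \<notin> I"
    proof
      assume "t \<otimes> a \<in> I"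
      then obtain i where i: "i < r" "t \<otimes> a \<in> H #> (t [^] i \<otimes> f)" by (auto simp: I_iff)
      show False
      proof (cases i)
        case 0
        then have "t \<otimes> a \<in> H #> f" using i fc by simp
        moreover have "t \<otimes> a \<in> tA" using a by (auto simp: tA_def)
        ultimately show False using entr by blast
      next
        case (Suc j)
        then have "a \<in> H #> (t [^] j \<otimes> f)" using i(2) tcan[OF ac tpc] tpow by simp
        then show False using a i(1) Suc I_iff by auto
      qed
    qed
    ultimately show "t \<otimes> a \<in> A - I" by simp
  qed
  have "card (adj H t) dvd card (A - I)"
    using A by (intro card_dvd_periodic[OF subgroup_adj[OF H tc] _ pR]) auto
  then obtain q where q: "card (A - I) = ?l * card H * q" by (auto simp: card_adj[OF H tc])
  have "card A = card I + card (A - I)"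
    using card_Diff_subset[of I A] card_mono[of A I] IA A Ic by simp
  then have "card H * d = card H * (3 * r + 3 * ?l * q)"
    using third unfolding d cI q by (simp add: algebra_simps)
  then have "d = 3 * r + 3 * ?l * q" using h0 by (simp only: mult_cancel1) simp
  then have "d = ?l * (c0 + 3 * q)" using c0 by (simp add: algebra_simps)
  then show ?thesis using tc c03 by blast
qed

section \<open>The exponent, and the sizes for orders divisible by 3\<close>

lemma group_exponent_props:
  "0 < group_exponent G" "x \<in> carrier G \<Longrightarrow> x [^] group_exponent G = \<one>"
  "0 < m \<Longrightarrow> m < group_exponent G \<Longrightarrow> \<exists>x\<in>carrier G. x [^] m \<noteq> \<one>"
proof -
  let ?P = "\<lambda>m::nat. 0 < m \<and> (\<forall>x\<in>carrier G. x [^] m = \<one>)"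
  have "?P (order G)" using pow_order_eq_1 by auto
  then have "?P (group_exponent G)" unfolding group_exponent_def by (rule LeastI)
  then show "0 < group_exponent G" "x \<in> carrier G \<Longrightarrow> x [^] group_exponent G = \<one>" by auto
  show "\<exists>x\<in>carrier G. x [^] m \<noteq> \<one>" if "0 < m" "m < group_exponent G"
    using not_less_Least[of m ?P] that unfolding group_exponent_def by blast
qed

text \<open>Pigeonhole: for \<open>z\<close> in \<open>M\<close>, the sets \<open>U\<close> and
  \<open>z - V\<close> (additively) are too large to be disjoint in \<open>M\<close>.\<close>

lemma set_mult_eq_subgroup:
  assumes M: "subgroup M G" and UV: "U \<subseteq> M" "V \<subseteq> M" and c: "card M < card U + card V"
  shows "U <#> V = M"
proof (intro equalityI subsetI)
  have Mc: "M \<subseteq> carrier G" using M by (rule subgroup.subset)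
  fix z assume z: "z \<in> M"
  then have zc: "z \<in> carrier G" using Mc by auto
  let ?V = "(\<lambda>v. z \<otimes> inv v) ` V"
  have "inj_on (\<lambda>v. z \<otimes> inv v) V"
  proof (rule inj_onI)
    fix u v assume uv: "u \<in> V" "v \<in> V" "z \<otimes> inv u = z \<otimes> inv v"
    then have "u \<in> carrier G" "v \<in> carrier G" using UV Mc by auto
    then show "u = v" using uv(3) zc by (simp add: inv_inj inj_onD[OF inv_inj])
  qed
  then have cV: "card ?V = card V" by (rule card_image)
  have VM: "?V \<subseteq> M"
    using z UV(2) by (auto intro!: subgroup.m_closed[OF M] subgroup.m_inv_closed[OF M])
  have "U \<inter> ?V \<noteq> {}"
  proof
    assume "U \<inter> ?V = {}"
    then have "card (U \<union> ?V) = card U + card V"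
      using UV VM Mc cV by (subst card_Un_disjoint) (auto intro: finite_subset_carrier)
    moreover have "card (U \<union> ?V) \<le> card M" using UV VM Mc by (intro card_mono) auto
    ultimately show False using c by simp
  qed
  then obtain u v where uv: "u \<in> U" "v \<in> V" "u = z \<otimes> inv v" by blast
  then have "v \<in> carrier G" using UV Mc by auto
  then have "z = u \<otimes> v" using uv(3) zc by (simp add: m_assoc)
  also have "\<dots> \<in> U <#> V" using uv(1,2) by (rule set_multI)
  finally show "z \<in> U <#> V" .
next
  fix z assume "z \<in> U <#> V"
  then show "z \<in> M" using UV by (auto simp: set_mult_def intro!: subgroup.m_closed[OF M])
qed

lemma incomplete_card_le_third:
  assumes A: "incomplete A" and no2: "\<And>d. d dvd order G \<Longrightarrow> d mod 3 \<noteq> 2"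
  shows "3 * card A \<le> order G"
proof -
  obtain d s r where p: "order G = card (stab (triple A)) * d" "r < d" "3 * s \<le> r + 2"
    "card A \<le> card (stab (triple A)) * s"
    using incomplete_parameters[OF A] by metis
  define h where "h = card (stab (triple A))"
  note p = p[folded h_def]
  have "d mod 3 \<noteq> 2" using no2 p(1) by simp
  then have "3 * s \<le> d" using p(2,3) by presburger
  then have "h * (3 * s) \<le> h * d" by (rule mult_le_mono2)
  moreover have "3 * card A \<le> h * (3 * s)" using p(4) by simp
  ultimately show ?thesis unfolding p(1) by (rule order_trans[rotated])
qed

text \<open>Equality in the size bound forces \<open>d = 3 * s\<close>, makes \<open>A\<close>
  itself a union of cosets of \<open>H\<close>, and leaves \<open>r = d - 1\<close> or
  \<open>r = d - 2\<close>. The second alternative is settled by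
  \<open>two_missing_cosets_index\<close>.\<close>

lemma incomplete_third_sizes:
  assumes A: "incomplete A" and no2: "\<And>d. d dvd order G \<Longrightarrow> d mod 3 \<noteq> 2" and third: "3 * card A = order G"
  shows "(\<exists>d. card (triple A) = order G - order G div d \<and> d dvd order G \<and> 3 dvd d \<and> d \<noteq> 3) \<or>
    (\<exists>d. card (triple A) = order G - 2 * order G div d \<and> d dvd order G \<and> 1 \<le> multiplicity 3 d \<and>
      multiplicity 3 d \<le> multiplicity 3 (group_exponent G))"
proof -
  define H where "H = stab (triple A)"
  define B where "B = A <#> H"
  have Ac: "A \<subseteq> carrier G" "A \<noteq> {}" using A by (auto simp: incomplete_iff)
  note k = kneser_triple[OF Ac, folded H_def, folded B_def]
  obtain d s r where p: "order G = card H * d" "card B = card H * s" "card (triple A) = card H * r"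
    "0 < r" "r < d" "3 * s \<le> r + 2" "card A \<le> card H * s" "0 < card H"
    using incomplete_parameters[OF A, folded H_def, folded B_def] by metis
  define h where "h = card H"
  note p = p[folded h_def]
  have d2: "d mod 3 \<noteq> 2" using no2 p(1) by simp
  have "h * d \<le> h * (3 * s)" using p(7) third p(1) by linarith
  then have ds: "d \<le> 3 * s" using p(8) by simp
  then have d3: "d = 3 * s" using p(5,6) d2 by presburger
  have "card A = card B" using third p d3 by simp
  then have AB: "A = B" using k(2,3) by (intro card_subset_eq) auto
  have ddvd: "d dvd order G" "3 dvd d" using p(1) d3 by auto
  have d0: "0 < d" using p(5) by simp
  have od: "order G div d = h" using p(1) d0 by simp
  have "r = d - 1 \<or> r = d - 2" using p(5,6) d3 by linarith
  then show ?thesis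
  proof
    assume r: "r = d - 1"
    \<comment> \<open>For \<open>d = 3\<close> the set \<open>A\<close> would be one coset of
      \<open>H\<close>, and so would \<open>3A\<close>, whereas \<open>r = 2\<close>.\<close>
    have "d \<noteq> 3"
    proof
      assume "d = 3"
      then have "card A = h" using third p(1) by simp
      obtain a where a: "a \<in> A" using Ac by blast
      have ac: "a \<in> carrier G" using a Ac by auto
      have Hc: "H \<subseteq> carrier G" using k(1) by (rule subgroup.subset)
      have "A = H #> a"
        using periodic_card_eq_coset[of H A a] k(4) AB Ac Hc a \<open>card A = h\<close> by (simp add: h_def)
      then have "triple A \<subseteq> H #> (a \<otimes> a \<otimes> a)"
        using r_coset_mult[OF k(1) _ ac r_coset_mult[OF k(1) ac ac]] ac by (auto simp: mem_triple_iff)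
      moreover have "H #> (a \<otimes> a \<otimes> a) \<subseteq> carrier G" using Hc ac by (intro r_coset_subset_G) auto
      ultimately have "card (triple A) \<le> card (H #> (a \<otimes> a \<otimes> a))"
        by (intro card_mono finite_subset_carrier)
      then have "h * r \<le> h" using p(3) Hc ac by (simp add: h_def)
      then show False using r p(8) \<open>d = 3\<close> by simp
    qed
    moreover have "card (triple A) = order G - order G div d"
      unfolding od p(1,3) r by (simp add: diff_mult_distrib2)
    ultimately show ?thesis using ddvd by blast
  next
    assume r: "r = d - 2"
    have c: "card (triple A) + 2 * h = order G"
      using p(1,3) r p(4) by (simp add: diff_mult_distrib2)
    have n2: "\<not> 2 dvd order G" using no2[of 2] by auto
    have pA: "periodic H A" using k(4) AB by simp
    have kn: "2 * card A \<le> card (A <#> A) + card H" using k(6) AB by simp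
    have "stab (triple A) \<subseteq> H" by (simp add: H_def)
    from two_missing_cosets_index[OF k(1) Ac(1) pA this c[unfolded h_def] kn third p(1)[unfolded h_def] n2]
    obtain t c where tc: "t \<in> carrier G" "d = relord H t * c" "\<not> 3 dvd c" by blast
    have l0: "relord H t \<noteq> 0" "c \<noteq> 0" using tc(2) d0 by auto
    have p3: "Factorial_Ring.prime (3::nat)" by simp
    have "multiplicity 3 d = multiplicity 3 (relord H t) + multiplicity 3 c"
      unfolding tc(2) using l0 p3 by (intro prime_elem_multiplicity_mult_distrib) auto
    also have "multiplicity 3 c = 0" using tc(3) by (rule not_dvd_imp_multiplicity_0)
    finally have m: "multiplicity 3 d = multiplicity 3 (relord H t)" by simp
    \<comment> \<open>\<open>relord H t\<close> carries the whole power of 3 in \<open>d\<close> and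
      divides the exponent of \<open>G\<close>.\<close>
    have "t [^] group_exponent G \<in> H" using group_exponent_props(2)[OF tc(1)] subgroup.one_closed[OF k(1)] by simp
    then have "relord H t dvd group_exponent G" by (simp add: pow_mem_iff[OF k(1) tc(1)])
    then have "multiplicity 3 d \<le> multiplicity 3 (group_exponent G)"
      unfolding m using group_exponent_props(1) by (intro dvd_imp_multiplicity_le) auto
    moreover have "1 \<le> multiplicity 3 d"
      using ddvd(2) d0 p3 by (intro multiplicity_geI) auto
    moreover have "card (triple A) = order G - 2 * order G div d"
    proof -
      have "2 * order G div d = 2 * h" using p(1) d0 by (simp add: mult.assoc[symmetric])
      then show ?thesis using c by simp
    qed
    ultimately show ?thesis using ddvd by blast
  qed
qed

text \<open>The set \<open>(M - H) \<union> (x + H)\<close>, where \<open>M\<close> has index 3 and \<open>x \<notin> M\<close>: in the coset \<open>2x + M\<close> only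
  \<open>x + x + m\<close> with \<open>m \<in> M - H\<close> is represented, while the other two cosets are covered.\<close>

lemma exists_incomplete_one_missing_coset:
  assumes d: "d dvd order G" "3 dvd d" "9 \<le> d"
  shows "\<exists>A. incomplete A \<and> 3 * card A = order G \<and> card (triple A) = order G - order G div d"
proof -
  obtain h where "order G = d * h" using d(1) by blast
  then have h: "order G = h * d" by (simp add: mult.commute)
  obtain e where e: "d = 3 * e" using d(2) by blast
  have h0: "0 < h" using order_pos h by (intro gr0I) auto
  have e3: "3 \<le> e" using d(3) e by simp
  obtain H where H: "subgroup H G" "card H = h" using exists_subgroup_card[of h] h by auto
  have "card H * e dvd order G" by (simp add: H(2) h e)
  then obtain M where M: "subgroup M G" "H \<subseteq> M" "card M = h * e" using exists_supergroup[OF H(1)] H(2) by blast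
  have "3 * card M dvd order G" by (simp add: M(3) h e)
  moreover have p3: "Factorial_Ring.prime (3::nat)" by simp
  ultimately obtain x where x: "x \<in> carrier G" "x \<notin> M" "x [^] (3::nat) \<in> M"
    using exists_prime_step_index[OF M(1)] by blast
  have l: "relord M x = 3" using relord_eqI_prime[OF M(1) x(1) p3 x(3,2)] .
  have Mc: "M \<subseteq> carrier G" and Hc: "H \<subseteq> carrier G" using M H by (auto dest: subgroup.subset)
  have full: "adj M x = carrier G"
    using card_adj[OF M(1) x(1)] subgroup.subset[OF subgroup_adj[OF M(1) x(1)]]
    by (intro card_subset_eq) (auto simp: l M(3) h e order_def[symmetric])
  define D where "D = M - H"
  have DM: "D \<subseteq> M" by (auto simp: D_def)
  have Dc: "D \<subseteq> carrier G" using DM Mc by auto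
  have cD: "card D = h * e - h" unfolding D_def using M Hc by (simp add: card_Diff_subset H(2))
  have he: "h * 3 \<le> h * e" using e3 by simp
  \<comment> \<open>With \<open>e \<ge> 3\<close> the set \<open>D\<close> exceeds half of
    \<open>M\<close>, so two summands from \<open>D\<close> already give all of
    \<open>M\<close>.\<close>
  have big: "card M < card D + card D" using cD he h0 M(3) by linarith
  have DD: "D <#> D = M" using set_mult_eq_subgroup[OF M(1) DM DM big] .
  define K where "K = (\<lambda>u. x \<otimes> u) ` H"
  have Kc: "K \<subseteq> carrier G" using x Hc by (auto simp: K_def)
  have cK: "card K = h" using x Hc H by (simp add: K_def)
  have Mm: "a \<otimes> b \<in> M" if "a \<in> M" "b \<in> M" for a b using that by (rule subgroup.m_closed[OF M(1)])
  have lev: "i mod 3 = j mod 3" if "x [^] i \<otimes> m = x [^] j \<otimes> m'" "m \<in> M" "m' \<in> M" for i j :: nat and m m'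
    using pow_mult_eq_imp_mod_eq[OF M(1) x(1) that] l by simp
  define A where "A = D \<union> K"
  have A_lev: "\<exists>i m. a = x [^] i \<otimes> m \<and> m \<in> M \<and> (i = (0::nat) \<and> m \<notin> H \<or> i = 1 \<and> m \<in> H)" if a: "a \<in> A" for a
  proof (cases "a \<in> D")
    case True
    then have "a \<in> carrier G" using Dc by auto
    then show ?thesis using True by (intro exI[of _ "0::nat"] exI[of _ a]) (auto simp: D_def)
  next
    case False
    then obtain u where u: "u \<in> H" "a = x \<otimes> u" using a by (auto simp: A_def K_def)
    then have "a = x [^] (1::nat) \<otimes> u" using x by simp
    then show ?thesis using u M(2) by blast
  qed
  have "D \<inter> K = {}"
  proof -
    have False if "u \<in> H" "x \<otimes> u \<in> D" for u
    proof -
      have "u \<in> M" "x \<otimes> u \<in> M" using that M(2) by (auto simp: D_def)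
      then have "x [^] (1::nat) \<otimes> u = x [^] (0::nat) \<otimes> (x \<otimes> u)" using x Mc by auto
      then have "1 mod 3 = (0::nat) mod 3" using \<open>u \<in> M\<close> \<open>x \<otimes> u \<in> M\<close> by (rule lev)
      then show False by simp
    qed
    then show ?thesis by (auto simp: K_def)
  qed
  then have "card A = card D + card K" unfolding A_def
    using Dc Kc by (intro card_Un_disjoint) simp_all
  then have "card A = h * e" using cD cK he by linarith
  then have cA: "3 * card A = order G" by (simp add: h e)
  have Ac: "A \<subseteq> carrier G" using Dc Kc by (simp add: A_def)
  have one: "\<one> \<in> H" using H(1) by (rule subgroup.one_closed)
  have xK: "x \<in> K" unfolding K_def using one x by (intro image_eqI[of _ _ \<one>]) auto
  define Z where "Z = (\<lambda>u. x \<otimes> x \<otimes> u) ` H"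
  have "carrier G - triple A = Z"
  proof (intro equalityI subsetI)
    fix z assume z: "z \<in> carrier G - triple A"
    then have "z \<in> blk M x {..<3}" using full adj_eq[OF M(1) x(1)] l by simp
    then obtain i m where im: "i \<in> {..<3::nat}" "m \<in> M" "z = x [^] i \<otimes> m" by (rule blkE)
    have mc: "m \<in> carrier G" using im Mc by auto
    have A2: "m \<in> D <#> D" using im DD by simp
    have "i = 0 \<or> i = 1 \<or> i = 2" using im(1) by auto
    then show "z \<in> Z"
    proof (elim disjE)
      assume i: "i = 0"
      have "D \<noteq> {}" using big by auto
      then obtain u where u: "u \<in> D" by blast
      have uc: "u \<in> carrier G" using u Dc by auto
      have "m \<otimes> inv u \<in> M" using im(2) u DM subgroup.m_inv_closed[OF M(1)] by (intro Mm) auto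
      then obtain a b where ab: "a \<in> D" "b \<in> D" "m \<otimes> inv u = a \<otimes> b" unfolding DD[symmetric] by (auto simp: set_mult_def)
      have "z = (m \<otimes> inv u) \<otimes> u" using im(3) i mc uc by (simp add: m_assoc)
      also have "\<dots> = a \<otimes> b \<otimes> u" using ab by simp
      also have "\<dots> \<in> triple A" using ab u by (intro tripleI) (auto simp: A_def)
      finally show ?thesis using z by simp
    next
      assume i: "i = 1"
      obtain a b where ab: "a \<in> D" "b \<in> D" "m = a \<otimes> b" using A2 by (auto simp: set_mult_def)
      have "a \<in> carrier G" "b \<in> carrier G" using ab Dc by auto
      then have "z = x \<otimes> a \<otimes> b" using im(3) i ab x by (simp add: m_assoc)
      also have "\<dots> \<in> triple A" using ab xK by (intro tripleI) (auto simp: A_def)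
      finally show ?thesis using z by simp
    next
      assume i: "i = 2"
      have e: "z = x \<otimes> x \<otimes> m" using im(3) i x by (simp add: numeral_2_eq_2)
      have "m \<in> H"
      proof (rule ccontr)
        assume "m \<notin> H"
        then have "x \<otimes> x \<otimes> m \<in> triple A" using im xK by (intro tripleI) (auto simp: A_def D_def)
        then show False using z e by simp
      qed
      then show ?thesis using e by (auto simp: Z_def)
    qed
  next
    fix z assume "z \<in> Z"
    then obtain u where u: "u \<in> H" "z = x \<otimes> x \<otimes> u" by (auto simp: Z_def)
    have uc: "u \<in> carrier G" "u \<in> M" using u Hc M by auto
    have z2: "z = x [^] (2::nat) \<otimes> u" using u x uc by (simp add: numeral_2_eq_2)
    have "z \<notin> triple A"
    proof
      assume "z \<in> triple A"
      then obtain a b c where abc: "a \<in> A" "b \<in> A" "c \<in> A" "z = a \<otimes> b \<otimes> c" by (auto simp: mem_triple_iff)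
      obtain i m where im: "a = x [^] i \<otimes> m" "m \<in> M" "i = (0::nat) \<and> m \<notin> H \<or> i = 1 \<and> m \<in> H" using A_lev[OF abc(1)] by blast
      obtain j m' where jm: "b = x [^] j \<otimes> m'" "m' \<in> M" "j = (0::nat) \<and> m' \<notin> H \<or> j = 1 \<and> m' \<in> H" using A_lev[OF abc(2)] by blast
      obtain k m'' where km: "c = x [^] k \<otimes> m''" "m'' \<in> M" "k = (0::nat) \<and> m'' \<notin> H \<or> k = 1 \<and> m'' \<in> H" using A_lev[OF abc(3)] by blast
      have mc: "m \<in> carrier G" "m' \<in> carrier G" "m'' \<in> carrier G" using im(2) jm(2) km(2) Mc by auto
      have "z = x [^] (i + j + k) \<otimes> (m \<otimes> m' \<otimes> m'')"
        unfolding abc(4) im(1) jm(1) km(1) using x mc by (simp add: m_ac flip: nat_pow_mult)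
      then have eq: "x [^] (2::nat) \<otimes> u = x [^] (i + j + k) \<otimes> (m \<otimes> m' \<otimes> m'')" using z2 by simp
      have mm: "m \<otimes> m' \<otimes> m'' \<in> M" using im(2) jm(2) km(2) by (intro Mm)
      have "2 mod 3 = (i + j + k) mod 3" using lev[OF eq uc(2) mm] .
      \<comment> \<open>The levels are 0 or 1, so level 2 modulo 3 needs two terms in
        \<open>K\<close> and one in \<open>D\<close>.\<close>
      then have ijk: "i + j + k = 2" using im(3) jm(3) km(3) by auto
      then have "u = m \<otimes> m' \<otimes> m''" using eq x uc(1) mc by simp
      moreover have "m \<otimes> m' \<otimes> m'' \<notin> H"
      proof
        assume uH: "m \<otimes> m' \<otimes> m'' \<in> H"
        have *: "w \<in> H" if "a \<in> H" "b \<in> H" "a \<otimes> b \<otimes> w \<in> H" "w \<in> carrier G" for a b w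
        proof -
          have "a \<otimes> b \<in> H" using that(1,2) by (rule subgroup.m_closed[OF H(1)])
          moreover have "periodic H H" by (auto simp: periodic_def intro: subgroup.m_closed[OF H(1)])
          ultimately show ?thesis using periodic_inv[OF H(1) _ _ that(4,3)] by blast
        qed
        have c1: "m \<otimes> m'' \<otimes> m' \<in> H" "m' \<otimes> m'' \<otimes> m \<in> H" using uH mc by (simp_all add: m_ac)
        show False using im(3) jm(3) km(3) ijk *[OF _ _ uH mc(3)] *[OF _ _ c1(1) mc(2)] *[OF _ _ c1(2) mc(1)] by auto
      qed
      ultimately show False using u(1) by simp
    qed
    then show "z \<in> carrier G - triple A" using u x uc by simp
  qed
  moreover have "card Z = h" using x Hc H by (simp add: Z_def)
  ultimately have cc: "card (carrier G - triple A) = h" by simp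
  have tc: "triple A \<subseteq> carrier G" using Ac by (rule triple_subset)
  have "card (triple A) = order G - h"
    using cc tc card_mono[of "carrier G" "triple A"] by (simp add: card_Diff_subset order_def)
  moreover have "order G div d = h" using h d by simp
  moreover have "incomplete A" using cc h0 Ac xK by (auto simp: incomplete_iff A_def)
  ultimately show ?thesis using cA by auto
qed

section \<open>Cyclic quotients of 3-power order\<close>

lemma mem_if_coprime_pows:
  assumes "subgroup M G" "x \<in> carrier G" "x [^] (a::nat) \<in> M" "x [^] (b::nat) \<in> M" "coprime a b"
  shows "x \<in> M"
proof -
  have "relord M x dvd a" "relord M x dvd b" using assms pow_mem_iff[OF assms(1,2)] by simp_all
  then have "relord M x dvd gcd a b" by (rule gcd_greatest)
  then have "relord M x dvd 1" using assms(5) by simp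
  then have "x [^] (1::nat) \<in> M" unfolding pow_mem_iff[OF assms(1,2)] .
  then show ?thesis using assms(2) by simp
qed

lemma exists_maximal_avoiding:
  assumes "subgroup M G" "W \<noteq> \<one>"
  obtains H where "subgroup H G" "H \<subseteq> M" "W \<notin> H"
    "\<And>N. subgroup N G \<Longrightarrow> H \<subset> N \<Longrightarrow> N \<subseteq> M \<Longrightarrow> W \<in> N"
proof -
  let ?F = "{H. subgroup H G \<and> H \<subseteq> M \<and> W \<notin> H}"
  have "?F \<subseteq> Pow (carrier G)" using subgroup.subset by auto
  then have "finite ?F" by (rule finite_subset) simp
  moreover have "{\<one>} \<in> ?F" using subgroup_one assms subgroup.one_closed[OF assms(1)] by auto
  then have "?F \<noteq> {}" by blast
  ultimately have "\<exists>H\<in>?F. \<forall>N\<in>?F. H \<le> N \<longrightarrow> H = N" by (rule finite_has_maximal)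
  then obtain H where H: "H \<in> ?F" "\<forall>N\<in>?F. H \<le> N \<longrightarrow> H = N" by (rule bexE)
  show ?thesis
  proof (rule that)
    show "subgroup H G" "H \<subseteq> M" "W \<notin> H" using H(1) by auto
    show "W \<in> N" if "subgroup N G" "H \<subset> N" "N \<subseteq> M" for N
      using bspec[OF H(2), of N] that by auto
  qed
qed

text \<open>For a subgroup \<open>H\<close> of \<open>M\<close> that is maximal subject to avoiding the element \<open>W\<close> of order 3
  generated by \<open>z\<close>, the quotient \<open>M / H\<close> is cyclic and generated by \<open>z\<close>: this takes the place of
  splitting off a cyclic direct factor of maximal order.\<close>

lemma adj_maximal_avoiding:
  assumes M: "subgroup M G" and z: "z \<in> M" and w: "1 \<le> w" "z [^] ((3::nat) ^ w) = \<one>"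
    and H: "subgroup H G" "H \<subseteq> M" "z [^] ((3::nat) ^ (w - 1)) \<notin> H"
    and maxi: "\<And>N. subgroup N G \<Longrightarrow> H \<subset> N \<Longrightarrow> N \<subseteq> M \<Longrightarrow> z [^] ((3::nat) ^ (w - 1)) \<in> N"
    and n: "order G = 3 ^ u * f" "\<not> 3 dvd f"
    and ex: "\<And>x. x \<in> carrier G \<Longrightarrow> x [^] ((3::nat) ^ u) = \<one> \<Longrightarrow> x [^] ((3::nat) ^ w) = \<one>"
  shows "adj H z = M"
proof (rule ccontr)
  define W where "W = z [^] ((3::nat) ^ (w - 1))"
  note H = H[folded W_def] and maxi = maxi[folded W_def]
  have Mc: "M \<subseteq> carrier G" using M by (rule subgroup.subset)
  have Hc: "H \<subseteq> carrier G" using H by (auto dest: subgroup.subset)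
  have zc: "z \<in> carrier G" using z Mc by auto
  have Wc: "W \<in> carrier G" using zc by (simp add: W_def)
  have p3: "Factorial_Ring.prime (3::nat)" by simp
  have W3: "W [^] (3::nat) = \<one>"
  proof -
    have "3 ^ (w - 1) * 3 = (3::nat) ^ w" using w(1) by (metis Suc_pred' less_eq_Suc_le One_nat_def power_Suc2)
    then show ?thesis using w(2) zc by (simp add: W_def nat_pow_pow)
  qed
  have one: "\<one> \<in> H" using H(1) by (rule subgroup.one_closed)
  let ?L = "adj H z"
  have L: "subgroup ?L G" using subgroup_adj[OF H(1) zc] .
  have HL: "H \<subseteq> ?L" using subset_adj[OF H(1) zc] .
  have WL: "W \<in> ?L" using pow_mem_adj[OF H(1) zc] by (simp add: W_def)
  have LM: "?L \<subseteq> M" using adj_subset[OF H(1) zc M H(2) z] .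
  have Wadj: "W \<in> adj H y" if y: "y \<in> M" "y \<notin> H" for y
  proof -
    have yc: "y \<in> carrier G" using y Mc by auto
    have "H \<subset> adj H y" using subset_adj[OF H(1) yc] mem_adj[OF H(1) yc] y by blast
    then show ?thesis using maxi[OF subgroup_adj[OF H(1) yc]] adj_subset[OF H(1) yc M H(2) y(1)] by blast
  qed
  have Hpow: "h [^] (i::nat) \<in> H" if "h \<in> H" for h i using H(1) that by (rule subgroup_nat_pow)
  assume "adj H z \<noteq> M"
  then have "?L \<subset> M" using LM by blast
  then obtain x q where x: "x \<in> M" "x \<notin> ?L" "Factorial_Ring.prime q" "x [^] (q::nat) \<in> ?L"
    using exists_prime_step[OF L M] by blast
  have xc: "x \<in> carrier G" using x Mc by auto
  have xn: "x [^] (3 ^ u * f) = \<one>" using pow_order_eq_1[OF xc] by (simp add: n)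
  show False
  proof (cases "q = 3")
    case False
    \<comment> \<open>The part of \<open>x\<close> of order prime to 3. As
      \<open>y [^] f = \<one>\<close>, a relation \<open>W = y [^] i \<otimes> h\<close> puts
      \<open>W [^] f\<close> into \<open>H\<close>, and then \<open>W\<close> itself, whose cube is
      \<open>\<one>\<close>.\<close>
    define y where "y = x [^] ((3::nat) ^ u)"
    have yc: "y \<in> carrier G" using xc by (simp add: y_def)
    have yf: "y [^] f = \<one>" using xn xc by (simp add: y_def nat_pow_pow)
    have "coprime q (3 ^ u)" using False x(3) p3 by (simp add: primes_coprime)
    then have "y \<notin> ?L" using mem_if_coprime_pows[OF L xc x(4), of "3 ^ u"] x(2) unfolding y_def by blast
    moreover have "y \<in> M" unfolding y_def using M x(1) by (rule subgroup_nat_pow)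
    ultimately have "W \<in> adj H y" using Wadj HL by blast
    then obtain i :: nat and h where ih: "h \<in> H" "W = y [^] i \<otimes> h" unfolding adj_def by (elim blkE)
    have hc: "h \<in> carrier G" using ih Hc by auto
    have "W [^] f = (y [^] f) [^] i \<otimes> h [^] f"
      unfolding ih(2) using yc hc by (simp add: nat_pow_distrib nat_pow_pow mult.commute)
    then have "W [^] f = h [^] f" using yf hc by simp
    then have "W [^] f \<in> H" using Hpow[OF ih(1)] by simp
    moreover have "W [^] (3::nat) \<in> H" using W3 one by simp
    moreover have "coprime f 3" using n(2) p3 by (metis coprime_commute prime_imp_coprime)
    ultimately show False using mem_if_coprime_pows[OF H(1) Wc] H(3) by blast
  next
    case True
    \<comment> \<open>The part of \<open>x\<close> of 3-power order, to which the exponent bound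
      \<open>ex\<close> applies.\<close>
    define y where "y = x [^] f"
    have yc: "y \<in> carrier G" using xc by (simp add: y_def)
    have "y [^] ((3::nat) ^ u) = \<one>" using xn xc by (simp add: y_def nat_pow_pow mult.commute)
    then have yw: "y [^] ((3::nat) ^ w) = \<one>" using ex yc by blast
    have cf: "coprime 3 f" using n(2) p3 by (metis prime_imp_coprime)
    have yL: "y \<notin> ?L" using mem_if_coprime_pows[OF L xc, of 3 f] x(2,4) True cf by (auto simp: y_def)
    have yM: "y \<in> M" unfolding y_def using M x(1) by (rule subgroup_nat_pow)
    have "y [^] (3::nat) = (x [^] (3::nat)) [^] f" using xc by (simp add: y_def nat_pow_pow mult.commute)
    then have "y [^] (3::nat) \<in> ?L" using subgroup_nat_pow[OF L] x(4) True by simp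
    then obtain i :: nat and h where ih: "h \<in> H" "y [^] (3::nat) = z [^] i \<otimes> h" unfolding adj_def by (elim blkE)
    have hc: "h \<in> carrier G" using ih Hc by auto
    show False
    proof (cases "3 dvd i")
      case True
      then obtain j where j: "i = j * 3" by (metis dvd_def mult.commute)
      \<comment> \<open>Correcting \<open>y\<close> by a power of \<open>z\<close> gives an element
        outside \<open>?L\<close> whose cube is in \<open>H\<close>. By maximality \<open>W\<close>
        is in \<open>adj H v\<close>, and this puts \<open>W\<close> into \<open>H\<close> or
        \<open>v\<close> into \<open>?L\<close>.\<close>
      define v where "v = y \<otimes> inv (z [^] j)"
      have vc: "v \<in> carrier G" using yc zc by (simp add: v_def)
      have "v [^] (3::nat) = (z [^] i \<otimes> h) \<otimes> inv (z [^] i)"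
        using yc zc ih(2) by (simp add: v_def nat_pow_distrib nat_pow_inv nat_pow_pow j)
      then have "v [^] (3::nat) = h" using zc hc by (simp add: ac_inv)
      then have v3: "v [^] (3::nat) \<in> H" using ih by simp
      have zjL: "z [^] j \<in> ?L" using pow_mem_adj[OF H(1) zc] .
      have vL: "v \<notin> ?L"
      proof
        assume "v \<in> ?L"
        then have "v \<otimes> z [^] j \<in> ?L" using zjL by (rule subgroup.m_closed[OF L])
        then show False using yL yc zc by (simp add: v_def m_assoc)
      qed
      have "z [^] j \<in> M" using M z by (rule subgroup_nat_pow)
      then have "v \<in> M" unfolding v_def using yM M by (simp add: subgroup.m_closed subgroup.m_inv_closed)
      then have "W \<in> adj H v" using Wadj vL HL by blast
      then obtain k :: nat and h' where kh: "h' \<in> H" "W = v [^] k \<otimes> h'" unfolding adj_def by (elim blkE)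
      have h'c: "h' \<in> carrier G" using kh Hc by auto
      show False
      proof (cases "3 dvd k")
        case True
        then obtain t where t: "k = 3 * t" by blast
        have "v [^] k = (v [^] (3::nat)) [^] t" using vc by (simp add: t nat_pow_pow)
        then have "v [^] k \<in> H" using Hpow[OF v3] by simp
        then have "W \<in> H" unfolding kh(2) using kh(1) by (rule subgroup.m_closed[OF H(1)])
        then show False using H(3) by simp
      next
        case False
        have "v [^] k = W \<otimes> inv h'" using vc h'c kh(2) by (simp add: m_assoc)
        also have "\<dots> \<in> ?L" using WL kh(1) HL by (intro subgroup.m_closed[OF L] subgroup.m_inv_closed[OF L]) auto
        finally have "v [^] k \<in> ?L" .
        moreover have "v [^] (3::nat) \<in> ?L" using v3 HL by blast
        moreover have "coprime k 3" using False p3 by (metis coprime_commute prime_imp_coprime)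
        ultimately show False using mem_if_coprime_pows[OF L vc] vL by blast
      qed
    next
      case False
      have e: "3 * 3 ^ (w - 1) = (3::nat) ^ w" using w(1) by (metis Suc_pred' less_eq_Suc_le One_nat_def power_Suc)
      \<comment> \<open>Raising the expression for the cube of \<open>y\<close> to the power
        \<open>3 ^ (w - 1)\<close> gives \<open>\<one>\<close> on the left, so
        \<open>W [^] i\<close> is in \<open>H\<close> with \<open>i\<close> prime to 3.\<close>
      have "\<one> = (y [^] (3::nat)) [^] ((3::nat) ^ (w - 1))" using yw yc by (simp only: nat_pow_pow e)
      also have "\<dots> = W [^] i \<otimes> h [^] ((3::nat) ^ (w - 1))"
        unfolding ih(2) W_def using zc hc by (simp add: nat_pow_distrib nat_pow_pow mult.commute)
      finally have "W [^] i = inv (h [^] ((3::nat) ^ (w - 1)))"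
        using Wc hc by (metis inv_equality nat_pow_closed)
      then have "W [^] i \<in> H" using Hpow[OF ih(1)] subgroup.m_inv_closed[OF H(1)] by simp
      moreover have "W [^] (3::nat) \<in> H" using W3 one by simp
      moreover have "coprime i 3" using False p3 by (metis coprime_commute prime_imp_coprime)
      ultimately show False using mem_if_coprime_pows[OF H(1) Wc] H(3) by blast
    qed
  qed
qed

text \<open>Let \<open>v\<close> and \<open>w\<close> be the exponents of 3 in \<open>d\<close> and
  in the exponent of \<open>G\<close>. A subgroup \<open>M\<close>, whose index \<open>e\<close> is
  the part of \<open>d\<close> prime to 3, has a cyclic quotient of order \<open>3 ^ w\<close> and
  hence one of order \<open>3 ^ v\<close>, with kernel \<open>K\<close>. A progression of a third of
  the cosets of \<open>K\<close> in \<open>M\<close> has threefold sums missing two cosets, and an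
  outer part of \<open>M\<close> supplies the rest; \<open>card K\<close> equals
  \<open>order G div d\<close>.\<close>

lemma exists_incomplete_two_missing_cosets:
  assumes d: "d dvd order G" "1 \<le> multiplicity 3 d" "multiplicity 3 d \<le> multiplicity 3 (group_exponent G)"
    and no2: "\<And>d. d dvd order G \<Longrightarrow> d mod 3 \<noteq> 2"
  shows "\<exists>A. incomplete A \<and> 3 * card A = order G \<and> card (triple A) = order G - 2 * order G div d"
proof -
  have p3: "Factorial_Ring.prime (3::nat)" by simp
  define u where "u = multiplicity 3 (order G)"
  define v where "v = multiplicity 3 d"
  define w where "w = multiplicity 3 (group_exponent G)"
  have v: "1 \<le> v" "v \<le> w" using d by (auto simp: v_def w_def)
  have d0: "d \<noteq> 0" using d(1) order_pos by (intro notI) simp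
  obtain f where f: "order G = 3 ^ u * f" "\<not> 3 dvd f"
    using multiplicity_decompose'[of "order G" 3] order_pos unfolding u_def by auto
  obtain e where e: "d = 3 ^ v * e" "\<not> 3 dvd e"
    using multiplicity_decompose'[of d 3] d0 unfolding v_def by auto
  obtain c where c: "group_exponent G = 3 ^ w * c" "\<not> 3 dvd c"
    using multiplicity_decompose'[of "group_exponent G" 3] group_exponent_props(1) unfolding w_def by auto
  have c0: "0 < c" using c group_exponent_props(1) by (intro gr0I) simp
  have w3: "3 * 3 ^ (w - 1) = (3::nat) ^ w" "3 ^ (w - 1) * 3 = (3::nat) ^ w"
    using v by (metis Suc_pred' less_eq_Suc_le One_nat_def power_Suc power_Suc2 order_trans)+
  have "3 ^ (w - 1) * c < group_exponent G" unfolding c(1) w3(1)[symmetric] using c0 by simp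
  then obtain g where g: "g \<in> carrier G" "g [^] (3 ^ (w - 1) * c) \<noteq> \<one>"
    using group_exponent_props(3)[of "3 ^ (w - 1) * c"] c0 by auto
  \<comment> \<open>\<open>z\<close> has order exactly \<open>3 ^ w\<close>, as \<open>zw\<close>
    and \<open>W1\<close> record.\<close>
  define z where "z = g [^] c"
  define W where "W = z [^] ((3::nat) ^ (w - 1))"
  have zc: "z \<in> carrier G" using g by (simp add: z_def)
  have W1: "W \<noteq> \<one>" using g by (simp add: W_def z_def nat_pow_pow mult.commute)
  have zw: "z [^] ((3::nat) ^ w) = \<one>"
    using group_exponent_props(2)[OF g(1)] g(1) by (simp add: c z_def nat_pow_pow mult.commute)
  have ex: "x [^] ((3::nat) ^ w) = \<one>" if x: "x \<in> carrier G" "x [^] ((3::nat) ^ u) = \<one>" for x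
  proof -
    have "relord {\<one>} x dvd 3 ^ u" using x pow_mem_iff[OF subgroup_one x(1), of "3 ^ u"] by simp
    then obtain a where a: "relord {\<one>} x = 3 ^ a" by (metis p3 divides_primepow_nat)
    have "relord {\<one>} x dvd 3 ^ w * c"
      using group_exponent_props(2)[OF x(1)] pow_mem_iff[OF subgroup_one x(1), of "3 ^ w * c"] c by simp
    moreover have "coprime (3 ^ a) c" using c(2) p3 by (metis coprime_power_left_iff prime_imp_coprime)
    ultimately have "relord {\<one>} x dvd 3 ^ w" unfolding a by (simp add: coprime_dvd_mult_left_iff)
    then show ?thesis using pow_mem_iff[OF subgroup_one x(1), of "3 ^ w"] by simp
  qed
  have rl: "relord K z = 3 ^ w" if K: "subgroup K G" "W \<notin> K" for K
  proof -
    have "z [^] ((3::nat) ^ w) \<in> K" using zw subgroup.one_closed[OF K(1)] by simp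
    then have "relord K z dvd 3 ^ w" by (simp add: pow_mem_iff[OF K(1) zc])
    then obtain a where a: "a \<le> w" "relord K z = 3 ^ a" by (metis p3 divides_primepow_nat)
    have "\<not> relord K z dvd 3 ^ (w - 1)" using K(2) pow_mem_iff[OF K(1) zc] by (simp add: W_def)
    then have "\<not> a \<le> w - 1" using a by (auto simp: le_imp_power_dvd)
    then have "a = w" using a(1) by simp
    then show ?thesis using a by simp
  qed
  define N where "N = adj {\<one>} z"
  have N: "subgroup N G" "card N = 3 ^ w"
    using subgroup_adj[OF subgroup_one zc] card_adj[OF subgroup_one zc] rl[OF subgroup_one] W1
    by (auto simp: N_def)
  have "3 ^ w dvd order G" using subgroup_card_dvd[OF N(1)] N(2) by simp
  moreover have "e dvd order G" using d(1) e(1) by (metis dvd_mult_right)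
  moreover have "coprime (3 ^ w) e" using e(2) p3 by (metis coprime_power_left_iff prime_imp_coprime)
  ultimately have "3 ^ w * e dvd order G" by (intro divides_mult)
  then obtain k where k: "order G = 3 ^ w * e * k" by blast
  have k0: "0 < k" and e0: "0 < e" using k order_pos by (auto intro!: gr0I)
  have "card N * k dvd order G" by (simp add: N(2) k)
  then obtain M where M: "subgroup M G" "N \<subseteq> M" "card M = 3 ^ w * k"
    using exists_supergroup[OF N(1)] N(2) by metis
  have zM: "z \<in> M" using M(2) mem_adj[OF subgroup_one zc] by (auto simp: N_def)
  obtain H where H: "subgroup H G" "H \<subseteq> M" "W \<notin> H"
    "\<And>N. subgroup N G \<Longrightarrow> H \<subset> N \<Longrightarrow> N \<subseteq> M \<Longrightarrow> W \<in> N"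
    using exists_maximal_avoiding[OF M(1) W1] by blast
  have HM: "adj H z = M"
    by (rule adj_maximal_avoiding[OF M(1) zM _ zw H(1,2) H(3)[unfolded W_def] H(4)[unfolded W_def] f ex])
      (use v in auto)
  have "3 ^ w * card H = 3 ^ w * k" using card_adj[OF H(1) zc] rl[OF H(1,3)] HM M(3) by simp
  then have cH: "card H = k" by simp
  \<comment> \<open>Adjoining the \<open>3 ^ v\<close>-th power of the generator cuts the cyclic
    quotient of \<open>M\<close> from order \<open>3 ^ w\<close> down to order
    \<open>3 ^ v\<close>.\<close>
  define y where "y = z [^] ((3::nat) ^ v)"
  have yc: "y \<in> carrier G" using zc by (simp add: y_def)
  have ryd: "relord H y dvd j \<longleftrightarrow> 3 ^ (w - v) dvd j" for j
  proof -
    have "relord H y dvd j \<longleftrightarrow> y [^] j \<in> H" by (simp add: pow_mem_iff[OF H(1) yc])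
    also have "y [^] j = z [^] (3 ^ v * j)" using zc by (simp add: y_def nat_pow_pow)
    also have "\<dots> \<in> H \<longleftrightarrow> 3 ^ w dvd 3 ^ v * j" by (simp add: pow_mem_iff[OF H(1) zc] rl[OF H(1,3)])
    also have "(3::nat) ^ w = 3 ^ v * 3 ^ (w - v)" using v(2) by (simp flip: power_add)
    also have "3 ^ v * 3 ^ (w - v) dvd 3 ^ v * j \<longleftrightarrow> (3 ^ (w - v) :: nat) dvd j" by simp
    finally show ?thesis .
  qed
  have ry: "relord H y = 3 ^ (w - v)" using ryd[of "relord H y"] ryd[of "3 ^ (w - v)"] by (simp add: dvd_antisym)
  define K where "K = adj H y"
  have K: "subgroup K G" "H \<subseteq> K" using subgroup_adj[OF H(1) yc] subset_adj[OF H(1) yc] by (auto simp: K_def)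
  have cK: "card K = 3 ^ (w - v) * k" using card_adj[OF H(1) yc] by (simp add: K_def ry cH)
  have yM: "y \<in> M" unfolding y_def using M(1) zM by (rule subgroup_nat_pow)
  have KM: "K \<subseteq> M" unfolding K_def using adj_subset[OF H(1) yc M(1) H(2) yM] .
  have aK: "adj K z = M"
  proof
    show "adj K z \<subseteq> M" using adj_subset[OF K(1) zc M(1) KM zM] .
    have "adj H z \<subseteq> adj K z"
      using adj_subset[OF H(1) zc subgroup_adj[OF K(1) zc]] K(2) subset_adj[OF K(1) zc] mem_adj[OF K(1) zc] by blast
    then show "M \<subseteq> adj K z" using HM by simp
  qed
  have w_eq: "(3::nat) ^ w = 3 ^ v * 3 ^ (w - v)" using v(2) by (simp flip: power_add)
  have "relord K z * card K = 3 ^ v * card K"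
    using card_adj[OF K(1) zc] unfolding aK M(3) by (simp only: cK w_eq mult.assoc)
  then have rK: "relord K z = 3 ^ v" using subgroup_card_pos[OF K(1)] by simp
  have cM: "card M = 3 ^ v * card K" using M(3) cK w_eq by simp
  define m where "m = (3::nat) ^ (v - 1)"
  have m: "3 * m = 3 ^ v" "1 \<le> m" unfolding m_def using v
    by (metis Suc_pred' less_eq_Suc_le One_nat_def power_Suc) simp
  define A where "A = blk K z {..<m}"
  have AM: "A \<subseteq> M" unfolding aK[symmetric] by (auto simp: A_def adj_def blk_def)
  have cA: "card A = m * card K" unfolding A_def
    using card_blk_lessThan[OF K(1) zc, of "{..<m}"] m rK by simp
  have K0: "0 < card K" using K(1) by (rule subgroup_card_pos)
  have "A \<noteq> {}" using cA m(2) K0 by (intro notI) simp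
  have tA: "card (triple A) = (3 ^ v - 2) * card K"
    unfolding A_def triple_blk_lessThan[OF K(1) zc m(2)] m(1)
    using card_blk_lessThan[OF K(1) zc, of "{..<3 ^ v - 2}"] rK by simp
  have v2: "2 < (3::nat) ^ v" using m by linarith
  have "(3 ^ v - 2) * card K < card M" unfolding cM using K0 v2 by (intro mult_strict_right_mono) auto
  then have tne: "triple A \<noteq> M" using tA by auto
  have idx: "order G div card M = e" using M(3) k0 by (simp add: k)
  have "q mod 3 = 1" if q: "Factorial_Ring.prime q" "q dvd e" for q
  proof -
    have "q dvd order G" using q(2) k by simp
    then have "q mod 3 \<noteq> 2" using no2 by blast
    moreover have "q mod 3 \<noteq> 0"
    proof
      assume "q mod 3 = 0"
      then have "3 dvd q" by presburger
      then have "3 dvd e" using q(2) dvd_trans by blast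
      then show False using e(2) by simp
    qed
    ultimately show ?thesis by presburger
  qed
  then obtain B where B: "outer_part M B" using exists_outer_part[OF M(1)] idx by metis
  note o = outer_part_triple[OF M(1) B AM \<open>A \<noteq> {}\<close>]
  have "3 * card A = card M" using cA m(1) cM by simp
  then have "3 * card (A \<union> B) = order G" using o(3) by simp
  moreover have "card (triple (A \<union> B)) = order G - 2 * order G div d"
  proof -
    have kd: "2 * order G = d * (2 * card K)" using w_eq by (simp add: k e(1) cK)
    have "2 * order G div d = 2 * card K" unfolding kd using d0 by simp
    moreover have "card M \<le> order G" unfolding order_def using M(1) by (intro card_mono) (auto dest: subgroup.subset)
    moreover have "(3 ^ v - 2) * card K + 2 * card K = card M"
    proof -
      have "(3 ^ v - 2) * card K + 2 * card K = (3 ^ v - 2 + 2) * card K" by (simp only: add_mult_distrib)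
      also have "(3::nat) ^ v - 2 + 2 = 3 ^ v" using v2 by linarith
      finally show ?thesis by (simp only: cM)
    qed
    ultimately show ?thesis using o(2) tA by linarith
  qed
  ultimately show ?thesis using o(4)[OF tne] by blast
qed

theorem incomplete_sizes_3_dvd:
  assumes 3: "3 dvd order G" and no2: "\<And>d. d dvd order G \<Longrightarrow> d mod 3 \<noteq> 2"
  shows "3 * max_incomplete_size G 3 = order G"
    "incomplete_sizes G 3 =
      {order G - order G div d | d. d dvd order G \<and> 3 dvd d \<and> d \<noteq> 3} \<union>
      {order G - 2 * order G div d | d. d dvd order G \<and> 1 \<le> multiplicity 3 d \<and>
         multiplicity 3 d \<le> multiplicity 3 (group_exponent G)}"
proof -
  obtain N where N: "order G = 3 * N" using 3 by blast
  have N0: "0 < N" using N order_pos by simp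
  \<comment> \<open>The bound is attained by a subgroup of index 3, which is its own threefold
    sumset.\<close>
  obtain M where M: "subgroup M G" "card M = N" using exists_subgroup_card[of N] N by auto
  have "triple M \<subseteq> M" by (auto simp: mem_triple_iff intro!: subgroup.m_closed[OF M(1)])
  moreover have "M \<noteq> carrier G" using M(2) N N0 by (auto simp: order_def)
  moreover have "M \<subseteq> carrier G" using M(1) by (rule subgroup.subset)
  ultimately have incM: "incomplete M" using M N0 by (auto simp: incomplete_iff)
  have ub: "card A \<le> N" if "incomplete A" for A
    using incomplete_card_le_third[OF that no2] N by simp
  have m: "max_incomplete_size G 3 = N"
    "incomplete_sizes G 3 = {card (triple C) | C. incomplete C \<and> card C = N}"
    by (rule max_incomplete_characterization[OF ub incM M(2)], assumption)+
  show "3 * max_incomplete_size G 3 = order G" using m(1) N by simp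
  have third: "card C = N \<longleftrightarrow> 3 * card C = order G" for C :: "'a set" using N by auto
  have T1: "\<exists>A. incomplete A \<and> card A = N \<and> card (triple A) = order G - order G div d"
    if d: "d dvd order G" "3 dvd d" "d \<noteq> 3" for d
  proof -
    obtain e where e: "d = 3 * e" using d(2) by (rule dvdE)
    have "e \<noteq> 0" using d(1) order_pos e by (intro notI) simp
    moreover have "e \<noteq> 1" using d(3) e by simp
    \<comment> \<open>\<open>d = 6\<close> would make 2 a divisor of the order; hence
      \<open>d\<close> is at least 9, as \<open>exists_incomplete_one_missing_coset\<close>
      requires.\<close>
    moreover have "e \<noteq> 2"
    proof
      assume "e = 2"
      then have "2 dvd d" using e by simp
      then have "2 dvd order G" using d(1) by (rule dvd_trans)
      then show False using no2[of 2] by simp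
    qed
    ultimately have "9 \<le> d" using e by linarith
    then show ?thesis using exists_incomplete_one_missing_coset[OF d(1,2)] third by simp
  qed
  have T2: "\<exists>A. incomplete A \<and> card A = N \<and> card (triple A) = order G - 2 * order G div d"
    if "d dvd order G" "1 \<le> multiplicity 3 d" "multiplicity 3 d \<le> multiplicity 3 (group_exponent G)" for d
    using exists_incomplete_two_missing_cosets[OF that no2] third by simp
  have T3: "(\<exists>d. card (triple C) = order G - order G div d \<and> d dvd order G \<and> 3 dvd d \<and> d \<noteq> 3) \<or>
    (\<exists>d. card (triple C) = order G - 2 * order G div d \<and> d dvd order G \<and> 1 \<le> multiplicity 3 d \<and>
      multiplicity 3 d \<le> multiplicity 3 (group_exponent G))" if "incomplete C" "card C = N" for C
    using that third by (intro incomplete_third_sizes no2) simp_all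
  show "incomplete_sizes G 3 =
      {order G - order G div d | d. d dvd order G \<and> 3 dvd d \<and> d \<noteq> 3} \<union>
      {order G - 2 * order G div d | d. d dvd order G \<and> 1 \<le> multiplicity 3 d \<and>
         multiplicity 3 d \<le> multiplicity 3 (group_exponent G)}"
    (is "_ = ?T1 \<union> ?T2")
  proof (rule equalityI; rule subsetI)
    fix s assume "s \<in> incomplete_sizes G 3"
    then obtain C where C: "s = card (triple C)" "incomplete C" "card C = N" unfolding m(2) by blast
    show "s \<in> ?T1 \<union> ?T2" unfolding Un_iff mem_Collect_eq C(1) by (rule T3[OF C(2,3)])
  next
    fix s assume s: "s \<in> ?T1 \<union> ?T2"
    have "\<exists>A. incomplete A \<and> card A = N \<and> card (triple A) = s"
    proof (rule UnE[OF s])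
      assume "s \<in> ?T1"
      then show ?thesis using T1 by (elim CollectE exE conjE) simp
    next
      assume "s \<in> ?T2"
      then show ?thesis using T2 by (elim CollectE exE conjE) simp
    qed
    then show "s \<in> incomplete_sizes G 3" unfolding m(2) by blast
  qed
qed

end

section \<open>Orders with all divisors congruent to 1 modulo 3\<close>

text \<open>The hole before the last term is inherited by the sums: of the residues modulo
  \<open>3 * k + 1\<close> only \<open>3 * k - 1\<close> is missed. For \<open>k = 2\<close> the set
  would be \<open>{0, 2}\<close>, whose sums also miss 1 and 3 modulo 7.\<close>

lemma triple_sums_gap:
  assumes "3 \<le> k"
  defines "I \<equiv> {..<k - 1} \<union> {k :: nat}"
  shows "{i + j | i j. i \<in> {i + j | i j. i \<in> I \<and> j \<in> I} \<and> j \<in> I} = {..<3 * k - 1} \<union> {3 * k}"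
    (is "?L = ?R")
proof (intro equalityI subsetI)
  fix m assume m: "m \<in> ?R"
  have "\<exists>i j l. i \<in> I \<and> j \<in> I \<and> l \<in> I \<and> m = (i + j) + l"
  proof -
    consider "m = 3 * k" | "m \<le> 3 * (k - 2)" | "3 * (k - 2) < m" "m \<le> 3 * k - 4" | "3 * k - 4 < m" "m \<le> 3 * k - 2"
      using m by (auto simp: not_le) linarith
    then show ?thesis
    proof cases
      case 1
      then show ?thesis by (intro exI[of _ k]) (auto simp: I_def)
    next
      case mid: 2
      have I: "b \<in> I" if "b \<le> k - 2" for b
      proof -
        have "b < k - 1" using that assms(1) by linarith
        then show ?thesis by (simp add: I_def)
      qed
      consider "m \<le> k - 2" | "k - 2 < m" "m \<le> 2 * (k - 2)" | "2 * (k - 2) < m" by linarith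
      then show ?thesis
      proof cases
        case 1
        then show ?thesis using I by (intro exI[of _ m] exI[of _ 0]) simp
      next
        case 2
        then have "m - (k - 2) \<le> k - 2" "m = (k - 2 + (m - (k - 2))) + 0" by linarith+
        then show ?thesis using I by (metis order_refl zero_le)
      next
        case 3
        then have "m - 2 * (k - 2) \<le> k - 2" "m = (k - 2 + (k - 2)) + (m - 2 * (k - 2))" using mid by linarith+
        then show ?thesis using I by (metis order_refl)
      qed
    next
      case 3
      have "k \<in> I" "k - 2 \<in> I" "m - (2 * k - 2) \<in> I" "m = (k + (k - 2)) + (m - (2 * k - 2))"
        using 3 assms(1) by (auto simp: I_def)
      then show ?thesis by blast
    next
      case 4
      have "k \<in> I" "m - 2 * k \<in> I" "m = (k + k) + (m - 2 * k)"
        using 4 assms(1) by (auto simp: I_def)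
      then show ?thesis by blast
    qed
  qed
  then show "m \<in> ?L" by blast
next
  fix m assume "m \<in> ?L"
  then obtain i j l where "i \<in> I" "j \<in> I" "l \<in> I" "m = i + j + l" by blast
  then show "m \<in> ?R" using assms(1) unfolding I_def by auto
qed

context finite_comm_group
begin

text \<open>For \<open>d\<close> congruent to 1 the number \<open>3 * s\<close> is at most
  \<open>d - 1\<close>, so \<open>3 * card A \<le> order G - h\<close> with \<open>h\<close> the
  order of the stabilizer. Extremal size therefore forces a trivial stabilizer, and Kneser's bounds
  hold for \<open>A\<close> itself.\<close>

lemma incomplete_card_1_mod_3:
  assumes A: "incomplete A" and n1: "\<And>d. d dvd order G \<Longrightarrow> d mod 3 = 1"
  shows "3 * card A + 1 \<le> order G"
    and "3 * card A + 1 = order G \<Longrightarrow>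
      2 * card A \<le> card (A <#> A) + 1 \<and> order G \<le> card (triple A) + 3 \<and> stab (triple A) = {\<one>}"
proof -
  define H where "H = stab (triple A)"
  define B where "B = A <#> H"
  have Ac: "A \<subseteq> carrier G" "A \<noteq> {}" using A by (auto simp: incomplete_iff)
  note k = kneser_triple[OF Ac, folded H_def, folded B_def]
  obtain d s r where p: "order G = card H * d" "card B = card H * s" "card (triple A) = card H * r"
    "0 < r" "r < d" "3 * s \<le> r + 2" "card A \<le> card H * s" "0 < card H"
    using incomplete_parameters[OF A, folded H_def, folded B_def] by metis
  define h where "h = card H"
  note p = p[folded h_def]
  have d1: "d mod 3 = 1" using n1 p(1) by simp
  have s: "3 * s \<le> d - 1" using p(5,6) d1 by presburger
  have "3 * card A \<le> h * (3 * s)" using p(7) by simp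
  also have "\<dots> \<le> h * (d - 1)" using s by (rule mult_le_mono2)
  also have "\<dots> = order G - h" by (simp add: p(1) diff_mult_distrib2)
  finally have c: "3 * card A \<le> order G - h" .
  have hn: "h \<le> order G" using p(1,4,5) by simp
  show "3 * card A + 1 \<le> order G" using c p(8) hn by linarith
  assume e: "3 * card A + 1 = order G"
  then have h1: "h = 1" using c p(8) hn by linarith
  then obtain a where "H = {a}" unfolding h_def by (auto simp: card_1_singleton_iff)
  then have H1: "H = {\<one>}" using subgroup.one_closed[OF k(1)] by auto
  have "B = A" unfolding B_def H1 using Ac by (force simp: set_mult_def)
  then show "2 * card A \<le> card (A <#> A) + 1 \<and> order G \<le> card (triple A) + 3 \<and> stab (triple A) = {\<one>}"
    using k(6,7) H1 e by (simp add: H_def[symmetric])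
qed

text \<open>Transfers a set of exponents from the cyclic group of \<open>t\<close> to
  \<open>G\<close>: an outer part completes it to a set of extremal size with the same number
  \<open>c\<close> of missing sums.\<close>

lemma exists_incomplete_blk:
  assumes n1: "\<And>d. d dvd order G \<Longrightarrow> d mod 3 = 1" and t: "t \<in> carrier G" "t \<noteq> \<one>"
    and I: "I \<noteq> {}" "\<And>i. i \<in> I \<Longrightarrow> i < relord {\<one>} t" "3 * card I + 1 = relord {\<one>} t"
    and J: "{i + j | i j. i \<in> {i + j | i j. i \<in> I \<and> j \<in> I} \<and> j \<in> I} = J"
      "\<And>j. j \<in> J \<Longrightarrow> j < relord {\<one>} t" "card J = relord {\<one>} t - c" "0 < c" "c \<le> relord {\<one>} t"
  shows "\<exists>A. incomplete A \<and> 3 * card A + 1 = order G \<and> card (triple A) = order G - c"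
proof -
  let ?M = "adj {\<one>} t"
  let ?l = "relord {\<one>} t"
  let ?A = "blk {\<one>} t I"
  have M: "subgroup ?M G" and cM: "card ?M = ?l"
    using subgroup_adj[OF subgroup_one t(1)] card_adj[OF subgroup_one t(1)] by auto
  have "?l dvd order G" using subgroup_card_dvd[OF M] cM by simp
  then have lo: "?l \<le> order G" by (intro dvd_imp_le) simp_all
  have "q mod 3 = 1" if "Factorial_Ring.prime q" "q dvd order G div card ?M" for q
  proof -
    have "order G div card ?M dvd order G"
      using subgroup_card_dvd[OF M] by (metis dvd_div_mult_self dvd_triv_left)
    then show ?thesis using that(2) n1 dvd_trans by blast
  qed
  then obtain B where B: "outer_part ?M B" using exists_outer_part[OF M] by blast
  have cA: "card ?A = card I" using card_blk_lessThan[OF subgroup_one t(1) I(2)] by simp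
  have AM: "?A \<subseteq> ?M" by (auto simp: adj_def blk_def)
  have "?A \<noteq> {}" using I(1) by (auto simp: blk_def)
  note o = outer_part_triple[OF M B AM this]
  have "triple ?A = blk {\<one>} t J" unfolding triple_blk[OF subgroup_one t(1)] J(1) ..
  then have tA: "card (triple ?A) = ?l - c" using card_blk_lessThan[OF subgroup_one t(1) J(2)] J(3) by simp
  have "triple ?A \<noteq> ?M" using tA cM J(4,5) by (metis diff_less less_le_trans nat_neq_iff)
  then have "incomplete (?A \<union> B)" by (rule o(4))
  moreover have "3 * card (?A \<union> B) + 1 = order G" using o(3) cM I(3) cA by linarith
  moreover have "card (triple (?A \<union> B)) = order G - c" using o(2) tA cM lo J(5) by linarith
  ultimately show ?thesis by blast
qed

lemma relord_one_mod_3: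
  assumes n1: "\<And>d. d dvd order G \<Longrightarrow> d mod 3 = 1" and t: "t \<in> carrier G" "t \<noteq> \<one>"
  shows "relord {\<one>} t dvd order G" "relord {\<one>} t mod 3 = 1" "7 \<le> relord {\<one>} t"
proof -
  have "card (adj {\<one>} t) dvd order G" using subgroup_card_dvd[OF subgroup_adj[OF subgroup_one t(1)]] .
  then show d: "relord {\<one>} t dvd order G" by (simp add: card_adj[OF subgroup_one t(1)])
  then show m: "relord {\<one>} t mod 3 = 1" by (rule n1)
  have "relord {\<one>} t \<noteq> 1" using relord_props(2)[OF subgroup_one t(1)] t by auto
  moreover have "relord {\<one>} t \<noteq> 4"
  proof
    assume "relord {\<one>} t = 4"
    then have "2 dvd relord {\<one>} t" by simp
    then have "2 dvd order G" using d by (rule dvd_trans)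
    then show False using n1[of 2] by simp
  qed
  ultimately show "7 \<le> relord {\<one>} t" using m by presburger
qed

lemma exists_incomplete_three_missing:
  assumes n1: "\<And>d. d dvd order G \<Longrightarrow> d mod 3 = 1" and t: "t \<in> carrier G" "t \<noteq> \<one>"
  shows "\<exists>A. incomplete A \<and> 3 * card A + 1 = order G \<and> card (triple A) = order G - 3"
proof -
  let ?l = "relord {\<one>} t"
  have l: "?l mod 3 = 1" "7 \<le> ?l" by (rule relord_one_mod_3[OF n1 t], assumption)+
  \<comment> \<open>The sums of \<open>{..<k}\<close> form \<open>{..<3 * k - 2}\<close>, which
    misses three of the \<open>3 * k + 1\<close> residues.\<close>
  define k where "k = (?l - 1) div 3"
  have k: "?l = 3 * k + 1" "2 \<le> k" using l unfolding k_def by presburger+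
  show ?thesis
    by (rule exists_incomplete_blk[OF n1 t, of "{..<k}" "{..<3 * k - 2}"])
      (use k triple_sums_lessThan[of k] in \<open>auto simp: lessThan_empty_iff\<close>)
qed

lemma exists_incomplete_one_missing:
  assumes n1: "\<And>d. d dvd order G \<Longrightarrow> d mod 3 = 1" and t: "t \<in> carrier G" "t \<noteq> \<one>" "relord {\<one>} t \<noteq> 7"
  shows "\<exists>A. incomplete A \<and> 3 * card A + 1 = order G \<and> card (triple A) = order G - 1"
proof -
  let ?l = "relord {\<one>} t"
  have l: "?l mod 3 = 1" "7 \<le> ?l" by (rule relord_one_mod_3[OF n1 t(1,2)], assumption)+
  define k where "k = (?l - 1) div 3"
  \<comment> \<open>Excluding order 7 raises the lower bound for \<open>k\<close> from 2 to 3, as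
    \<open>triple_sums_gap\<close> requires.\<close>
  have k: "?l = 3 * k + 1" "3 \<le> k" using l t(3) unfolding k_def by presburger+
  show ?thesis
    by (rule exists_incomplete_blk[OF n1 t(1,2) _ _ _ triple_sums_gap[OF k(2)]]) (use k in auto)
qed

section \<open>Exclusion of exactly two missing elements\<close>

lemma mem_triple_insert:
  assumes "A \<subseteq> carrier G" "e \<in> carrier G" "z \<in> triple (insert e A)"
  shows "z \<in> triple A \<or> (\<exists>a\<in>A. \<exists>b\<in>A. z = a \<otimes> b \<otimes> e) \<or> (\<exists>a\<in>A. z = a \<otimes> e \<otimes> e) \<or> z = e \<otimes> e \<otimes> e"
proof -
  obtain a b c where abc: "a \<in> insert e A" "b \<in> insert e A" "c \<in> insert e A" "z = a \<otimes> b \<otimes> c"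
    using assms(3) by (auto simp: mem_triple_iff)
  have car: "a \<in> carrier G" "b \<in> carrier G" "c \<in> carrier G" using abc assms by auto
  consider "a \<in> A" "b \<in> A" "c \<in> A" | "a \<in> A" "b \<in> A" "c = e" | "a \<in> A" "b = e" "c \<in> A" | "a = e" "b \<in> A" "c \<in> A"
    | "a \<in> A" "b = e" "c = e" | "a = e" "b \<in> A" "c = e" | "a = e" "b = e" "c \<in> A" | "a = e" "b = e" "c = e"
    using abc by blast
  then show ?thesis
  proof cases
    case 1 then show ?thesis using abc tripleI by simp
  next
    case 2 then show ?thesis using abc by blast
  next
    case 3
    then have "z = a \<otimes> c \<otimes> e" using abc car by (simp add: m_ac)
    then show ?thesis using 3 by blast
  next
    case 4
    then have "z = b \<otimes> c \<otimes> e" using abc car by (simp add: m_ac)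
    then show ?thesis using 4 by blast
  next
    case 5 then show ?thesis using abc by blast
  next
    case 6
    then have "z = b \<otimes> e \<otimes> e" using abc car by (simp add: m_ac)
    then show ?thesis using 6 by blast
  next
    case 7
    then have "z = c \<otimes> e \<otimes> e" using abc car by (simp add: m_ac)
    then show ?thesis using 7 by blast
  next
    case 8 then show ?thesis using abc by simp
  qed
qed

text \<open>In additive notation: \<open>3A\<close> misses exactly \<open>x\<close> and \<open>y = x - t\<close>, and \<open>E\<close> consists of the last
  elements of the progressions with difference \<open>t\<close> that make up \<open>A\<close>.  Each of the elements
  \<open>e + t\<close>, with \<open>e \<in> E\<close>, can be tested against the maximality of \<open>A\<close>.\<close>

lemma two_exits:
  assumes A: "A \<subseteq> carrier G" and xy: "t \<in> carrier G" "y \<in> carrier G" "x = t \<otimes> y"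
    and miss: "x \<notin> triple A" "y \<notin> triple A"
    and maxi: "\<And>e. e \<in> carrier G \<Longrightarrow> e \<notin> A \<Longrightarrow> x \<in> triple (insert e A)"
    and inj2: "\<And>u v. u \<in> carrier G \<Longrightarrow> v \<in> carrier G \<Longrightarrow> u \<otimes> u = v \<otimes> v \<Longrightarrow> u = v"
    and inj3: "\<And>u v. u \<in> carrier G \<Longrightarrow> v \<in> carrier G \<Longrightarrow> u \<otimes> u \<otimes> u = v \<otimes> v \<otimes> v \<Longrightarrow> u = v"
    and compl: "\<And>b. b \<in> carrier G \<Longrightarrow> (\<And>a. a \<in> A \<Longrightarrow> b \<otimes> a \<noteq> x \<and> b \<otimes> a \<noteq> y) \<Longrightarrow> b \<in> A <#> A"
    and E: "card {a \<in> A. t \<otimes> a \<notin> A} = 2"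
  shows "\<exists>e1 e2. {a \<in> A. t \<otimes> a \<notin> A} = {e1, e2} \<and> y = t \<otimes> (e1 \<otimes> e1 \<otimes> e2) \<and> e1 \<otimes> e1 = t \<otimes> (e2 \<otimes> e2)"
proof -
  let ?E = "{a \<in> A. t \<otimes> a \<notin> A}"
  note tc = xy(1) and yc = xy(2)
  have xc: "x \<in> carrier G" using xy by simp
  define u where "u = inv t \<otimes> y"
  have uc: "u \<in> carrier G" and tu: "y = t \<otimes> u" using tc yc by (simp_all add: u_def)
  have Ac: "a \<in> carrier G" if "a \<in> A" for a using that A by auto
  have yT: "t \<otimes> u \<noteq> a \<otimes> b \<otimes> c" if "a \<in> A" "b \<in> A" "c \<in> A" for a b c
    using miss(2) tripleI[OF that] tu by auto
  have xT: "t \<otimes> (t \<otimes> u) \<noteq> a \<otimes> b \<otimes> c" if "a \<in> A" "b \<in> A" "c \<in> A" for a b c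
    using miss(1) tripleI[OF that] tu xy(3) by auto
  \<comment> \<open>Adding \<open>t \<otimes> e\<close> to \<open>A\<close> makes \<open>x\<close> a
    threefold sum; the three alternatives correspond to one, two or three copies of
    \<open>t \<otimes> e\<close>.\<close>
  have add: "(\<exists>a\<in>A. \<exists>b\<in>A. t \<otimes> u = a \<otimes> b \<otimes> e) \<or> (\<exists>a\<in>A. u = a \<otimes> e \<otimes> e) \<or> u = t \<otimes> (e \<otimes> e \<otimes> e)"
    if e: "e \<in> ?E" for e
  proof -
    have ec: "e \<in> carrier G" "t \<otimes> e \<in> carrier G" "t \<otimes> e \<notin> A" using e A tc by auto
    from mem_triple_insert[OF A ec(2) maxi[OF ec(2,3)]] miss(1)
    consider a b where "a \<in> A" "b \<in> A" "x = a \<otimes> b \<otimes> (t \<otimes> e)" | a where "a \<in> A" "x = a \<otimes> (t \<otimes> e) \<otimes> (t \<otimes> e)"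
      | "x = (t \<otimes> e) \<otimes> (t \<otimes> e) \<otimes> (t \<otimes> e)" by blast
    then show ?thesis
    proof cases
      case (1 a b)
      have "t \<otimes> (t \<otimes> u) = t \<otimes> (a \<otimes> b \<otimes> e)" using 1 Ac tc ec by (simp add: xy(3) tu m_ac)
      then have "t \<otimes> u = a \<otimes> b \<otimes> e" using 1 Ac tc ec uc by simp
      then show ?thesis using 1 by blast
    next
      case (2 a)
      have "t \<otimes> (t \<otimes> u) = t \<otimes> (t \<otimes> (a \<otimes> e \<otimes> e))" using 2 Ac tc ec by (simp add: xy(3) tu m_ac)
      then have "u = a \<otimes> e \<otimes> e" using 2 Ac tc ec uc by simp
      then show ?thesis using 2 by blast
    next
      case 3
      have "t \<otimes> (t \<otimes> u) = t \<otimes> (t \<otimes> (t \<otimes> (e \<otimes> e \<otimes> e)))" using 3 tc ec by (simp add: xy(3) tu m_ac)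
      then have "u = t \<otimes> (e \<otimes> e \<otimes> e)" using tc ec uc by simp
      then show ?thesis by blast
    qed
  qed
  have nocase1: "\<not> (\<exists>a\<in>A. \<exists>b\<in>A. t \<otimes> u = a \<otimes> b \<otimes> e)" if "e \<in> ?E" for e using yT that by blast
  \<comment> \<open>If the hole after the exit \<open>e\<close> had length 1, then \<open>e\<close>
    could absorb two steps of \<open>t\<close>, and \<open>x\<close> or \<open>y\<close> would
    become a threefold sum.\<close>
  have gap: "t \<otimes> (t \<otimes> e) \<notin> A" if e: "e \<in> ?E" for e
  proof
    assume tte: "t \<otimes> (t \<otimes> e) \<in> A"
    have ec: "e \<in> carrier G" "e \<in> A" using e A by auto
    from add[OF e] nocase1[OF e] consider a where "a \<in> A" "u = a \<otimes> e \<otimes> e" | "u = t \<otimes> (e \<otimes> e \<otimes> e)" by blast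
    then show False
    proof cases
      case (1 a)
      then have "t \<otimes> (t \<otimes> u) = a \<otimes> e \<otimes> (t \<otimes> (t \<otimes> e))" using ec tc Ac by (simp add: m_ac)
      then show False using xT[OF 1(1) ec(2) tte] by simp
    next
      case 2
      then have "t \<otimes> u = e \<otimes> e \<otimes> (t \<otimes> (t \<otimes> e))" using ec tc by (simp add: m_ac)
      then show False using yT[OF ec(2) ec(2) tte] by simp
    qed
  qed
  \<comment> \<open>Additively, \<open>u - e\<close> is in neither \<open>x - A\<close> nor
    \<open>y - A\<close>, by \<open>gap\<close> and since \<open>e\<close> is an exit, so it lies in
    \<open>2A\<close>. Its two terms are exits, for otherwise \<open>y = t + u\<close> would be a
    threefold sum.\<close>
  have decomp: "\<exists>a\<in>?E. \<exists>b\<in>?E. u = a \<otimes> b \<otimes> e" if e: "e \<in> ?E" for e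
  proof -
    have ec: "e \<in> carrier G" "e \<in> A" using e A by auto
    have "u \<otimes> inv e \<in> A <#> A"
    proof (rule compl)
      show "u \<otimes> inv e \<in> carrier G" using uc ec by simp
      fix a assume a: "a \<in> A"
      have ac: "a \<in> carrier G" using a Ac by simp
      have *: "u \<otimes> inv e \<otimes> a = z \<longleftrightarrow> u \<otimes> a = z \<otimes> e" if "z \<in> carrier G" for z
        using that uc ec ac by (metis (no_types, lifting) inv_closed inv_solve_right m_assoc m_closed m_comm)
      have "u \<otimes> inv e \<otimes> a \<noteq> x"
      proof
        assume "u \<otimes> inv e \<otimes> a = x"
        then have "u \<otimes> a = u \<otimes> (t \<otimes> (t \<otimes> e))" using *[OF xc] tc uc ec by (simp add: xy(3) tu m_ac)
        then show False using gap[OF e] a tc uc ec ac by simp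
      qed
      moreover have "u \<otimes> inv e \<otimes> a \<noteq> y"
      proof
        assume "u \<otimes> inv e \<otimes> a = y"
        then have "u \<otimes> a = u \<otimes> (t \<otimes> e)" using *[OF yc] tc uc ec by (simp add: tu m_ac)
        then show False using e a tc uc ec ac by simp
      qed
      ultimately show "u \<otimes> inv e \<otimes> a \<noteq> x \<and> u \<otimes> inv e \<otimes> a \<noteq> y" ..
    qed
    then obtain a b where ab: "a \<in> A" "b \<in> A" "u \<otimes> inv e = a \<otimes> b" by (auto simp: set_mult_def)
    have abc: "a \<in> carrier G" "b \<in> carrier G" using ab Ac by auto
    have "u = u \<otimes> inv e \<otimes> e" using uc ec by (simp add: m_assoc)
    then have ue: "u = a \<otimes> b \<otimes> e" using ab(3) by simp
    have "t \<otimes> a \<notin> A" using yT[of "t \<otimes> a" b e] ab ec abc tc by (auto simp: ue m_ac)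
    moreover have "t \<otimes> b \<notin> A" using yT[of a "t \<otimes> b" e] ab ec abc tc by (auto simp: ue m_ac)
    ultimately show ?thesis using ab ue by blast
  qed
  obtain p q where pq: "?E = {p, q}" "p \<noteq> q" using E by (auto simp: card_2_iff)
  have pqE: "p \<in> ?E" "q \<in> ?E" unfolding pq(1) by auto
  have pqc: "p \<in> carrier G" "q \<in> carrier G" using pqE A by auto
  have ne: "p \<otimes> p \<noteq> q \<otimes> q" "p \<otimes> (p \<otimes> p) \<noteq> q \<otimes> (q \<otimes> q)"
    using inj2[OF pqc] inj3[OF pqc] pq(2) pqc by (auto simp: m_assoc)
  \<comment> \<open>Each exit takes part in some decomposition of \<open>u\<close>. As squaring and
    cubing are injective, comparing the two decompositions leaves only the mixed forms.\<close>
  have "u = p \<otimes> p \<otimes> q \<or> u = q \<otimes> q \<otimes> p"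
  proof -
    obtain a b where a: "a = p \<or> a = q" "b = p \<or> b = q" "u = a \<otimes> b \<otimes> p" using decomp[OF pqE(1)] unfolding pq(1) by blast
    obtain c d where c: "c = p \<or> c = q" "d = p \<or> d = q" "u = c \<otimes> d \<otimes> q" using decomp[OF pqE(2)] unfolding pq(1) by blast
    have "a \<otimes> b \<otimes> p = c \<otimes> d \<otimes> q" using a c by simp
    then show ?thesis using a c pqc pq(2) ne ne[symmetric]
      by (elim disjE) (simp_all add: m_ac)
  qed
  then obtain e1 e2 where e12: "?E = {e1, e2}" "e1 \<noteq> e2" "u = e1 \<otimes> e1 \<otimes> e2"
    using pq by (metis insert_commute)
  have eE: "e1 \<in> ?E" "e2 \<in> ?E" unfolding e12(1) by auto
  have ec: "e1 \<in> carrier G" "e2 \<in> carrier G" "e1 \<in> A" "e2 \<in> A" using eE A by auto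
  have "e1 \<otimes> e1 = t \<otimes> (e2 \<otimes> e2)"
  proof -
    from add[OF eE(2)] nocase1[OF eE(2)] consider a where "a \<in> A" "u = a \<otimes> e2 \<otimes> e2" | "u = t \<otimes> (e2 \<otimes> e2 \<otimes> e2)" by blast
    then show ?thesis
    proof cases
      case (1 a)
      have ac: "a \<in> carrier G" using 1 Ac by simp
      have "e2 \<otimes> (a \<otimes> e2) = e2 \<otimes> (e1 \<otimes> e1)" using 1(2) e12(3) ec ac by (simp add: m_ac)
      then have ae: "a \<otimes> e2 = e1 \<otimes> e1" using ec ac by simp
      have "t \<otimes> u = (t \<otimes> a) \<otimes> e2 \<otimes> e2" using 1(2) tc ec ac by (simp add: m_ac)
      then have "t \<otimes> a \<notin> A" using yT[of "t \<otimes> a" e2 e2] ec by auto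
      then have "a \<in> ?E" using 1(1) by simp
      then have "a = e1 \<or> a = e2" unfolding e12(1) by simp
      then have "e1 = e2"
      proof
        assume "a = e1" then show ?thesis using ae ec by simp
      next
        assume "a = e2" then show ?thesis using ae ec inj2 by metis
      qed
      then show ?thesis using e12(2) by simp
    next
      case 2
      have "e2 \<otimes> (e1 \<otimes> e1) = e2 \<otimes> (t \<otimes> (e2 \<otimes> e2))" using 2 e12(3) ec tc by (simp add: m_ac)
      then show ?thesis using ec tc by simp
    qed
  qed
  moreover have "y = t \<otimes> (e1 \<otimes> e1 \<otimes> e2)" using tu e12(3) by simp
  ultimately show ?thesis using e12(1) by blast
qed

text \<open>Kneser's bound leaves room for at most two exits from \<open>A\<close> in the direction
  \<open>t\<close>. A single exit \<open>e\<close> leads to \<open>f = t \<otimes> e\<close> for the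
  only entry \<open>f\<close>, which is absurd. Two exits and two entries lie on one progression
  with difference \<open>s\<close>, where \<open>t = s \<otimes> s\<close>, and the element halfway
  between \<open>y\<close> and \<open>x\<close> turns out not to be a sum of three elements of
  \<open>A\<close>.\<close>

lemma no_two_missing:
  assumes A: "incomplete A" and n1: "\<And>d. d dvd order G \<Longrightarrow> d mod 3 = 1" and third: "3 * card A + 1 = order G"
  shows "card (triple A) + 2 \<noteq> order G"
proof
  assume miss: "card (triple A) + 2 = order G"
  let ?T = "triple A"
  have Ac: "A \<subseteq> carrier G" "A \<noteq> {}" using A by (auto simp: incomplete_iff)
  have acar: "a \<in> carrier G" if "a \<in> A" for a using that Ac by auto
  have Tc: "?T \<subseteq> carrier G" using Ac(1) by (rule triple_subset)
  have kn: "2 * card A \<le> card (A <#> A) + 1" and st: "stab ?T = {\<one>}"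
    using incomplete_card_1_mod_3(2)[OF A n1 third] by auto
  \<comment> \<open>The order is prime to 6, so squaring and cubing are injective.\<close>
  have p6: "coprime 2 (order G)" "coprime 3 (order G)"
  proof -
    have "\<not> 2 dvd order G" "\<not> 3 dvd order G" using n1[of 2] n1[of 3] by auto
    then show "coprime 2 (order G)" "coprime 3 (order G)" by (simp_all add: prime_imp_coprime)
  qed
  have pow_inj: "g = h" if gh: "g \<in> carrier G" "h \<in> carrier G" "g [^] m = h [^] m" and m: "coprime m (order G)" for g h and m :: nat
  proof -
    have c: "g \<otimes> inv h \<in> carrier G" using gh by simp
    have "(g \<otimes> inv h) [^] m = g [^] m \<otimes> inv (h [^] m)" using gh by (simp add: nat_pow_distrib nat_pow_inv)
    then have "(g \<otimes> inv h) [^] m \<in> {\<one>}" using gh by simp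
    moreover have "(g \<otimes> inv h) [^] order G \<in> {\<one>}" using pow_order_eq_1[OF c] by simp
    ultimately have "g \<otimes> inv h = \<one>" using mem_if_coprime_pows[OF subgroup_one c _ _ m] by simp
    then show ?thesis using gh by (metis inv_closed inv_equality inv_inv)
  qed
  have inj2: "g = h" if "g \<in> carrier G" "h \<in> carrier G" "g \<otimes> g = h \<otimes> h" for g h
    using pow_inj[OF that(1,2) _ p6(1)] that by (simp add: numeral_2_eq_2)
  have inj3: "g = h" if "g \<in> carrier G" "h \<in> carrier G" "g \<otimes> g \<otimes> g = h \<otimes> h \<otimes> h" for g h
    using pow_inj[OF that(1,2) _ p6(2)] that by (simp add: numeral_3_eq_3)
  have "card (carrier G - ?T) = 2"
    using miss Tc by (simp add: card_Diff_subset order_def)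
  then obtain x y where xy: "carrier G - ?T = {x, y}" "x \<noteq> y" by (auto simp: card_2_iff)
  have xc: "x \<in> carrier G" and yc: "y \<in> carrier G" and xT: "x \<notin> ?T" and yT: "y \<notin> ?T" using xy by auto
  have T_iff: "z \<in> ?T \<longleftrightarrow> z \<noteq> x \<and> z \<noteq> y" if "z \<in> carrier G" for z using xy that by blast
  define t where "t = x \<otimes> inv y"
  have tc: "t \<in> carrier G" using xc yc by (simp add: t_def)
  have xt: "x = t \<otimes> y" using xc yc by (simp add: t_def m_assoc)
  have yt: "y = inv t \<otimes> x" using tc yc by (simp add: xt)
  have t1: "t \<noteq> \<one>" using xy(2) xt yc by auto
  have tt1: "t \<otimes> t \<noteq> \<one>" using inj2[OF tc one_closed] t1 by auto
  \<comment> \<open>\<open>A\<close> has the largest size of an incomplete set.\<close>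
  have maxi: "triple (insert e A) = carrier G" if e: "e \<in> carrier G" "e \<notin> A" for e
  proof (rule ccontr)
    assume "triple (insert e A) \<noteq> carrier G"
    then have "incomplete (insert e A)" using Ac e by (simp add: incomplete_iff)
    then have "3 * card (insert e A) + 1 \<le> order G" using n1 by (rule incomplete_card_1_mod_3(1))
    then show False using third e Ac by simp
  qed
  define tA where "tA = (\<lambda>a. t \<otimes> a) ` A"
  have tAc: "tA \<subseteq> carrier G" using Ac tc by (auto simp: tA_def)
  have ctA: "card tA = card A" using Ac tc by (simp add: tA_def)
  have fin: "finite A" "finite tA" using Ac tAc by auto
  let ?R = "(\<lambda>u. x \<otimes> inv u) ` (A \<union> tA)"
  have "inj_on (\<lambda>u. x \<otimes> inv u) (A \<union> tA)"
  proof (rule inj_onI)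
    fix u v assume uv: "u \<in> A \<union> tA" "v \<in> A \<union> tA" "x \<otimes> inv u = x \<otimes> inv v"
    then have "u \<in> carrier G" "v \<in> carrier G" using Ac tAc by auto
    then show "u = v" using uv(3) xc by (simp add: inj_onD[OF inv_inj])
  qed
  then have cR: "card ?R = card (A \<union> tA)" by (rule card_image)
  have R_iff: "b \<in> ?R \<longleftrightarrow> (\<exists>a\<in>A. b \<otimes> a = x \<or> b \<otimes> a = y)" if bc: "b \<in> carrier G" for b
  proof -
    have 1: "b = x \<otimes> inv a \<longleftrightarrow> b \<otimes> a = x" if "a \<in> carrier G" for a
      using that bc xc by (metis inv_solve_right)
    have 2: "b = x \<otimes> inv (t \<otimes> a) \<longleftrightarrow> b \<otimes> a = y" if a: "a \<in> carrier G" for a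
    proof -
      have "b = x \<otimes> inv (t \<otimes> a) \<longleftrightarrow> b \<otimes> (t \<otimes> a) = x" using 1[of "t \<otimes> a"] a tc by simp
      also have "\<dots> \<longleftrightarrow> t \<otimes> (b \<otimes> a) = t \<otimes> y" using a tc bc by (simp add: xt m_lcomm)
      also have "\<dots> \<longleftrightarrow> b \<otimes> a = y" using a tc bc yc by simp
      finally show ?thesis .
    qed
    have "b \<in> ?R \<longleftrightarrow> (\<exists>a\<in>A. b = x \<otimes> inv a) \<or> (\<exists>a\<in>A. b = x \<otimes> inv (t \<otimes> a))" unfolding tA_def by blast
    also have "\<dots> \<longleftrightarrow> (\<exists>a\<in>A. b \<otimes> a = x \<or> b \<otimes> a = y)" using 1 2 acar by blast
    finally show ?thesis .
  qed
  have AAc: "A <#> A \<subseteq> carrier G" using Ac set_mult_subset by blast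
  have Rc: "?R \<subseteq> carrier G" using Ac tAc xc by auto
  have dis: "(A <#> A) \<inter> ?R = {}"
  proof -
    have "b \<notin> ?R" if "b \<in> A <#> A" for b
    proof -
      have bc: "b \<in> carrier G" using that AAc by auto
      have "b \<otimes> a \<in> ?T" if "a \<in> A" for a using \<open>b \<in> A <#> A\<close> that unfolding triple_def by (rule set_multI)
      then show ?thesis unfolding R_iff[OF bc] using xT yT by metis
    qed
    then show ?thesis by blast
  qed
  have cAR: "card ((A <#> A) \<union> ?R) = card (A <#> A) + card ?R"
    using dis AAc Rc by (intro card_Un_disjoint) simp_all
  have "card ((A <#> A) \<union> ?R) \<le> order G" unfolding order_def using AAc Rc by (intro card_mono) auto
  then have bound: "card (A \<union> tA) \<le> card A + 2" using cAR cR kn third by linarith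
  \<comment> \<open>With two exits the counts are tight: \<open>2A\<close> is exactly the complement
    of \<open>?R\<close>, which additively is the union of \<open>x - A\<close> and
    \<open>y - A\<close>.\<close>
  have compl: "b \<in> A <#> A" if two: "card (A \<union> tA) = card A + 2" and bc: "b \<in> carrier G"
    and b: "\<And>a. a \<in> A \<Longrightarrow> b \<otimes> a \<noteq> x \<and> b \<otimes> a \<noteq> y" for b
  proof -
    have "order G \<le> card ((A <#> A) \<union> ?R)" using two cAR cR kn third by linarith
    then have "(A <#> A) \<union> ?R = carrier G" using AAc Rc by (intro card_seteq) (auto simp: order_def)
    moreover have "b \<notin> ?R" unfolding R_iff[OF bc] using b by blast
    ultimately show ?thesis using bc by blast
  qed
  let ?E = "{a \<in> A. t \<otimes> a \<notin> A}"
  let ?F = "{a \<in> A. inv t \<otimes> a \<notin> A}"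
  have E_im: "(\<lambda>a. t \<otimes> a) ` ?E = tA - A" by (auto simp: tA_def)
  have F_eq: "?F = A - tA"
  proof -
    have "inv t \<otimes> a \<in> A \<longleftrightarrow> a \<in> tA" if "a \<in> carrier G" for a
    proof
      assume "inv t \<otimes> a \<in> A"
      moreover have "a = t \<otimes> (inv t \<otimes> a)" using that tc by simp
      ultimately show "a \<in> tA" unfolding tA_def by blast
    next
      assume "a \<in> tA"
      then obtain b where "b \<in> A" "a = t \<otimes> b" by (auto simp: tA_def)
      then show "inv t \<otimes> a \<in> A" using tc acar by simp
    qed
    then show ?thesis using acar by blast
  qed
  have cU: "card (A \<union> tA) = card A + card (tA - A)" "card (A \<union> tA) = card tA + card (A - tA)"
    using card_Un_disjoint[of A "tA - A"] card_Un_disjoint[of tA "A - tA"] fin by (simp_all add: Un_commute)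
  have cE: "card ?E = card (tA - A)"
  proof -
    have "card ((\<lambda>a. t \<otimes> a) ` ?E) = card ?E" using tc acar by (intro card_mult_image) auto
    then show ?thesis by (simp only: E_im)
  qed
  have cF: "card ?F = card (tA - A)" unfolding F_eq using cU ctA by linarith
  have le2: "card ?E \<le> 2" using bound cU(1) cE by linarith
  have "card ?E \<noteq> 0"
  proof
    assume "card ?E = 0"
    then have "?E = {}" using fin by simp
    then have "t \<in> stab A" using tc by (auto simp: stab_def)
    moreover have "stab A \<subseteq> stab ?T" unfolding triple_def
      using stab_set_mult[OF Ac(1,1)] stab_set_mult[OF AAc Ac(1)] by (rule subset_trans)
    ultimately show False using st t1 by auto
  qed
  then have "card ?E = 1 \<or> card ?E = 2" using le2 by linarith
  then show False
  proof
    \<comment> \<open>Every term of \<open>u\<close> is the exit \<open>e\<close>, and every term of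
      \<open>t \<otimes> x\<close> is the entry \<open>f\<close>. As \<open>t \<otimes> x\<close> is
      also \<open>u\<close> shifted three times by \<open>t\<close>, injectivity of cubing gives
      \<open>f = t \<otimes> e\<close>, which is not in \<open>A\<close>.\<close>
    assume cE1: "card ?E = 1"
    define u where "u = inv t \<otimes> y"
    have uc: "u \<in> carrier G" and tu: "y = t \<otimes> u" using tc yc by (simp_all add: u_def)
    obtain e where e: "?E = {e}" using cE1 by (auto simp: card_1_singleton_iff)
    obtain f where f: "?F = {f}" using cF cE cE1 by (metis card_1_singletonE)
    have eE: "e \<in> ?E" and fF: "f \<in> ?F" unfolding e f by auto
    have ec: "e \<in> carrier G" "f \<in> carrier G" using eE fF acar by auto
    have "u \<in> ?T"
    proof -
      have "u \<noteq> y" using tu t1 uc tc by auto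
      moreover have "u \<noteq> x"
      proof
        assume "u = x"
        then have "\<one> \<otimes> u = (t \<otimes> t) \<otimes> u" using xt tu uc tc by (simp add: m_assoc)
        then show False using tt1 uc tc by simp
      qed
      ultimately show ?thesis using T_iff[OF uc] by simp
    qed
    then obtain a b c where abc: "a \<in> A" "b \<in> A" "c \<in> A" "u = a \<otimes> b \<otimes> c" by (auto simp: mem_triple_iff)
    have car: "a \<in> carrier G" "b \<in> carrier G" "c \<in> carrier G" using abc acar by auto
    have "t \<otimes> a \<notin> A" "t \<otimes> b \<notin> A" "t \<otimes> c \<notin> A"
      using tripleI[of "t \<otimes> a" A b c] tripleI[of a A "t \<otimes> b" c] tripleI[of a A b "t \<otimes> c"] abc car yT tc
      by (auto simp: tu m_ac)
    then have "a \<in> ?E" "b \<in> ?E" "c \<in> ?E" using abc by auto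
    then have ue: "u = e \<otimes> e \<otimes> e" using abc(4) unfolding e by simp
    have txc: "t \<otimes> x \<in> carrier G" using tc xc by simp
    have "t \<otimes> x \<in> ?T"
    proof -
      have "t \<otimes> x \<noteq> x" using t1 xc tc by auto
      moreover have "t \<otimes> x \<noteq> y"
      proof
        assume "t \<otimes> x = y"
        then have "(t \<otimes> t) \<otimes> y = \<one> \<otimes> y" using xt yc tc by (simp add: m_assoc)
        then show False using tt1 yc tc by simp
      qed
      ultimately show ?thesis using T_iff[OF txc] by simp
    qed
    then obtain a b c where abc: "a \<in> A" "b \<in> A" "c \<in> A" "t \<otimes> x = a \<otimes> b \<otimes> c" by (auto simp: mem_triple_iff)
    have car: "a \<in> carrier G" "b \<in> carrier G" "c \<in> carrier G" using abc acar by auto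
    have x_eq: "x = inv t \<otimes> (a \<otimes> b \<otimes> c)" using abc(4)[symmetric] tc xc by simp
    have "inv t \<otimes> a \<notin> A" "inv t \<otimes> b \<notin> A" "inv t \<otimes> c \<notin> A"
      using tripleI[of "inv t \<otimes> a" A b c] tripleI[of a A "inv t \<otimes> b" c] tripleI[of a A b "inv t \<otimes> c"] abc car xT tc
      by (auto simp: x_eq m_ac)
    then have "a \<in> ?F" "b \<in> ?F" "c \<in> ?F" using abc by auto
    then have "t \<otimes> x = f \<otimes> f \<otimes> f" using abc(4) unfolding f by simp
    moreover have "t \<otimes> x = (t \<otimes> e) \<otimes> (t \<otimes> e) \<otimes> (t \<otimes> e)" unfolding xt tu ue using tc ec by (simp add: m_ac)
    ultimately have "f = t \<otimes> e" using inj3[of f "t \<otimes> e"] ec tc by simp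
    then show False using eE fF by simp
  next
    assume cE2: "card ?E = 2"
    have two: "card (A \<union> tA) = card A + 2" using cU(1) cE cE2 by simp
    obtain e1 e2 where e: "?E = {e1, e2}" "y = t \<otimes> (e1 \<otimes> e1 \<otimes> e2)" "e1 \<otimes> e1 = t \<otimes> (e2 \<otimes> e2)"
      using two_exits[OF Ac(1) tc yc xt xT yT _ inj2 inj3 compl[OF two] cE2] maxi xc by blast
    have cF2: "card ?F = 2" using cF cE cE2 by simp
    have compl': "b \<in> A <#> A" if "b \<in> carrier G" "\<And>a. a \<in> A \<Longrightarrow> b \<otimes> a \<noteq> y \<and> b \<otimes> a \<noteq> x" for b
      using compl[OF two that(1)] that(2) by blast
    obtain f1 f2 where f: "?F = {f1, f2}" "x = inv t \<otimes> (f1 \<otimes> f1 \<otimes> f2)" "f1 \<otimes> f1 = inv t \<otimes> (f2 \<otimes> f2)"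
      using two_exits[OF Ac(1) inv_closed[OF tc] xc yt yT xT _ inj2 inj3 compl' cF2] maxi yc by blast
    have eE: "e1 \<in> ?E" "e2 \<in> ?E" "f1 \<in> ?F" "f2 \<in> ?F" unfolding e(1) f(1) by auto
    have ec: "e1 \<in> carrier G" "e2 \<in> carrier G" "f1 \<in> carrier G" "f2 \<in> carrier G" using eE acar by auto
    \<comment> \<open>Half of \<open>t\<close> in additive terms: the exits differ by
      \<open>s\<close>, and so do the entries.\<close>
    define s where "s = e1 \<otimes> inv e2"
    have sc: "s \<in> carrier G" using ec by (simp add: s_def)
    have e1s: "e1 = s \<otimes> e2" using ec by (simp add: s_def m_assoc)
    have st: "t = s \<otimes> s"
    proof -
      have "(e2 \<otimes> e2) \<otimes> (s \<otimes> s) = (e2 \<otimes> e2) \<otimes> t" using e(3) ec sc tc unfolding e1s by (simp add: m_ac)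
      then show ?thesis using ec sc tc by simp
    qed
    have s1: "s \<noteq> \<one>" using t1 st sc by auto
    have f2s: "f2 = s \<otimes> f1"
    proof (rule inj2)
      have "t \<otimes> (f1 \<otimes> f1) = f2 \<otimes> f2" unfolding f(3) using ec tc by simp
      then show "f2 \<otimes> f2 = (s \<otimes> f1) \<otimes> (s \<otimes> f1)" using ec sc by (simp add: st m_ac)
    qed (use ec sc in auto)
    let ?l = "relord {\<one>} s"
    have l: "?l dvd order G" "?l mod 3 = 1" "7 \<le> ?l"
      by (rule relord_one_mod_3[OF n1 sc s1], assumption)+
    have s_eq: "s [^] i = s [^] j \<longleftrightarrow> i mod ?l = j mod ?l" for i j :: nat
    proof
      assume "s [^] i = s [^] j"
      then show "i mod ?l = j mod ?l"
        using pow_mult_eq_imp_mod_eq[OF subgroup_one sc, of i \<one> j \<one>] by simp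
    next
      assume ij: "i mod ?l = j mod ?l"
      have "s [^] i = s [^] (i mod ?l)" for i :: nat using pow_mod[OF subgroup_one sc, of i] sc by auto
      then show "s [^] i = s [^] j" using ij by metis
    qed
    have sl: "s [^] ?l = \<one>" using relord_props(2)[OF subgroup_one sc] by simp
    \<comment> \<open>Expressing \<open>x\<close> through the exits and through the entries shows,
      additively, that three times \<open>f1 - e1\<close> is \<open>4 s\<close>; \<open>k\<close>
      solves \<open>3 k = 4\<close> modulo \<open>?l\<close>, so that
      \<open>f1 = p k\<close>.\<close>
    define k where "k = (2 * ?l + 4) div 3"
    have k: "3 * k = 2 * ?l + 4" "k < ?l" "2 < k" using l(2,3) unfolding k_def by presburger+
    define p where "p i = s [^] i \<otimes> e1" for i :: nat
    have pc: "p i \<in> carrier G" for i using sc ec by (simp add: p_def)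
    have p_eq: "p i = p j \<longleftrightarrow> i mod ?l = j mod ?l" for i j using s_eq sc ec by (simp add: p_def)
    have p_Suc: "p (Suc i) = s \<otimes> p i" for i using sc ec by (simp add: p_def m_ac)
    have p_t: "p (Suc (Suc i)) = t \<otimes> p i" for i using sc pc by (simp add: p_Suc st m_assoc)
    have p0: "p 0 = e1" using ec by (simp add: p_def)
    have e2p: "e2 = p (?l - 1)"
    proof -
      have "s \<otimes> p (?l - 1) = p ?l" using p_Suc[of "?l - 1"] l(3) by simp
      also have "\<dots> = s \<otimes> e2" using sl ec by (simp add: p_def e1s)
      finally show ?thesis using sc ec pc by simp
    qed
    have x_e: "x = s [^] (3::nat) \<otimes> (e1 \<otimes> e1 \<otimes> e1)"
    proof -
      have "x = t \<otimes> (t \<otimes> (e1 \<otimes> e1 \<otimes> e2))" using xt e(2) by simp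
      also have "\<dots> = s \<otimes> s \<otimes> s \<otimes> (e1 \<otimes> e1 \<otimes> (s \<otimes> e2))" unfolding st using sc ec by (simp add: m_ac)
      finally show ?thesis using sc by (simp add: e1s[symmetric] numeral_3_eq_3)
    qed
    have f1p: "f1 = p k"
    proof (rule inj3)
      have "t \<otimes> x = f1 \<otimes> f1 \<otimes> f2" using f(2) tc ec by simp
      then have "s \<otimes> (f1 \<otimes> f1 \<otimes> f1) = s \<otimes> (s [^] (4::nat) \<otimes> (e1 \<otimes> e1 \<otimes> e1))"
        unfolding x_e st f2s using sc ec by (simp add: m_ac numeral_3_eq_3 numeral_Bit0)
      then have "f1 \<otimes> f1 \<otimes> f1 = s [^] (4::nat) \<otimes> (e1 \<otimes> e1 \<otimes> e1)" using sc ec by simp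
      also have "s [^] (4::nat) = s [^] (k + k + k)" using k(1) by (simp add: s_eq mult_2[symmetric] flip: mult_2)
      also have "s [^] (k + k + k) \<otimes> (e1 \<otimes> e1 \<otimes> e1) = p k \<otimes> p k \<otimes> p k"
        unfolding p_def using sc ec by (simp add: m_ac flip: nat_pow_mult)
      finally show "f1 \<otimes> f1 \<otimes> f1 = p k \<otimes> p k \<otimes> p k" .
    qed (use ec pc in auto)
    then have f2p: "f2 = p (Suc k)" using f2s by (simp add: p_Suc)
    \<comment> \<open>On the progression \<open>p\<close> the exits are at positions 0 and
      \<open>?l - 1\<close> and the entries at \<open>k\<close> and \<open>k + 1\<close>. The holes
      after the exits are followed in steps of \<open>t\<close>, two positions at a time, up to the
      entries.\<close>
    have notin: "p i \<notin> A" if "0 < i" "i < k" for i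
      using that
    proof (induction i rule: less_induct)
      case (less i)
      show ?case
      proof (cases "i \<le> 2")
        case True
        then consider "i = 1" | "i = 2" using less.prems by linarith
        then show ?thesis
        proof cases
          case 1
          have "p 1 = t \<otimes> e2" using p_Suc[of 0] sc ec by (simp add: p0 e1s st m_assoc)
          then show ?thesis using eE 1 by simp
        next
          case 2
          have "p 2 = t \<otimes> e1" using p_t[of 0] by (simp add: p0 numeral_2_eq_2)
          then show ?thesis using eE 2 by simp
        qed
      next
        case False
        then obtain j where j: "i = Suc (Suc j)" "0 < j" by (metis Suc_le_D less_eq_Suc_le not_less_eq_eq numeral_2_eq_2 zero_less_Suc)
        then have "p j \<notin> A" using less by simp
        then have pj: "inv t \<otimes> p i \<notin> A" unfolding j(1) p_t using tc pc by simp
        show ?thesis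
        proof
          assume "p i \<in> A"
          then have "p i \<in> ?F" using pj by simp
          then have "p i = p k \<or> p i = p (Suc k)" unfolding f(1) f1p f2p by simp
          moreover have "i < ?l" using less.prems k(2) by simp
          ultimately have "i = k mod ?l \<or> i = Suc k mod ?l" unfolding p_eq by simp
          moreover have "k mod ?l = k" "Suc k mod ?l = Suc k \<or> Suc k mod ?l = 0"
            using k(2) by (auto simp: mod_Suc)
          ultimately show False using less.prems by auto
        qed
      qed
    qed
    \<comment> \<open>If \<open>s \<otimes> a\<close> were in \<open>A\<close>, then
      \<open>x = s \<otimes> g\<close> would be a threefold sum. As \<open>?l\<close> is odd,
      \<open>s\<close> is a power of \<open>t\<close>, so steps of \<open>t\<close> from
      \<open>a\<close> must leave \<open>A\<close> through an exit; this places \<open>a\<close> on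
      the progression.\<close>
    have range: "\<exists>i. k \<le> i \<and> i \<le> ?l \<and> a = p i" if abc: "a \<in> A" "b \<in> A" "c \<in> A" "a \<otimes> b \<otimes> c = g" "x = s \<otimes> g" for a b c g
    proof -
      have ac: "a \<in> carrier G" "b \<in> carrier G" "c \<in> carrier G" using abc acar by auto
      have "s \<otimes> a \<notin> A"
      proof
        assume "s \<otimes> a \<in> A"
        then have "s \<otimes> a \<otimes> b \<otimes> c \<in> ?T" using abc by (intro tripleI)
        then show False using xT abc(5) ac sc by (simp add: m_assoc flip: abc(4))
      qed
      moreover have "t [^] ((?l + 1) div 2) = s"
      proof -
        have "odd ?l"
        proof
          assume "even ?l"
          then have "2 dvd order G" using l(1) by (rule dvd_trans)
          then show False using n1[of 2] by simp
        qed
        then have "2 * ((?l + 1) div 2) = ?l + 1" by simp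
        moreover have "t [^] ((?l + 1) div 2) = s [^] (2 * ((?l + 1) div 2))"
        proof -
          have "t = s [^] (2::nat)" using sc by (simp add: st numeral_2_eq_2)
          then show ?thesis using sc by (simp add: nat_pow_pow)
        qed
        ultimately show ?thesis using sl sc by simp
      qed
      ultimately have ex: "\<exists>j::nat. t [^] j \<otimes> a \<notin> A" by metis
      define j where "j = (LEAST j::nat. t [^] j \<otimes> a \<notin> A)"
      have j1: "t [^] j \<otimes> a \<notin> A" unfolding j_def using ex by (rule LeastI_ex)
      have j0: "j \<noteq> 0" using j1 abc(1) ac by (intro notI) simp
      then obtain i where i: "j = Suc i" using not0_implies_Suc by blast
      have "t [^] i \<otimes> a \<in> A"
        using not_less_Least[of i "\<lambda>j. t [^] j \<otimes> a \<notin> A"] i unfolding j_def by simp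
      moreover have "t \<otimes> (t [^] i \<otimes> a) \<notin> A" using j1 ac tc by (simp add: i m_ac)
      ultimately have "t [^] i \<otimes> a \<in> ?E" by simp
      then have "t [^] i \<otimes> a = p 0 \<or> t [^] i \<otimes> a = p (?l - 1)" unfolding e(1) using p0 e2p by simp
      then obtain m where m: "t [^] i \<otimes> a = p m" by blast
      have "t [^] i = s [^] (2 * i)"
      proof -
        have "t = s [^] (2::nat)" using sc by (simp add: st numeral_2_eq_2)
        then show ?thesis using sc by (simp add: nat_pow_pow)
      qed
      then have "s [^] (2 * i * (?l - 1)) \<otimes> (s [^] (2 * i) \<otimes> a) = s [^] (2 * i * (?l - 1)) \<otimes> p m" using m by simp
      moreover have "s [^] (2 * i * (?l - 1)) \<otimes> s [^] (2 * i) = \<one>"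
      proof -
        have e: "2 * i * (?l - 1) + 2 * i = 2 * i * ?l" using l(3) by (cases ?l) simp_all
        have "s [^] (2 * i * ?l) = s [^] (0::nat)" unfolding s_eq by simp
        then show ?thesis using sc e by (simp add: nat_pow_mult)
      qed
      ultimately have "a = s [^] (2 * i * (?l - 1)) \<otimes> p m" using sc ac by (simp flip: m_assoc)
      also have "\<dots> = p (2 * i * (?l - 1) + m)" unfolding p_def using sc ec by (simp add: m_assoc flip: nat_pow_mult)
      finally obtain q where q: "a = p q" by blast
      define r where "r = q mod ?l"
      have r: "a = p r" "r < ?l" unfolding q p_eq r_def using l(3) by simp_all
      show ?thesis
      proof (cases "r = 0")
        case True
        then have "a = p ?l" using r p_eq[of 0 ?l] by simp
        then show ?thesis using k(2) by (intro exI[of _ ?l]) simp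
      next
        case False
        then have "k \<le> r" using notin[of r] r abc(1) by (metis not_gr_zero not_le)
        then show ?thesis using r by (intro exI[of _ r]) simp
      qed
    qed
    \<comment> \<open>Additively \<open>g = x - s\<close>, halfway between \<open>y\<close> and
      \<open>x\<close>.\<close>
    define g where "g = s [^] (2::nat) \<otimes> (e1 \<otimes> e1 \<otimes> e1)"
    have gc: "g \<in> carrier G" using sc ec by (simp add: g_def)
    have xg: "x = s \<otimes> g" unfolding x_e g_def using sc ec by (simp add: numeral_3_eq_3 numeral_2_eq_2 m_ac)
    have "g \<noteq> x" using xg s1 gc sc by auto
    moreover have "g \<noteq> y"
    proof
      assume "g = y"
      then have "s \<otimes> g = s \<otimes> (s \<otimes> g)" using xg xt sc yc by (simp add: st m_assoc)
      then show False using s1 gc sc by auto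
    qed
    ultimately have "g \<in> ?T" using T_iff[OF gc] by simp
    then obtain a b c where abc: "a \<in> A" "b \<in> A" "c \<in> A" "g = a \<otimes> b \<otimes> c" by (auto simp: mem_triple_iff)
    have car: "a \<in> carrier G" "b \<in> carrier G" "c \<in> carrier G" using abc acar by auto
    obtain i where i: "k \<le> i" "i \<le> ?l" "a = p i" using range[OF abc(1-3) abc(4)[symmetric] xg] by blast
    have "b \<otimes> a \<otimes> c = g" using abc(4) car by (simp add: m_ac)
    then obtain j where j: "k \<le> j" "j \<le> ?l" "b = p j" using range[OF abc(2,1,3) _ xg] by blast
    have "c \<otimes> a \<otimes> b = g" using abc(4) car by (simp add: m_ac)
    then obtain m where m: "k \<le> m" "m \<le> ?l" "c = p m" using range[OF abc(3,1,2) _ xg] by blast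
    have "g = s [^] (i + j + m) \<otimes> (e1 \<otimes> e1 \<otimes> e1)"
      unfolding abc(4) i(3) j(3) m(3) p_def using sc ec by (simp add: m_ac flip: nat_pow_mult)
    then have "s [^] (i + j + m) = s [^] (2::nat)" unfolding g_def using sc ec by simp
    then have "(i + j + m) mod ?l = 2 mod ?l" unfolding s_eq .
    then have "?l dvd (i + j + m) - 2" using k(3) i(1) by (metis mod_eq_dvd_iff_nat trans_le_add1 less_imp_le le_trans)
    then obtain c where c: "i + j + m - 2 = ?l * c" by (rule dvdE)
    \<comment> \<open>Three positions from \<open>k\<close> to \<open>?l\<close> have a sum from
      \<open>2 * ?l + 4\<close> to \<open>3 * ?l\<close>, so \<open>i + j + m - 2\<close> lies
      strictly between two consecutive multiples of \<open>?l\<close>.\<close>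
    have b1: "?l * 2 + 2 \<le> ?l * c" "?l * c + 2 \<le> ?l * 3" using c k(1) i j m l(3) by linarith+
    then have "?l * 2 < ?l * c" "?l * c < ?l * 3" by linarith+
    then have "2 < c" "c < 3" by (simp_all only: mult_less_cancel1)
    then show False by simp
  qed
qed

end

section \<open>Elementary abelian 7-groups\<close>

text \<open>\<open>a1\<close> to \<open>a6\<close> are the numbers of points of \<open>A\<close> on
  the six other parallels, within a plane, of a line through the origin, which itself has 2 points.
  A hypothesis \<open>c\<close> with three digits is the Cauchy-Davenport bound for three layers
  whose indices add up to 0 modulo 7; in \<open>c016\<close> and \<open>c034\<close> the 2 points of
  layer 0 turn the bound 8 into 6.\<close>

lemma layer_arith:
  fixes a1 a2 a3 a4 a5 a6 :: nat
  assumes sum: "a1 + a2 + a3 + a4 + a5 + a6 = 14"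
    and le: "a1 \<le> 7" "a2 \<le> 7" "a4 \<le> 7"
    and c016: "a1 = 0 \<or> a6 = 0 \<or> a1 + a6 \<le> 6" and c034: "a3 = 0 \<or> a4 = 0 \<or> a3 + a4 \<le> 6"
    and c115: "a1 = 0 \<or> a5 = 0 \<or> a1 + a1 + a5 \<le> 8" and c223: "a2 = 0 \<or> a3 = 0 \<or> a2 + a2 + a3 \<le> 8"
    and c331: "a3 = 0 \<or> a1 = 0 \<or> a3 + a3 + a1 \<le> 8" and c446: "a4 = 0 \<or> a6 = 0 \<or> a4 + a4 + a6 \<le> 8"
    and c662: "a6 = 0 \<or> a2 = 0 \<or> a6 + a6 + a2 \<le> 8"
    and c124: "a1 = 0 \<or> a2 = 0 \<or> a4 = 0 \<or> a1 + a2 + a4 \<le> 8"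
    and a1: "4 \<le> a1"
  shows "a1 = 7 \<and> a3 = 0 \<and> a5 = 0 \<and> a6 = 0 \<and> (a2 = 7 \<and> a4 = 0 \<or> a4 = 7 \<and> a2 = 0)"
proof -
  have a5: "a5 = 0" using c115 a1 by linarith
  have a3: "a3 \<le> 2" using c331 a1 by linarith
  have a6: "a6 = 0 \<or> a1 + a6 \<le> 6" using c016 a1 by linarith
  consider "4 \<le> a2" | "4 \<le> a4" | "a2 \<le> 3" "a4 \<le> 3" by linarith
  then show ?thesis
  proof cases
    case 1
    have "a3 = 0" using c223 1 by linarith
    moreover have "a4 = 0" using c124 1 a1 by linarith
    ultimately have s: "a1 + a2 + a6 = 14" using sum a5 by simp
    then have "a6 = 0" using c662 a6 le by linarith
    then show ?thesis using s le \<open>a3 = 0\<close> \<open>a4 = 0\<close> a5 by simp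
  next
    case 2
    have "a6 = 0" using c446 2 by linarith
    moreover have "a2 = 0" using c124 2 a1 by linarith
    ultimately have s: "a1 + a3 + a4 = 14" using sum a5 by simp
    then have "a3 = 0" using c034 2 a3 le by linarith
    then show ?thesis using s le \<open>a2 = 0\<close> \<open>a6 = 0\<close> a5 by simp
  next
    case 3
    have "a1 + a6 \<le> 7" using a6 le by linarith
    moreover have "a2 = 0 \<or> a4 = 0 \<or> a1 + a2 + a4 \<le> 8" using c124 a1 by linarith
    moreover have "a6 \<le> 2" using a6 a1 by linarith
    ultimately have False using sum a5 a3 3 by linarith
    then show ?thesis ..
  qed
qed

context finite_comm_group
begin

text \<open>Kneser's theorem in a group of prime order: the stabilizer of \<open>P <#> Q\<close> is
  trivial unless \<open>P <#> Q = W\<close>, which would leave no room for the inverses of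
  \<open>R\<close>.\<close>

lemma cauchy_davenport_7:
  assumes W: "subgroup W G" "card W = 7" and XYZ: "P \<subseteq> W" "Q \<subseteq> W" "R \<subseteq> W" "P \<noteq> {}" "Q \<noteq> {}" "R \<noteq> {}"
    and one: "\<And>p q r. p \<in> P \<Longrightarrow> q \<in> Q \<Longrightarrow> r \<in> R \<Longrightarrow> p \<otimes> q \<otimes> r \<noteq> \<one>"
  shows "card P + card Q + card R \<le> 8"
proof -
  have Wc: "W \<subseteq> carrier G" using W(1) by (rule subgroup.subset)
  have c: "P \<subseteq> carrier G" "Q \<subseteq> carrier G" "R \<subseteq> carrier G" using XYZ Wc by auto
  have PQW: "P <#> Q \<subseteq> W" using XYZ by (auto simp: set_mult_def intro!: subgroup.m_closed[OF W(1)])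
  have PQc: "P <#> Q \<subseteq> carrier G" using PQW Wc by auto
  let ?R = "(\<lambda>r. inv r) ` R"
  have cR: "card ?R = card R" using c(3) inj_on_subset[OF inv_inj] by (intro card_image) auto
  have RW: "?R \<subseteq> W" using XYZ(3) by (auto intro!: subgroup.m_inv_closed[OF W(1)])
  have dis: "(P <#> Q) \<inter> ?R = {}"
  proof -
    have False if r: "r \<in> R" "inv r \<in> P <#> Q" for r
    proof -
      obtain p q where pq: "p \<in> P" "q \<in> Q" "inv r = p \<otimes> q" using r(2) by (auto simp: set_mult_def)
      have "r \<in> carrier G" using r c by auto
      then have "p \<otimes> q \<otimes> r = \<one>" by (simp flip: pq(3))
      then show False using one[OF pq(1,2) r(1)] by simp
    qed
    then show ?thesis by blast
  qed
  have "card (P <#> Q) + card R = card ((P <#> Q) \<union> ?R)"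
    using dis PQc RW Wc cR by (subst card_Un_disjoint) (auto intro: finite_subset_carrier)
  also have "\<dots> \<le> card W" using PQW RW Wc by (intro card_mono) auto
  finally have b: "card (P <#> Q) + card R \<le> 7" using W(2) by simp
  let ?S = "stab (P <#> Q)"
  have S: "subgroup ?S G" using PQc by (rule subgroup_stab)
  have "P <#> Q \<noteq> {}" using XYZ by (auto simp: set_mult_def)
  then obtain z where z: "z \<in> P <#> Q" by blast
  have "?S \<subseteq> W"
  proof
    fix g assume g: "g \<in> ?S"
    then have gc: "g \<in> carrier G" and "g \<otimes> z \<in> W" using z PQW by (auto simp: stab_def)
    moreover have "z \<in> W" using z PQW by auto
    ultimately have "g \<otimes> z \<otimes> inv z \<in> W" using W(1) by (simp add: subgroup.m_closed subgroup.m_inv_closed)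
    then show "g \<in> W" using gc \<open>z \<in> W\<close> Wc by (simp add: m_assoc subset_iff)
  qed
  then have "periodic ?S W" unfolding periodic_def by (auto intro: subgroup.m_closed[OF W(1)])
  then have "card ?S dvd 7" using card_dvd_periodic[OF S Wc] W(2) by simp
  moreover have "Factorial_Ring.prime (7::nat)" by simp
  ultimately have "card ?S = 1 \<or> card ?S = 7" using prime_nat_iff by blast
  then have "card ?S = 1"
  proof
    assume "card ?S = 7"
    then have "7 dvd card (P <#> Q)" using card_dvd_periodic[OF S PQc periodic_stab] by simp
    moreover have "card (P <#> Q) \<noteq> 0" using z PQc by auto
    ultimately have "7 \<le> card (P <#> Q)" by (intro dvd_imp_le) auto
    moreover have "card R \<noteq> 0" using XYZ c by auto
    ultimately show ?thesis using b by simp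
  qed simp
  then show ?thesis using kneser[OF c(1) XYZ(4) c(2) XYZ(5)] b by linarith
qed

section \<open>Lines and layers in exponent 7\<close>

abbreviation line :: "'a \<Rightarrow> 'a set"
  where "line t \<equiv> adj {\<one>} t"

lemma subgroup_line: "t \<in> carrier G \<Longrightarrow> subgroup (line t) G"
  using subgroup_adj[OF subgroup_one] .

lemma mem_line: "t \<in> carrier G \<Longrightarrow> t \<in> line t"
  using mem_adj[OF subgroup_one] .

lemma line_subset: "subgroup V G \<Longrightarrow> t \<in> V \<Longrightarrow> line t \<subseteq> V"
  using adj_subset[OF subgroup_one subgroup.mem_carrier] subgroup.one_closed by blast

context
  fixes A
  assumes exp7: "\<And>x. x \<in> carrier G \<Longrightarrow> x [^] (7::nat) = \<one>"
    and A: "A \<subseteq> carrier G" and one_miss: "\<one> \<notin> triple A" and third: "3 * card A + 1 = order G"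
begin

text \<open>The points of \<open>A\<close> in the coset of \<open>u [^] i\<close>, translated back
  into \<open>W\<close> so that layers of different index can be multiplied inside one
  subgroup.\<close>

definition layer :: "'a set \<Rightarrow> 'a \<Rightarrow> nat \<Rightarrow> 'a set"
  where "layer W u i = {w \<in> W. u [^] i \<otimes> w \<in> A}"

lemma A_carrier: "a \<in> A \<Longrightarrow> a \<in> carrier G"
  using A by auto

lemma no_triple_one: "a \<in> A \<Longrightarrow> b \<in> A \<Longrightarrow> c \<in> A \<Longrightarrow> a \<otimes> b \<otimes> c \<noteq> \<one>"
  using one_miss tripleI by metis

lemma one_notin: "\<one> \<notin> A"
  using no_triple_one[of \<one> \<one> \<one>] by auto

lemma relord_7: "subgroup W G \<Longrightarrow> u \<in> carrier G \<Longrightarrow> u \<notin> W \<Longrightarrow> relord W u = 7"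
  using exp7 subgroup.one_closed by (intro relord_eqI_prime) auto

lemma card_line: "t \<in> carrier G \<Longrightarrow> t \<noteq> \<one> \<Longrightarrow> card (line t) = 7"
  by (simp add: card_adj[OF subgroup_one] relord_7[OF subgroup_one])

lemma line_eq:
  assumes "t \<in> carrier G" "b \<in> line t" "b \<noteq> \<one>" shows "line b = line t"
proof -
  have c: "line t \<subseteq> carrier G" using subgroup_line[OF assms(1)] by (rule subgroup.subset)
  have bc: "b \<in> carrier G" using c assms by auto
  have "t \<noteq> \<one>"
  proof
    assume "t = \<one>"
    then have "line t \<subseteq> {\<one>}" by (intro line_subset subgroup_one) simp
    then show False using assms by auto
  qed
  then show ?thesis
    using card_line[OF bc assms(3)] card_line[OF assms(1)] line_subset[OF subgroup_line[OF assms(1)] assms(2)] c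
    by (intro card_subset_eq) auto
qed

lemma line_sym: "t \<in> carrier G \<Longrightarrow> b \<in> line t \<Longrightarrow> b \<noteq> \<one> \<Longrightarrow> t \<in> line b"
  using line_eq mem_line by blast

lemma layer_subset: "layer W u i \<subseteq> W"
  by (auto simp: layer_def)

text \<open>The powers of \<open>u\<close> cancel, so the condition
  \<open>\<one> \<notin> triple A\<close> becomes one inside \<open>W\<close>.\<close>

lemma layer_triple:
  assumes "u \<in> carrier G" "W \<subseteq> carrier G" "7 dvd i + j + k"
    "p \<in> layer W u i" "q \<in> layer W u j" "r \<in> layer W u k"
  shows "p \<otimes> q \<otimes> r \<noteq> \<one>"
proof -
  have c: "p \<in> carrier G" "q \<in> carrier G" "r \<in> carrier G" using assms by (auto simp: layer_def)
  obtain m where "i + j + k = 7 * m" using assms(3) by blast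
  then have "u [^] (i + j + k) = (u [^] (7::nat)) [^] m" using assms(1) by (simp add: nat_pow_pow)
  then have "u [^] (i + j + k) = \<one>" using exp7[OF assms(1)] by simp
  moreover have "(u [^] i \<otimes> p) \<otimes> (u [^] j \<otimes> q) \<otimes> (u [^] k \<otimes> r) = u [^] (i + j + k) \<otimes> (p \<otimes> q \<otimes> r)"
    using assms(1) c by (simp add: m_ac flip: nat_pow_mult)
  moreover have "(u [^] i \<otimes> p) \<otimes> (u [^] j \<otimes> q) \<otimes> (u [^] k \<otimes> r) \<noteq> \<one>"
    using assms(4-6) by (intro no_triple_one) (auto simp: layer_def)
  ultimately show ?thesis using c by auto
qed

lemma layer_full_product:
  assumes W: "subgroup W G" and u: "u \<in> carrier G" and k: "7 dvd i + j + k"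
    and full: "W \<subseteq> layer W u i <#> layer W u j"
  shows "layer W u k = {}"
proof -
  have Wc: "W \<subseteq> carrier G" using W by (rule subgroup.subset)
  have False if r: "r \<in> layer W u k" for r
  proof -
    have rW: "r \<in> W" using r layer_subset by blast
    then have "inv r \<in> W" by (rule subgroup.m_inv_closed[OF W])
    then obtain p q where pq: "p \<in> layer W u i" "q \<in> layer W u j" "inv r = p \<otimes> q"
      using full by (auto simp: set_mult_def)
    have "r \<in> carrier G" using rW Wc by auto
    then have "p \<otimes> q \<otimes> r = \<one>" by (simp flip: pq(3))
    then show False using layer_triple[OF u Wc k pq(1,2) r] by simp
  qed
  then show ?thesis by blast
qed

lemma layer_pigeonhole:
  assumes W: "subgroup W G" and u: "u \<in> carrier G" and k: "7 dvd i + j + k"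
    and c: "card W < card (layer W u i) + card (layer W u j)"
  shows "layer W u k = {}"
  using set_mult_eq_subgroup[OF W layer_subset layer_subset c] by (intro layer_full_product[OF W u k]) simp

lemma layer_cauchy_davenport:
  assumes W: "subgroup W G" "card W = 7" and u: "u \<in> carrier G" and k: "7 dvd i + j + k"
  shows "card (layer W u i) = 0 \<or> card (layer W u j) = 0 \<or> card (layer W u k) = 0 \<or>
    card (layer W u i) + card (layer W u j) + card (layer W u k) \<le> 8"
proof -
  have Wc: "W \<subseteq> carrier G" using W(1) by (rule subgroup.subset)
  show ?thesis
  proof (rule ccontr)
    assume "\<not> ?thesis"
    then have ne: "layer W u i \<noteq> {}" "layer W u j \<noteq> {}" "layer W u k \<noteq> {}"
      and gt: "\<not> card (layer W u i) + card (layer W u j) + card (layer W u k) \<le> 8" by auto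
    show False
      using gt cauchy_davenport_7[OF W layer_subset layer_subset layer_subset ne] layer_triple[OF u Wc k] by blast
  qed
qed

text \<open>Three copies of one set obey the Cauchy-Davenport bound 8.\<close>

lemma line_count_le: "t \<in> carrier G \<Longrightarrow> t \<noteq> \<one> \<Longrightarrow> card (A \<inter> line t) \<le> 2"
proof -
  assume t: "t \<in> carrier G" "t \<noteq> \<one>"
  show ?thesis
  proof (cases "A \<inter> line t = {}")
    case False
    have "card (A \<inter> line t) + card (A \<inter> line t) + card (A \<inter> line t) \<le> 8"
      using False no_triple_one by (intro cauchy_davenport_7[OF subgroup_line[OF t(1)] card_line[OF t]]) auto
    then show ?thesis by simp
  qed simp
qed

text \<open>Double counting: an element \<open>b \<noteq> \<one>\<close> lies on
  \<open>line t\<close> for exactly 6 values of \<open>t\<close>, the generators of its own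
  line.\<close>

lemma incidence_count:
  assumes V: "subgroup V G" and S: "S \<subseteq> V" "\<one> \<notin> S"
  shows "(\<Sum>t\<in>V - {\<one>}. card {b \<in> S. b \<in> line t}) = 6 * card S"
proof -
  have Vc: "V \<subseteq> carrier G" using V by (rule subgroup.subset)
  have fin: "finite V" "finite S" using Vc S by auto
  have "card {t \<in> V - {\<one>}. b \<in> line t} = 6" if b: "b \<in> S" for b
  proof -
    have bc: "b \<in> carrier G" "b \<noteq> \<one>" "b \<in> V" using b S Vc by auto
    have "{t \<in> V - {\<one>}. b \<in> line t} = line b - {\<one>}"
    proof (intro equalityI subsetI)
      fix t assume t: "t \<in> {t \<in> V - {\<one>}. b \<in> line t}"
      then show "t \<in> line b - {\<one>}" using line_sym[of t b] bc Vc by auto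
    next
      fix t assume t: "t \<in> line b - {\<one>}"
      then have "t \<in> V" using line_subset[OF V bc(3)] by auto
      then show "t \<in> {t \<in> V - {\<one>}. b \<in> line t}" using t line_sym[of b t] bc by auto
    qed
    moreover have "\<one> \<in> line b" using subgroup_line[OF bc(1)] by (rule subgroup.one_closed)
    ultimately show ?thesis using card_line[OF bc(1,2)] by (simp add: card_Diff_singleton)
  qed
  then have "(\<Sum>t\<in>V - {\<one>}. card {b \<in> S. b \<in> line t}) = (\<Sum>b\<in>S. 6)"
    using fin by (intro sum_multicount_gen) auto
  then show ?thesis by simp
qed

text \<open>Since \<open>3 * card A = order G - 1\<close>, the average over all directions equals
  the upper bound 2, so no line can fall below it.\<close>

lemma line_count:
  assumes t: "t \<in> carrier G" "t \<noteq> \<one>" shows "card (A \<inter> line t) = 2"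
proof (rule ccontr)
  assume ne: "card (A \<inter> line t) \<noteq> 2"
  let ?f = "\<lambda>t. card {b \<in> A. b \<in> line t}"
  have f: "?f t = card (A \<inter> line t)" for t by (simp add: Int_def)
  have V: "subgroup (carrier G) G" by (rule subgroup_self)
  have "(\<Sum>t\<in>carrier G - {\<one>}. ?f t) < (\<Sum>t\<in>carrier G - {\<one>}. 2)"
  proof (rule sum_strict_mono_ex1)
    show "\<forall>x\<in>carrier G - {\<one>}. ?f x \<le> 2" using line_count_le f by simp
    have "?f t < 2" using line_count_le[OF t] ne f by simp
    then show "\<exists>a\<in>carrier G - {\<one>}. ?f a < 2" using t by blast
  qed simp
  moreover have "card (carrier G - {\<one>}) = 3 * card A" using third by (simp add: order_def card_Diff_singleton)
  ultimately show False using incidence_count[OF V A one_notin] by simp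
qed

lemma subgroup_count:
  assumes V: "subgroup V G" shows "3 * card (A \<inter> V) + 1 = card V"
proof -
  have Vc: "V \<subseteq> carrier G" using V by (rule subgroup.subset)
  have "(\<Sum>t\<in>V - {\<one>}. card {b \<in> A \<inter> V. b \<in> line t}) = (\<Sum>t\<in>V - {\<one>}. 2)"
  proof (rule sum.cong[OF refl])
    fix t assume t: "t \<in> V - {\<one>}"
    then have "{b \<in> A \<inter> V. b \<in> line t} = A \<inter> line t" using line_subset[OF V, of t] by auto
    then show "card {b \<in> A \<inter> V. b \<in> line t} = 2" using line_count[of t] t Vc by auto
  qed
  then have "2 * card (V - {\<one>}) = 6 * card (A \<inter> V)"
    using incidence_count[OF V, of "A \<inter> V"] one_notin by simp
  moreover have "card (V - {\<one>}) = card V - 1" using subgroup.one_closed[OF V] by (simp add: card_Diff_singleton)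
  ultimately show ?thesis using subgroup_card_pos[OF V] by linarith
qed

text \<open>\<open>adj W u\<close> and \<open>W\<close> contain \<open>(7 * card W - 1) / 3\<close>
  and \<open>(card W - 1) / 3\<close> points of \<open>A\<close>; the difference is spread over the
  six nonzero layers.\<close>

lemma layer_sum:
  assumes W: "subgroup W G" and u: "u \<in> carrier G" "u \<notin> W"
  shows "card (layer W u 1) + card (layer W u 2) + card (layer W u 3) + card (layer W u 4) +
    card (layer W u 5) + card (layer W u 6) = 2 * card W"
proof -
  let ?l = "\<lambda>i. (\<lambda>w. u [^] (i::nat) \<otimes> w) ` layer W u i"
  have Wc: "W \<subseteq> carrier G" using W by (rule subgroup.subset)
  have r: "relord W u = 7" using W u by (rule relord_7)
  have lc: "layer W u i \<subseteq> carrier G" for i using layer_subset Wc by blast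
  have cl: "card (?l i) = card (layer W u i)" for i using u(1) lc by (intro card_mult_image) auto
  have un: "A \<inter> adj W u = (\<Union>i\<in>{..<7}. ?l i)"
  proof (intro equalityI subsetI)
    fix z assume z: "z \<in> A \<inter> adj W u"
    then have "z \<in> blk W u {..<7}" using adj_eq[OF W u(1)] r by simp
    then obtain i w where "i \<in> {..<7::nat}" "w \<in> W" "z = u [^] i \<otimes> w" by (rule blkE)
    then show "z \<in> (\<Union>i\<in>{..<7}. ?l i)" using z by (auto simp: layer_def)
  next
    fix z assume "z \<in> (\<Union>i\<in>{..<7}. ?l i)"
    then show "z \<in> A \<inter> adj W u" by (auto simp: layer_def adj_def blk_def)
  qed
  have "card (\<Union>i\<in>{..<7}. ?l i) = (\<Sum>i<7. card (?l i))"
  proof (rule card_UN_disjoint)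
    show "\<forall>i\<in>{..<7::nat}. finite (?l i)" using lc by auto
    show "\<forall>i\<in>{..<7}. \<forall>j\<in>{..<7}. i \<noteq> j \<longrightarrow> ?l i \<inter> ?l j = {}"
    proof (intro ballI impI)
      fix i j :: nat assume ij: "i \<in> {..<7}" "j \<in> {..<7}" "i \<noteq> j"
      have False if "v \<in> layer W u i" "w \<in> layer W u j" "u [^] i \<otimes> v = u [^] j \<otimes> w" for v w
        using pow_mult_eq_imp_mod_eq[OF W u(1) that(3)] that ij by (auto simp: layer_def r)
      then show "?l i \<inter> ?l j = {}" by blast
    qed
  qed simp
  then have s: "card (A \<inter> adj W u) = (\<Sum>i<7. card (layer W u i))" unfolding un cl .
  have "layer W u 0 = A \<inter> W" using Wc by (auto simp: layer_def)
  then have "card (A \<inter> adj W u) = card (A \<inter> W) + (card (layer W u 1) + card (layer W u 2) + card (layer W u 3) +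
    card (layer W u 4) + card (layer W u 5) + card (layer W u 6))"
    unfolding s by (simp add: eval_nat_numeral)
  moreover have "3 * card (A \<inter> adj W u) + 1 = 7 * card W"
    using subgroup_count[OF subgroup_adj[OF W u(1)]] card_adj[OF W u(1)] r by simp
  ultimately show ?thesis using subgroup_count[OF W] by linarith
qed

lemma card_layer_le: "subgroup W G \<Longrightarrow> card (layer W u i) \<le> card W"
  using layer_subset subgroup_finite by (intro card_mono)

lemma layer_eq_full: "subgroup W G \<Longrightarrow> card (layer W u i) = card W \<Longrightarrow> layer W u i = W"
  using layer_subset subgroup_finite by (intro card_subset_eq)

lemma layer_empty_iff: "subgroup W G \<Longrightarrow> card (layer W u i) = 0 \<longleftrightarrow> layer W u i = {}"
  using finite_subset[OF layer_subset subgroup_finite] by simp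

text \<open>More than three points on one parallel force every nonzero layer to be full or empty
  (\<open>layer_arith\<close>), which is what lets a single full coset determine its plane.\<close>

lemma line_pattern:
  assumes t: "t \<in> carrier G" "t \<noteq> \<one>" and u: "u \<in> carrier G" "u \<notin> line t" and c: "4 \<le> card (layer (line t) u 1)"
  shows "layer (line t) u 1 = line t \<and> layer (line t) u 3 = {} \<and> layer (line t) u 5 = {} \<and> layer (line t) u 6 = {} \<and>
    (layer (line t) u 2 = line t \<and> layer (line t) u 4 = {} \<or> layer (line t) u 4 = line t \<and> layer (line t) u 2 = {})"
proof -
  let ?a = "\<lambda>i. card (layer (line t) u i)"
  note W = subgroup_line[OF t(1)]
  have c7: "card (line t) = 7" using card_line[OF t] .
  have Wc: "line t \<subseteq> carrier G" using W by (rule subgroup.subset)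
  note cd = layer_cauchy_davenport[OF W c7 u(1)]
  have "layer (line t) u 0 = A \<inter> line t" using Wc by (auto simp: layer_def)
  then have a0: "?a 0 = 2" using line_count[OF t] by simp
  have sum: "?a 1 + ?a 2 + ?a 3 + ?a 4 + ?a 5 + ?a 6 = 14" using layer_sum[OF W u] c7 by simp
  have le: "?a i \<le> 7" for i using card_layer_le[OF W] c7 by metis
  have "?a 1 = 7 \<and> ?a 3 = 0 \<and> ?a 5 = 0 \<and> ?a 6 = 0 \<and> (?a 2 = 7 \<and> ?a 4 = 0 \<or> ?a 4 = 7 \<and> ?a 2 = 0)"
  proof (rule layer_arith[OF sum le le le])
    show "?a 1 = 0 \<or> ?a 6 = 0 \<or> ?a 1 + ?a 6 \<le> 6" using cd[of 1 6 0] a0 by auto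
    show "?a 3 = 0 \<or> ?a 4 = 0 \<or> ?a 3 + ?a 4 \<le> 6" using cd[of 3 4 0] a0 by auto
  qed (use cd[of 1 1 5] cd[of 2 2 3] cd[of 3 3 1] cd[of 4 4 6] cd[of 6 6 2] cd[of 1 2 4] c in auto)
  then show ?thesis
    using layer_eq_full[OF W, of u] layer_empty_iff[OF W, of u] by (metis c7)
qed

lemma layer_1_coset: "u \<in> carrier G \<Longrightarrow> layer W u 1 = {w \<in> W. u \<otimes> w \<in> A}"
  by (simp add: layer_def)

lemma full_coset_iff:
  assumes "u \<in> carrier G" shows "layer W u 1 = W \<longleftrightarrow> (\<forall>w\<in>W. u \<otimes> w \<in> A)"
  unfolding layer_1_coset[OF assms] by blast

text \<open>A plane without a full coset of a line would be met by \<open>A\<close> in a set of 16 points with at most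
  three on each affine line; counting the lines through a point of \<open>A\<close>, each line that misses the
  origin would then contain 0 or 3 points of \<open>A\<close>, whereas 3 does not divide 14.\<close>

lemma exists_full_coset:
  assumes V: "subgroup V G" "card V = 49"
  shows "\<exists>t\<in>V - {\<one>}. \<exists>u\<in>A \<inter> V - line t. \<forall>w\<in>line t. u \<otimes> w \<in> A"
proof (rule ccontr)
  assume no: "\<not> ?thesis"
  have Vc: "V \<subseteq> carrier G" using V(1) by (rule subgroup.subset)
  have cAV: "card (A \<inter> V) = 16" using subgroup_count[OF V(1)] V(2) by simp
  have le3: "card (layer (line t) u 1) \<le> 3" if tu: "t \<in> V - {\<one>}" "u \<in> A \<inter> V - line t" for t u
  proof (rule ccontr)
    assume "\<not> ?thesis"
    then have c: "4 \<le> card (layer (line t) u 1)" by simp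
    have tc: "t \<in> carrier G" "t \<noteq> \<one>" "u \<in> carrier G" "u \<notin> line t" using tu Vc by auto
    have "layer (line t) u 1 = line t" using line_pattern[OF tc c] by (rule conjunct1)
    then have "\<forall>w\<in>line t. u \<otimes> w \<in> A" by (simp only: full_coset_iff[OF tc(3)])
    then show False using no tu by blast
  qed
  \<comment> \<open>Seen from \<open>a\<close>, the 15 other points of \<open>A\<close> in
    \<open>V\<close> are counted 90 times: the 6 directions on \<open>line a\<close> contribute 1
    each and the 42 others at most 2 each. As \<open>6 + 84 = 90\<close>, each of the latter
    contributes exactly 2.\<close>
  have eq3: "card (layer (line t) a 1) = 3" if at: "a \<in> A \<inter> V" "t \<in> V - line a" for a t
  proof (rule ccontr)
    assume ne: "card (layer (line t) a 1) \<noteq> 3"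
    have ac: "a \<in> carrier G" "a \<noteq> \<one>" "a \<in> V" using at Vc one_notin by auto
    define S where "S = (\<lambda>b. inv a \<otimes> b) ` (A \<inter> V - {a})"
    have S: "S \<subseteq> V" "\<one> \<notin> S"
    proof -
      show "S \<subseteq> V" unfolding S_def using ac V(1) by (auto intro!: subgroup.m_closed subgroup.m_inv_closed)
      show "\<one> \<notin> S"
      proof
        assume "\<one> \<in> S"
        then obtain b where b: "b \<in> A" "b \<noteq> a" "\<one> = inv a \<otimes> b" by (auto simp: S_def)
        have "b = a \<otimes> (inv a \<otimes> b)" using b(1) A_carrier ac by simp
        also have "\<dots> = a" unfolding b(3)[symmetric] using ac by simp
        finally show False using b(2) by simp
      qed
    qed
    have cS: "card S = 15" unfolding S_def
      using ac cAV at Vc by (subst card_mult_image) (auto simp: card_Diff_singleton)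
    have S_iff: "{b \<in> S. b \<in> line t} = layer (line t) a 1 - {\<one>}" if t: "t \<in> V" for t
    proof -
      have lV: "line t \<subseteq> V" using line_subset[OF V(1) t] .
      have "b \<in> S \<longleftrightarrow> a \<otimes> b \<in> A \<and> b \<noteq> \<one>" if b: "b \<in> line t" for b
      proof
        assume bS: "b \<in> S"
        then obtain c where c: "c \<in> A \<inter> V" "b = inv a \<otimes> c" by (auto simp: S_def)
        then have "a \<otimes> b = c" using ac Vc by auto
        then show "a \<otimes> b \<in> A \<and> b \<noteq> \<one>" using c bS S(2) by auto
      next
        assume ab: "a \<otimes> b \<in> A \<and> b \<noteq> \<one>"
        have bV: "b \<in> V" "b \<in> carrier G" using b lV Vc by auto
        have "a \<otimes> b \<in> V" using ac(3) bV(1) by (rule subgroup.m_closed[OF V(1)])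
        moreover have "a \<otimes> b \<noteq> a" using ab ac bV by auto
        moreover have "b = inv a \<otimes> (a \<otimes> b)" using ac bV by simp
        ultimately show "b \<in> S" using ab unfolding S_def by blast
      qed
      then show ?thesis using layer_1_coset[OF ac(1), of "line t"] by blast
    qed
    have one_lay: "\<one> \<in> layer (line s) a 1" if "s \<in> V" for s
      using subgroup.one_closed[OF subgroup_line, of s] that Vc at ac by (auto simp: layer_def)
    have fin_lay: "finite (layer (line s) a 1)" if "s \<in> V" for s
      using finite_subset[OF layer_subset subgroup_finite[OF subgroup_line]] that Vc by blast
    have c1: "card {b \<in> S. b \<in> line s} = card (layer (line s) a 1) - 1" if "s \<in> V" for s
      unfolding S_iff[OF that] using one_lay[OF that] by (simp add: card_Diff_singleton)
    have lineV: "line a \<subseteq> V" using line_subset[OF V(1) ac(3)] .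
    have e_line: "card {b \<in> S. b \<in> line s} = 1" if s: "s \<in> line a - {\<one>}" for s
    proof -
      have sV: "s \<in> V" using s lineV by auto
      have ls: "line s = line a" using line_eq[OF ac(1)] s by auto
      have "layer (line s) a 1 = (\<lambda>b. inv a \<otimes> b) ` (A \<inter> line a)"
      proof (intro equalityI subsetI)
        fix w assume w: "w \<in> layer (line s) a 1"
        then have w': "w \<in> line a" "a \<otimes> w \<in> A" using layer_1_coset[OF ac(1)] ls by auto
        have "a \<otimes> w \<in> line a" using mem_line[OF ac(1)] w'(1) by (rule subgroup.m_closed[OF subgroup_line[OF ac(1)]])
        moreover have "w = inv a \<otimes> (a \<otimes> w)" using w' lineV Vc ac by auto
        ultimately show "w \<in> (\<lambda>b. inv a \<otimes> b) ` (A \<inter> line a)" using w'(2) by blast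
      next
        fix w assume "w \<in> (\<lambda>b. inv a \<otimes> b) ` (A \<inter> line a)"
        then obtain b where b: "b \<in> A" "b \<in> line a" "w = inv a \<otimes> b" by auto
        have "inv a \<in> line a" using mem_line[OF ac(1)] by (rule subgroup.m_inv_closed[OF subgroup_line[OF ac(1)]])
        then have "w \<in> line a" unfolding b(3) using b(2) by (rule subgroup.m_closed[OF subgroup_line[OF ac(1)]])
        moreover have "a \<otimes> w = b" using b A_carrier ac by simp
        ultimately show "w \<in> layer (line s) a 1" using b layer_1_coset[OF ac(1)] ls by simp
      qed
      moreover have "card ((\<lambda>b. inv a \<otimes> b) ` (A \<inter> line a)) = 2"
        using line_count[OF ac(1,2)] ac A by (subst card_mult_image) auto
      ultimately have "card (layer (line s) a 1) = 2" by simp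
      then show ?thesis using c1[OF sV] by simp
    qed
    have e_out: "card {b \<in> S. b \<in> line s} \<le> 2" if s: "s \<in> V - line a" for s
    proof -
      have s1: "s \<noteq> \<one>" using s subgroup.one_closed[OF subgroup_line[OF ac(1)]] by auto
      have "a \<notin> line s" using line_sym[of s a] s ac Vc by auto
      then have "card (layer (line s) a 1) \<le> 3" using le3[of s a] s s1 at by auto
      then show ?thesis using c1[of s] s by simp
    qed
    have e_t: "card {b \<in> S. b \<in> line t} < 2"
    proof -
      have s1: "t \<noteq> \<one>" using at subgroup.one_closed[OF subgroup_line[OF ac(1)]] by auto
      have "a \<notin> line t" using line_sym[of t a] at ac Vc by auto
      then have "card (layer (line t) a 1) \<le> 3" using le3[of t a] at s1 by auto
      then show ?thesis using c1[of t] at ne by simp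
    qed
    have split: "V - {\<one>} = (line a - {\<one>}) \<union> (V - line a)"
      using lineV subgroup.one_closed[OF subgroup_line[OF ac(1)]] by blast
    have finV: "finite V" using Vc by simp
    have "(\<Sum>s\<in>V - {\<one>}. card {b \<in> S. b \<in> line s}) =
        (\<Sum>s\<in>line a - {\<one>}. card {b \<in> S. b \<in> line s}) + (\<Sum>s\<in>V - line a. card {b \<in> S. b \<in> line s})"
      unfolding split using finV finite_subset[OF lineV] by (intro sum.union_disjoint) auto
    also have "(\<Sum>s\<in>line a - {\<one>}. card {b \<in> S. b \<in> line s}) = (\<Sum>s\<in>line a - {\<one>}. 1)"
      by (rule sum.cong[OF refl e_line])
    also have "(\<Sum>s\<in>line a - {\<one>}. 1) = (6::nat)"
      using card_line[OF ac(1,2)] subgroup.one_closed[OF subgroup_line[OF ac(1)]] by (simp add: card_Diff_singleton)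
    also have "(\<Sum>s\<in>V - line a. card {b \<in> S. b \<in> line s}) < (\<Sum>s\<in>V - line a. 2)"
      using finV e_out e_t at by (intro sum_strict_mono_ex1) auto
    also have "(\<Sum>s\<in>V - line a. 2) = (84::nat)"
      using lineV finV V(2) card_line[OF ac(1,2)] by (simp add: card_Diff_subset finite_subset[OF lineV])
    finally show False using incidence_count[OF V(1) S] cS by simp
  qed
  have "V \<noteq> {\<one>}" using V(2) by auto
  then obtain t where t: "t \<in> V" "t \<noteq> \<one>" using subgroup.one_closed[OF V(1)] by blast
  have tc: "t \<in> carrier G" using t Vc by auto
  have "line t \<noteq> V" using card_line[OF tc t(2)] V(2) by auto
  then obtain u where u: "u \<in> V" "u \<notin> line t" using line_subset[OF V(1) t(1)] by blast
  have uc: "u \<in> carrier G" using u Vc by auto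
  note W = subgroup_line[OF tc]
  have Wc: "line t \<subseteq> carrier G" using W by (rule subgroup.subset)
  have lay: "card (layer (line t) u i) = 0 \<or> card (layer (line t) u i) = 3" if i: "i \<in> {1..6}" for i
  proof (cases "layer (line t) u i = {}")
    case False
    then obtain w where w: "w \<in> line t" "u [^] i \<otimes> w \<in> A" by (auto simp: layer_def)
    have wc: "w \<in> carrier G" using w Wc by auto
    define b where "b = u [^] i \<otimes> w"
    have bA: "b \<in> A" using w by (simp add: b_def)
    have bV: "b \<in> V" unfolding b_def using w(1) line_subset[OF V(1) t(1)] subgroup_nat_pow[OF V(1) u(1)]
      by (intro subgroup.m_closed[OF V(1)]) auto
    have "\<not> 7 dvd i" using i by (auto dest: dvd_imp_le)
    then have ui: "u [^] i \<notin> line t" using pow_mem_iff[OF W uc] relord_7[OF W uc u(2)] by simp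
    have bt: "b \<notin> line t"
    proof
      assume "b \<in> line t"
      then have "b \<otimes> inv w \<in> line t" using w W by (simp add: subgroup.m_closed subgroup.m_inv_closed)
      then show False using ui uc wc by (simp add: b_def m_assoc)
    qed
    have bc: "b \<in> carrier G" "b \<noteq> \<one>" using bA A_carrier one_notin by auto
    have "t \<notin> line b" using line_sym[OF bc(1), of t] t bt by auto
    then have c3: "card (layer (line t) b 1) = 3" using eq3[of b t] bA bV t by auto
    have "layer (line t) u i = (\<lambda>v. w \<otimes> v) ` layer (line t) b 1"
    proof (intro equalityI subsetI)
      fix v assume v: "v \<in> layer (line t) u i"
      then have v': "v \<in> line t" "u [^] i \<otimes> v \<in> A" "v \<in> carrier G" using Wc by (auto simp: layer_def)
      have "inv w \<otimes> v \<in> line t" using w v' W by (simp add: subgroup.m_closed subgroup.m_inv_closed)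
      moreover have "b \<otimes> (inv w \<otimes> v) \<in> A" using v' wc uc by (simp add: b_def m_assoc)
      moreover have "v = w \<otimes> (inv w \<otimes> v)" using v' wc by simp
      ultimately show "v \<in> (\<lambda>v. w \<otimes> v) ` layer (line t) b 1" unfolding layer_1_coset[OF bc(1)] by blast
    next
      fix v assume "v \<in> (\<lambda>v. w \<otimes> v) ` layer (line t) b 1"
      then obtain v' where v': "v' \<in> line t" "b \<otimes> v' \<in> A" "v = w \<otimes> v'" unfolding layer_1_coset[OF bc(1)] by blast
      have "v' \<in> carrier G" using v' Wc by auto
      then have "u [^] i \<otimes> v \<in> A" using v' wc uc by (simp add: b_def m_assoc)
      moreover have "v \<in> line t" unfolding v'(3) using w(1) v'(1) by (rule subgroup.m_closed[OF W])
      ultimately show "v \<in> layer (line t) u i" by (simp add: layer_def)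
    qed
    moreover have "card ((\<lambda>v. w \<otimes> v) ` layer (line t) b 1) = 3"
      using c3 wc layer_subset[of "line t" b 1] Wc by (subst card_mult_image) auto
    ultimately show ?thesis by simp
  qed simp
  have "3 dvd card (layer (line t) u i)" if "i \<in> {1..6}" for i using lay[OF that] by auto
  then have "3 dvd card (layer (line t) u 1) + card (layer (line t) u 2) + card (layer (line t) u 3) +
    card (layer (line t) u 4) + card (layer (line t) u 5) + card (layer (line t) u 6)"
    by (intro dvd_add) auto
  then have "3 dvd 2 * card (line t)" using layer_sum[OF W uc u(2)] by simp
  then show False by (simp add: card_line[OF tc t(2)])
qed

lemma pow_mod_7: "x \<in> carrier G \<Longrightarrow> x [^] (m::nat) = x [^] (m mod 7)"
proof -
  assume x: "x \<in> carrier G"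
  have "x [^] m = (x [^] (7::nat)) [^] (m div 7) \<otimes> x [^] (m mod 7)"
    using x by (simp add: nat_pow_pow nat_pow_mult)
  then show ?thesis using exp7[OF x] x by simp
qed

lemma full_coset_pattern:
  assumes t: "t \<in> carrier G" "t \<noteq> \<one>" and u: "u \<in> carrier G" "u \<notin> line t" and full: "\<forall>w\<in>line t. u \<otimes> w \<in> A"
  shows "layer (line t) u 1 = line t \<and> layer (line t) u 3 = {} \<and> layer (line t) u 5 = {} \<and> layer (line t) u 6 = {} \<and>
    (layer (line t) u 2 = line t \<and> layer (line t) u 4 = {} \<or> layer (line t) u 4 = line t \<and> layer (line t) u 2 = {})"
proof (rule line_pattern[OF t u])
  have "layer (line t) u 1 = line t" using full by (simp only: full_coset_iff[OF u(1)])
  then show "4 \<le> card (layer (line t) u 1)" using card_line[OF t] by simp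
qed

text \<open>Once one coset of the line is full, every other coset in the plane, apart from the line
  itself, is full as soon as it contains a point of \<open>A\<close>.\<close>

lemma full_coset_covers:
  assumes t: "t \<in> carrier G" "t \<noteq> \<one>" and u: "u \<in> carrier G" "u \<notin> line t" and full: "\<forall>w\<in>line t. u \<otimes> w \<in> A"
    and c: "c \<in> A" "c \<in> adj (line t) u" "c \<notin> line t" and w: "w \<in> line t"
  shows "c \<otimes> w \<in> A"
proof -
  note W = subgroup_line[OF t(1)]
  have Wc: "line t \<subseteq> carrier G" using W by (rule subgroup.subset)
  have "c \<in> blk (line t) u {..<7}" using c(2) adj_eq[OF W u(1)] relord_7[OF W u] by simp
  then obtain i v where iv: "i \<in> {..<7::nat}" "v \<in> line t" "c = u [^] i \<otimes> v" by (rule blkE)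
  have vc: "v \<in> carrier G" "w \<in> carrier G" using iv w Wc by auto
  have "i \<noteq> 0" using c(3) iv vc by (intro notI) simp
  then have i: "i = 1 \<or> i = 2 \<or> i = 3 \<or> i = 4 \<or> i = 5 \<or> i = 6" using iv(1) by auto
  have v: "v \<in> layer (line t) u i" using iv c(1) by (simp add: layer_def)
  have "layer (line t) u i = line t"
    using full_coset_pattern[OF t u full] i v by (elim disjE) auto
  moreover have "v \<otimes> w \<in> line t" using iv(2) w by (rule subgroup.m_closed[OF W])
  ultimately have "u [^] i \<otimes> (v \<otimes> w) \<in> A" by (auto simp: layer_def)
  then show ?thesis using u(1) vc by (simp add: iv(3) m_assoc)
qed

text \<open>In the plane of \<open>b\<close> and \<open>u\<close>, layer 3 along \<open>b\<close> is
  empty by the pattern, while an affine line in any other direction \<open>t\<close> crosses every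
  layer.\<close>

lemma full_coset_directions:
  assumes b: "b \<in> A" and u: "u \<in> carrier G" "u \<notin> line b" and full: "\<forall>w\<in>line b. u \<otimes> w \<in> A"
    and t: "t \<in> adj (line b) u" "t \<notin> line b"
  shows "\<exists>w\<in>line t. b \<otimes> w \<notin> A"
proof (rule ccontr)
  assume "\<not> ?thesis"
  then have bt: "b \<otimes> w \<in> A" if "w \<in> line t" for w using that by blast
  have bc: "b \<in> carrier G" "b \<noteq> \<one>" using b A_carrier one_notin by auto
  note W = subgroup_line[OF bc(1)]
  have Wc: "line b \<subseteq> carrier G" using W by (rule subgroup.subset)
  have "t \<in> blk (line b) u {..<7}" using t(1) adj_eq[OF W u(1)] relord_7[OF W u] by simp
  then obtain i v where iv: "i \<in> {..<7::nat}" "v \<in> line b" "t = u [^] i \<otimes> v" by (rule blkE)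
  have vc: "v \<in> carrier G" using iv Wc by auto
  have tc: "t \<in> carrier G" using iv u vc by simp
  have "i \<noteq> 0" using t(2) iv vc by (intro notI) simp
  then have i: "i = 1 \<or> i = 2 \<or> i = 3 \<or> i = 4 \<or> i = 5 \<or> i = 6" using iv(1) by auto
  \<comment> \<open>\<open>j\<close> is 3 divided by \<open>i\<close> modulo 7: it takes
    \<open>b \<otimes> t [^] j\<close> into the empty layer 3.\<close>
  then obtain j :: nat where j: "i * j mod 7 = 3"
  proof (elim disjE)
    assume "i = 1" then show ?thesis by (intro that[of 3]) simp
  next
    assume "i = 2" then show ?thesis by (intro that[of 5]) simp
  next
    assume "i = 3" then show ?thesis by (intro that[of 1]) simp
  next
    assume "i = 4" then show ?thesis by (intro that[of 6]) simp
  next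
    assume "i = 5" then show ?thesis by (intro that[of 2]) simp
  next
    assume "i = 6" then show ?thesis by (intro that[of 4]) simp
  qed
  have "u [^] (i * j) = u [^] (3::nat)" using pow_mod_7[OF u(1), of "i * j"] j by simp
  then have "t [^] j = u [^] (3::nat) \<otimes> v [^] j" using u vc by (simp add: iv(3) nat_pow_distrib nat_pow_pow)
  then have e: "b \<otimes> t [^] j = u [^] (3::nat) \<otimes> (b \<otimes> v [^] j)" using u vc bc by (simp add: m_lcomm)
  have "t [^] j \<in> line t" using subgroup_line[OF tc] mem_line[OF tc] by (rule subgroup_nat_pow)
  then have "u [^] (3::nat) \<otimes> (b \<otimes> v [^] j) \<in> A" unfolding e[symmetric] by (rule bt)
  moreover have "b \<otimes> v [^] j \<in> line b"
    using mem_line[OF bc(1)] subgroup_nat_pow[OF W iv(2)] by (rule subgroup.m_closed[OF W])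
  ultimately have "b \<otimes> v [^] j \<in> layer (line b) u 3" by (simp add: layer_def)
  then show False using full_coset_pattern[OF bc u full] by simp
qed

text \<open>The layers are now parallel to the plane of \<open>b\<close> and \<open>t\<close>.
  Assumption \<open>bm\<close> supplies a second point of \<open>A\<close> on \<open>line b\<close>,
  so that differences of points in layer 0 generate the plane; this rules out the borderline case of
  the pigeonhole bound for layers 0, 3 and 4.\<close>

lemma full_plane_cosets:
  assumes b: "b \<in> carrier G" "b \<noteq> \<one>" and t: "t \<in> carrier G" "t \<notin> line b"
    and u: "u \<in> carrier G" "u \<notin> adj (line b) t"
    and ub: "\<And>w. w \<in> line b \<Longrightarrow> u \<otimes> w \<in> A" and uub: "\<And>w. w \<in> line b \<Longrightarrow> u [^] (2::nat) \<otimes> w \<in> A"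
    and bt: "\<And>w. w \<in> line t \<Longrightarrow> b \<otimes> w \<in> A" and bm: "b [^] Suc m \<in> A" "coprime m 7"
  shows "layer (adj (line b) t) u 1 = adj (line b) t \<and> layer (adj (line b) t) u 2 = adj (line b) t"
proof -
  define W where "W = adj (line b) t"
  note lb = subgroup_line[OF b(1)] and lt = subgroup_line[OF t(1)]
  have W: "subgroup W G" unfolding W_def using subgroup_adj[OF lb t(1)] .
  have Wc: "W \<subseteq> carrier G" using W by (rule subgroup.subset)
  have bW: "line b \<subseteq> W" and tW: "t \<in> W" unfolding W_def using subset_adj[OF lb t(1)] mem_adj[OF lb t(1)] by auto
  have ltW: "line t \<subseteq> W" using line_subset[OF W tW] .
  have cW: "card W = 49" unfolding W_def using card_adj[OF lb t(1)] relord_7[OF lb t] card_line[OF b] by simp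
  have uW: "u \<notin> W" using u by (simp add: W_def)
  let ?L = "layer W u"
  let ?c = "\<lambda>i. card (?L i)"
  have sum: "?c 1 + ?c 2 + ?c 3 + ?c 4 + ?c 5 + ?c 6 = 98" using layer_sum[OF W u(1) uW] cW by simp
  have le: "?c i \<le> 49" for i using card_layer_le[OF W, of u i] cW by simp
  have L0: "w \<in> ?L 0 \<longleftrightarrow> w \<in> W \<and> w \<in> A" for w using Wc by (auto simp: layer_def)
  have b1: "line b \<subseteq> ?L 1" unfolding layer_1_coset[OF u(1)] using ub bW by blast
  have b2: "line b \<subseteq> ?L 2" using uub bW by (auto simp: layer_def)
  have b0: "b \<otimes> w \<in> ?L 0" if "w \<in> line t" for w
  proof -
    have "b \<otimes> w \<in> W" using mem_line[OF b(1)] bW ltW that by (intro subgroup.m_closed[OF W]) auto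
    then show ?thesis using bt[OF that] L0 by simp
  qed
  \<comment> \<open>Layer 0 contains a coset of \<open>line t\<close>, which meets every coset of
    \<open>line b\<close> in \<open>W\<close>. As layers 1 and 2 contain \<open>line b\<close>,
    their products with layer 0 fill \<open>W\<close>, which empties the layers 6 and 5.\<close>
  have full: "W \<subseteq> line b <#> ?L 0"
  proof
    fix z assume "z \<in> W"
    then obtain i :: nat and v where iv: "v \<in> line b" "z = t [^] i \<otimes> v" unfolding W_def adj_def[of "line b"] by (elim blkE)
    have vc: "v \<in> carrier G" using iv bW Wc by auto
    have ti: "t [^] i \<in> line t" using lt mem_line[OF t(1)] by (rule subgroup_nat_pow)
    have "z = (v \<otimes> inv b) \<otimes> (b \<otimes> t [^] i)" unfolding iv(2) using vc b t by (simp add: ac_inv)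
    moreover have "v \<otimes> inv b \<in> line b" using iv(1) mem_line[OF b(1)] lb by (simp add: subgroup.m_closed subgroup.m_inv_closed)
    ultimately show "z \<in> line b <#> ?L 0" using b0[OF ti] by (simp add: set_multI)
  qed
  have c6: "?L 6 = {}"
  proof (rule layer_full_product[OF W u(1)])
    show "7 dvd 1 + 0 + (6::nat)" by simp
    show "W \<subseteq> ?L 1 <#> ?L 0" using full mono_set_mult[OF b1 order_refl] by (rule subset_trans)
  qed
  have c5: "?L 5 = {}"
  proof (rule layer_full_product[OF W u(1)])
    show "7 dvd 2 + 0 + (5::nat)" by simp
    show "W \<subseteq> ?L 2 <#> ?L 0" using full mono_set_mult[OF b2 order_refl] by (rule subset_trans)
  qed
  have s4: "?c 1 + ?c 2 + ?c 3 + ?c 4 = 98" using sum c5 c6 by simp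
  have pg: "?L k = {}" if "7 dvd i + j + k" "49 < ?c i + ?c j" for i j k
    using layer_pigeonhole[OF W u(1) that(1)] that(2) cW by simp
  have ne: "?L 1 \<noteq> {}" "?L 2 \<noteq> {}" "?L 0 \<noteq> {}"
    using b1 b2 mem_line[OF b(1)] b0[OF subgroup.one_closed[OF lt]] by auto
  \<comment> \<open>If the sum were 49, every translate of layer 3 by a point of layer 0 would be
    the same set, the complement of the inverses of layer 4. Differences of points in layer 0 would
    then stabilize layer 3, which would fill \<open>W\<close> and leave layer 4 empty.\<close>
  have c34: "?c 3 + ?c 4 \<le> 48" if n34: "?L 3 \<noteq> {}" "?L 4 \<noteq> {}"
  proof (rule ccontr)
    assume "\<not> ?thesis"
    moreover have "?c 3 + ?c 4 \<le> 49" using pg[of 3 4 0] ne(3) by (auto simp: not_less[symmetric])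
    ultimately have e49: "?c 3 + ?c 4 = 49" by linarith
    let ?N = "W - (\<lambda>r. inv r) ` ?L 4"
    have Lc: "?L i \<subseteq> carrier G" for i using layer_subset Wc by blast
    have inv4: "(\<lambda>r. inv r) ` ?L 4 \<subseteq> W" using layer_subset by (auto intro!: subgroup.m_inv_closed[OF W])
    have "card ((\<lambda>r. inv r) ` ?L 4) = ?c 4" using inj_on_subset[OF inv_inj Lc] by (rule card_image)
    then have cN: "card ?N = ?c 3"
      using inv4 Wc e49 cW by (subst card_Diff_subset) (auto intro: finite_subset_carrier)
    have trans: "(\<lambda>x. p \<otimes> x) ` ?L 3 = ?N" if p: "p \<in> ?L 0" for p
    proof (rule card_subset_eq)
      show "finite ?N" using Wc by simp
      have pW: "p \<in> W" using p L0 by simp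
      then have pc: "p \<in> carrier G" using Wc by auto
      show "(\<lambda>x. p \<otimes> x) ` ?L 3 \<subseteq> ?N"
      proof
        fix z assume "z \<in> (\<lambda>x. p \<otimes> x) ` ?L 3"
        then obtain x where x: "x \<in> ?L 3" "z = p \<otimes> x" by blast
        have "x \<in> W" using x layer_subset by blast
        with pW have "z \<in> W" unfolding x(2) by (rule subgroup.m_closed[OF W])
        moreover have "z \<noteq> inv r" if r: "r \<in> ?L 4" for r
        proof
          assume "z = inv r"
          moreover have "p \<otimes> x \<otimes> r \<noteq> \<one>" using layer_triple[OF u(1) Wc _ p x(1) r] by simp
          moreover have "r \<in> carrier G" using r Lc by blast
          ultimately show False using x(2) by auto
        qed
        ultimately show "z \<in> ?N" by blast
      qed
      show "card ((\<lambda>x. p \<otimes> x) ` ?L 3) = card ?N" using cN pc Lc by simp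
    qed
    let ?S = "stab (?L 3)"
    have S: "subgroup ?S G" using Lc by (rule subgroup_stab)
    have diff: "p \<otimes> inv q \<in> ?S" if pq: "p \<in> ?L 0" "q \<in> ?L 0" for p q
    proof -
      have c: "p \<in> carrier G" "q \<in> carrier G" using pq Lc by auto
      have "p \<otimes> inv q \<otimes> x \<in> ?L 3" if x: "x \<in> ?L 3" for x
      proof -
        have xc: "x \<in> carrier G" using x Lc by auto
        have "p \<otimes> x \<in> (\<lambda>x. q \<otimes> x) ` ?L 3" using trans[OF pq(1)] trans[OF pq(2)] x by blast
        then obtain x' where x': "x' \<in> ?L 3" "p \<otimes> x = q \<otimes> x'" by blast
        have "x' \<in> carrier G" using x' Lc by auto
        then have "p \<otimes> inv q \<otimes> x = x'" using c xc x'(2) by (metis inv_closed m_assoc m_comm m_lcomm mult_inv_cancel(2))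
        then show ?thesis using x'(1) by simp
      qed
      then show ?thesis using c by (simp add: stab_def)
    qed
    have bL0: "b \<in> ?L 0" using b0[OF subgroup.one_closed[OF lt]] b by simp
    have "t \<in> ?S"
    proof -
      have "b \<otimes> t \<otimes> inv b \<in> ?S" using b0[OF mem_line[OF t(1)]] bL0 by (rule diff)
      then show ?thesis using b t by (simp add: ac_inv)
    qed
    moreover have "b \<in> ?S"
    proof (rule mem_if_coprime_pows[OF S b(1) _ _ bm(2)])
      have "b [^] Suc m \<in> W" using bW mem_line[OF b(1)] subgroup_nat_pow[OF W] by blast
      then have "b [^] Suc m \<otimes> inv b \<in> ?S" using bm(1) L0 bL0 by (intro diff) auto
      then show "b [^] m \<in> ?S" using b by (simp add: m_assoc)
      show "b [^] (7::nat) \<in> ?S" using exp7[OF b(1)] subgroup.one_closed[OF S] by simp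
    qed
    ultimately have WS: "W \<subseteq> ?S"
      using adj_subset[OF lb t(1) S line_subset[OF S]] by (simp only: W_def[symmetric])
    obtain x where x: "x \<in> ?L 3" using n34 by blast
    have "W \<subseteq> ?L 3"
    proof
      fix z assume z: "z \<in> W"
      have xW: "x \<in> W" using x layer_subset by blast
      have c: "x \<in> carrier G" "z \<in> carrier G" using xW z Wc by auto
      have "z \<otimes> inv x \<in> W" using z xW W by (simp add: subgroup.m_closed subgroup.m_inv_closed)
      then have "z \<otimes> inv x \<otimes> x \<in> ?L 3" using WS x by (auto simp: stab_def)
      then show "z \<in> ?L 3" using c by (simp add: m_assoc)
    qed
    then have "card W \<le> ?c 3" using Lc by (intro card_mono) auto
    then have "?c 4 = 0" using e49 cW by simp
    then show False using n34 layer_empty_iff[OF W, of u 4] by simp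
  qed
  have z: "?c i = 0 \<longleftrightarrow> ?L i = {}" for i using layer_empty_iff[OF W] .
  \<comment> \<open>The four remaining layers have 98 points in total, twice the size of
    \<open>W\<close>, so a point in layer 3 or 4 makes some pair of layers exceed 49 and contradicts
    the pigeonhole bound. Afterwards layers 1 and 2 must both be full.\<close>
  have "?L 3 = {} \<and> ?L 4 = {}"
  proof (rule ccontr)
    assume "\<not> ?thesis"
    then consider "?L 3 \<noteq> {}" "?L 4 \<noteq> {}" | "?L 3 \<noteq> {}" "?L 4 = {}" | "?L 3 = {}" "?L 4 \<noteq> {}" by blast
    then show False
    proof cases
      case 1
      then have "49 < ?c 1 + ?c 2" using c34 s4 by linarith
      then show False using pg[of 1 2 4] 1 by simp
    next
      case 2
      then have c4: "?c 4 = 0" using z by simp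
      have "\<not> 49 < ?c 1 + ?c 3" using pg[of 1 3 3] 2 by auto
      then have "49 < ?c 2 + ?c 2" using s4 c4 by linarith
      then show False using pg[of 2 2 3] 2 by simp
    next
      case 3
      then have c3: "?c 3 = 0" using z by simp
      have "\<not> 49 < ?c 1 + ?c 2" using pg[of 1 2 4] 3 by auto
      moreover have "0 < ?c 1" using ne(1) z by (intro gr0I) simp
      ultimately have "49 < ?c 4 + ?c 1" using s4 c3 by linarith
      then show False using pg[of 4 1 2] ne by simp
    qed
  qed
  then have "?c 1 + ?c 2 = 98" using s4 z[of 3] z[of 4] by simp
  then have "?c 1 = card W" "?c 2 = card W" using le[of 1] le[of 2] cW by linarith+
  then show ?thesis unfolding W_def[symmetric] using layer_eq_full[OF W] by blast
qed

text \<open>\<open>a\<close> sees the direction \<open>t\<close> if the affine line through \<open>a\<close> in direction \<open>t\<close> lies in \<open>A\<close>.  By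
  transitivity an element that sees the fewest directions sees none, and then every plane through
  the origin and that element has its full cosets in the direction of the element.\<close>

lemma full_coset_trans:
  assumes a: "a \<in> A" and b: "b \<in> A" and t: "t \<in> carrier G" "t \<noteq> \<one>"
    and ab: "\<forall>w\<in>line b. a \<otimes> w \<in> A" and bt: "\<forall>w\<in>line t. b \<otimes> w \<in> A"
  shows "\<forall>w\<in>line t. a \<otimes> w \<in> A"
proof -
  have ac: "a \<in> carrier G" "a \<noteq> \<one>" and bc: "b \<in> carrier G" "b \<noteq> \<one>" using a b A_carrier one_notin by auto
  note lb = subgroup_line[OF bc(1)] and lt = subgroup_line[OF t(1)]
  have anb: "a \<notin> line b"
  proof
    assume "a \<in> line b"
    then have "inv a \<in> line b" by (rule subgroup.m_inv_closed[OF lb])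
    then show False using ab ac one_notin by force
  qed
  have bnt: "b \<notin> line t"
  proof
    assume "b \<in> line t"
    then have "inv b \<in> line t" by (rule subgroup.m_inv_closed[OF lt])
    then show False using bt bc one_notin by force
  qed
  have tnb: "t \<notin> line b" using line_sym[OF bc(1) _ t(2)] bnt by blast
  \<comment> \<open>\<open>b\<close> sees \<open>t\<close>, so \<open>full_coset_directions\<close>
    keeps \<open>t\<close> out of the plane of \<open>a\<close> and \<open>b\<close>: the three
    elements are independent.\<close>
  have tV: "t \<notin> adj (line b) a"
    using full_coset_directions[OF b ac(1) anb ab _ tnb] bt by blast
  let ?W = "adj (line b) t"
  have W: "subgroup ?W G" using subgroup_adj[OF lb t(1)] .
  have ltW: "line t \<subseteq> ?W" using line_subset[OF W mem_adj[OF lb t(1)]] .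
  have aW: "a \<notin> ?W"
  proof
    assume "a \<in> ?W"
    then have "a \<in> blk (line b) t {..<7}" using adj_eq[OF lb t(1)] relord_7[OF lb t(1) tnb] by simp
    then obtain i v where iv: "i \<in> {..<7::nat}" "v \<in> line b" "a = t [^] i \<otimes> v" by (rule blkE)
    have vc: "v \<in> carrier G" using iv(2) lb by (rule subgroup.mem_carrier[rotated])
    have "i \<noteq> 0" using anb iv vc by (intro notI) simp
    then have "\<not> 7 dvd i" using iv(1) by (auto dest: dvd_imp_le)
    moreover have "Factorial_Ring.prime (7::nat)" by simp
    ultimately have co: "coprime i 7" by (metis coprime_commute prime_imp_coprime)
    let ?V = "adj (line b) a"
    have V: "subgroup ?V G" using subgroup_adj[OF lb ac(1)] .
    have "a \<in> ?V" "v \<in> ?V" using mem_adj[OF lb ac(1)] subset_adj[OF lb ac(1)] iv by auto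
    then have "a \<otimes> inv v \<in> ?V" using V by (simp add: subgroup.m_closed subgroup.m_inv_closed)
    then have "t [^] i \<in> ?V" unfolding iv(3) using t vc by (simp add: m_assoc)
    moreover have "t [^] (7::nat) \<in> ?V" using exp7[OF t(1)] subgroup.one_closed[OF V] by simp
    ultimately have "t \<in> ?V" using mem_if_coprime_pows[OF V t(1) _ _ co] by blast
    then show False using tV by simp
  qed
  \<comment> \<open>The second full layer around \<open>b\<close> along \<open>t\<close> has index 2
    or 4 and provides the point \<open>b [^] 2\<close> or \<open>b [^] 4\<close> of \<open>A\<close>
    on \<open>line b\<close>.\<close>
  have "\<exists>m. b [^] Suc m \<in> A \<and> coprime m 7"
  proof -
    have l1: "\<one> \<in> line t" using lt by (rule subgroup.one_closed)
    have p7: "Factorial_Ring.prime (7::nat)" by simp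
    have "layer (line t) b 2 = line t \<or> layer (line t) b 4 = line t"
      using full_coset_pattern[OF t bc(1) bnt bt] by blast
    then show ?thesis
    proof
      assume "layer (line t) b 2 = line t"
      then have "b [^] (2::nat) \<otimes> \<one> \<in> A" using l1 by (auto simp: layer_def)
      then have "b [^] Suc 1 \<in> A" using bc by (simp add: numeral_2_eq_2)
      then show ?thesis by (intro exI[of _ 1]) simp
    next
      assume "layer (line t) b 4 = line t"
      then have "b [^] (4::nat) \<otimes> \<one> \<in> A" using l1 by (auto simp: layer_def)
      then have "b [^] Suc 3 \<in> A" using bc by (simp add: eval_nat_numeral)
      moreover have "coprime (3::nat) 7" using p7 by (intro primes_coprime) auto
      ultimately show ?thesis by blast
    qed
  qed
  then obtain m where m: "b [^] Suc m \<in> A" "coprime m 7" by blast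
  from full_coset_pattern[OF bc ac(1) anb ab] consider "layer (line b) a 2 = line b" | "layer (line b) a 4 = line b" by blast
  then show ?thesis
  proof cases
    case 1
    have "layer ?W a 1 = ?W \<and> layer ?W a 2 = ?W"
    proof (rule full_plane_cosets[OF bc t(1) tnb ac(1) aW _ _ _ m])
      show "a \<otimes> w \<in> A" if "w \<in> line b" for w using ab that by blast
      show "a [^] (2::nat) \<otimes> w \<in> A" if "w \<in> line b" for w using 1 that by (auto simp: layer_def)
      show "b \<otimes> w \<in> A" if "w \<in> line t" for w using bt that by blast
    qed
    then have "layer ?W a 1 = ?W" ..
    then have "\<forall>w\<in>?W. a \<otimes> w \<in> A" by (simp only: full_coset_iff[OF ac(1)])
    then show ?thesis using ltW by blast
  next
    case 2
    \<comment> \<open>If the full layers are 1 and 4, then \<open>u\<close> serves instead of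
      \<open>a\<close>: since \<open>a [^] 8 = a\<close>, the layers 1 and 2 of \<open>u\<close> are
      the layers 4 and 1 of \<open>a\<close>.\<close>
    define u where "u = a [^] (4::nat)"
    have uc: "u \<in> carrier G" using ac by (simp add: u_def)
    have uu: "u [^] (2::nat) = a"
    proof -
      have "u [^] (2::nat) = a [^] (8::nat)" using ac by (simp add: u_def nat_pow_pow)
      also have "\<dots> = a" using pow_mod_7[OF ac(1), of 8] ac by simp
      finally show ?thesis .
    qed
    have uW: "u \<notin> ?W" using subgroup_nat_pow[OF W, of u 2] uu aW by auto
    have "layer ?W u 1 = ?W \<and> layer ?W u 2 = ?W"
    proof (rule full_plane_cosets[OF bc t(1) tnb uc uW _ _ _ m])
      show "u \<otimes> w \<in> A" if "w \<in> line b" for w using 2 that by (auto simp: layer_def u_def)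
      show "u [^] (2::nat) \<otimes> w \<in> A" if "w \<in> line b" for w using ab that uu by simp
      show "b \<otimes> w \<in> A" if "w \<in> line t" for w using bt that by blast
    qed
    then have W2: "layer ?W u 2 = ?W" ..
    show ?thesis
    proof
      fix w assume "w \<in> line t"
      then have "w \<in> layer ?W u 2" using ltW W2 by blast
      then show "a \<otimes> w \<in> A" by (simp add: layer_def uu)
    qed
  qed
qed

lemma exists_line_periodic:
  assumes ne: "A \<noteq> {}"
  shows "\<exists>a\<in>A. \<forall>c\<in>A - line a. \<forall>w\<in>line a. c \<otimes> w \<in> A"
proof -
  let ?T = "\<lambda>a. {t \<in> carrier G - {\<one>}. \<forall>w\<in>line t. a \<otimes> w \<in> A}"
  obtain a0 where "a0 \<in> A" using ne by blast
  then obtain a where a: "a \<in> A" "\<And>b. b \<in> A \<Longrightarrow> card (?T a) \<le> card (?T b)"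
    using ex_has_least_nat[of "\<lambda>a. a \<in> A" a0 "\<lambda>a. card (?T a)"] by blast
  have ac: "a \<in> carrier G" "a \<noteq> \<one>" using a A_carrier one_notin by auto
  note la = subgroup_line[OF ac(1)]
  \<comment> \<open>If \<open>a\<close> sees \<open>t\<close>, take \<open>b\<close> in
    \<open>A\<close> on \<open>line t\<close>. By transitivity \<open>b\<close> sees only directions
    that \<open>a\<close> sees, but not its own, since its own line passes through the origin; so
    \<open>b\<close> sees fewer directions than \<open>a\<close>.\<close>
  have Ta: False if t: "t \<in> ?T a" for t
  proof -
    have tc: "t \<in> carrier G" "t \<noteq> \<one>" using t by auto
    have "A \<inter> line t \<noteq> {}" using line_count[OF tc] by auto
    then obtain b where b: "b \<in> A" "b \<in> line t" by blast
    have bc: "b \<in> carrier G" "b \<noteq> \<one>" using b A_carrier one_notin by auto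
    have lbt: "line b = line t" using line_eq[OF tc(1) b(2) bc(2)] .
    have ab: "\<forall>w\<in>line b. a \<otimes> w \<in> A" using t lbt by simp
    have sub: "?T b \<subseteq> ?T a" using full_coset_trans[OF a(1) b(1) _ _ ab] by blast
    have "b \<in> ?T a" using ab bc by simp
    moreover have "b \<notin> ?T b"
    proof
      assume "b \<in> ?T b"
      moreover have "inv b \<in> line b" using mem_line[OF bc(1)] by (rule subgroup.m_inv_closed[OF subgroup_line[OF bc(1)]])
      ultimately show False using bc one_notin by force
    qed
    ultimately have "?T b \<subset> ?T a" using sub by blast
    then have "card (?T b) < card (?T a)" by (intro psubset_card_mono) auto
    then show False using a(2)[OF b(1)] by simp
  qed
  have "c \<otimes> w \<in> A" if c: "c \<in> A - line a" and w: "w \<in> line a" for c w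
  proof -
    have cc: "c \<in> carrier G" "c \<notin> line a" "c \<in> A" using c A_carrier by auto
    let ?V = "adj (line a) c"
    have V: "subgroup ?V G" using subgroup_adj[OF la cc(1)] .
    have cV: "card ?V = 49" using card_adj[OF la cc(1)] relord_7[OF la cc(1,2)] card_line[OF ac] by simp
    have Vc: "?V \<subseteq> carrier G" using V by (rule subgroup.subset)
    obtain t u where tu: "t \<in> ?V - {\<one>}" "u \<in> A \<inter> ?V - line t" "\<forall>w\<in>line t. u \<otimes> w \<in> A"
      using exists_full_coset[OF V cV] by blast
    have tc: "t \<in> carrier G" "t \<noteq> \<one>" and uc: "u \<in> carrier G" "u \<notin> line t" using tu Vc by auto
    have sub: "adj (line t) u \<subseteq> ?V"
      using tu by (intro adj_subset[OF subgroup_line[OF tc(1)] uc(1) V line_subset[OF V]]) auto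
    have "card (adj (line t) u) = 49"
      using card_adj[OF subgroup_line[OF tc(1)] uc(1)] relord_7[OF subgroup_line[OF tc(1)] uc] card_line[OF tc] by simp
    then have VV: "adj (line t) u = ?V" using sub cV Vc by (intro card_subset_eq) auto
    note cov = full_coset_covers[OF tc uc tu(3)]
    have "a \<in> ?V" "c \<in> ?V" using subset_adj[OF la cc(1)] mem_line[OF ac(1)] mem_adj[OF la cc(1)] by auto
    \<comment> \<open>Otherwise the full coset in this plane would make the coset of
      \<open>a\<close> full as well, and \<open>a\<close> would see \<open>t\<close>.\<close>
    have "a \<in> line t"
    proof (rule ccontr)
      assume "a \<notin> line t"
      then have "\<forall>w\<in>line t. a \<otimes> w \<in> A" using cov[OF a(1)] VV \<open>a \<in> ?V\<close> by simp
      then show False using Ta[of t] tc by simp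
    qed
    then have "line a = line t" using line_eq[OF tc(1)] ac by blast
    then show ?thesis using cov[OF cc(3)] VV \<open>c \<in> ?V\<close> cc(2) w by simp
  qed
  then show ?thesis using a(1) by blast
qed

text \<open>A threefold sum in \<open>line a\<close> with a term off that line could be shifted
  along the line to \<open>\<one>\<close>. So only the sums of the two points \<open>p\<close> and
  \<open>q\<close> occur there, at most four of seven elements.\<close>

lemma card_triple_elementary:
  assumes ne: "A \<noteq> {}"
  shows "card (triple A) + 3 \<le> order G"
proof -
  obtain a where a: "a \<in> A" and per: "\<And>c w. c \<in> A - line a \<Longrightarrow> w \<in> line a \<Longrightarrow> c \<otimes> w \<in> A"
    using exists_line_periodic[OF ne] by blast
  have ac: "a \<in> carrier G" "a \<noteq> \<one>" using a A_carrier one_notin by auto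
  note la = subgroup_line[OF ac(1)]
  have lc: "line a \<subseteq> carrier G" using la by (rule subgroup.subset)
  obtain p q where pq: "A \<inter> line a = {p, q}" using line_count[OF ac] by (auto simp: card_2_iff)
  have pqc: "p \<in> carrier G" "q \<in> carrier G" using pq lc by auto
  let ?F = "{p \<otimes> p \<otimes> p, p \<otimes> p \<otimes> q, p \<otimes> q \<otimes> q, q \<otimes> q \<otimes> q}"
  have "triple A \<subseteq> (carrier G - line a) \<union> ?F"
  proof
    fix z assume "z \<in> triple A"
    then obtain x y w where xyw: "x \<in> A" "y \<in> A" "w \<in> A" "z = x \<otimes> y \<otimes> w" by (auto simp: mem_triple_iff)
    have car: "x \<in> carrier G" "y \<in> carrier G" "w \<in> carrier G" using xyw A_carrier by auto
    show "z \<in> (carrier G - line a) \<union> ?F"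
    proof (cases "z \<in> line a")
      case True
      then have iz: "inv z \<in> line a" by (rule subgroup.m_inv_closed[OF la])
      have zc: "z \<in> carrier G" using xyw car by simp
      have *: "v \<in> line a" if v: "v \<in> A" "v' \<in> A" "v'' \<in> A" "z = v \<otimes> v' \<otimes> v''" for v v' v''
      proof (rule ccontr)
        assume "v \<notin> line a"
        then have "v \<otimes> inv z \<in> A" using per[of v "inv z"] v iz by simp
        moreover have "(v \<otimes> inv z) \<otimes> v' \<otimes> v'' = \<one>"
        proof -
          have "(v \<otimes> inv z) \<otimes> v' \<otimes> v'' = (v \<otimes> v' \<otimes> v'') \<otimes> inv z"
            using v(1-3) A_carrier zc by (simp add: m_ac)
          then show ?thesis using zc by (simp flip: v(4))
        qed
        ultimately show False using no_triple_one v by blast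
      qed
      have "x \<in> line a" using *[OF xyw] .
      moreover have "y \<in> line a" using *[OF xyw(2,1,3)] xyw(4) car by (simp add: m_comm)
      moreover have "w \<in> line a" using *[OF xyw(3,1,2)] xyw(4) car by (simp add: m_ac)
      ultimately have "x \<in> {p, q}" "y \<in> {p, q}" "w \<in> {p, q}" using xyw pq by blast+
      then have "z \<in> ?F" unfolding xyw(4) using pqc by (auto simp: m_ac)
      then show ?thesis by blast
    next
      case False then show ?thesis using xyw car by simp
    qed
  qed
  then have "card (triple A) \<le> card ((carrier G - line a) \<union> ?F)" by (intro card_mono) auto
  also have "\<dots> \<le> card (carrier G - line a) + card ?F" by (rule card_Un_le)
  also have "card ?F \<le> 4" by (simp add: card_insert_if)
  also have "card (carrier G - line a) = order G - 7" using lc card_line[OF ac] by (simp add: card_Diff_subset order_def)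
  finally have "card (triple A) \<le> order G - 7 + 4" by simp
  moreover have "7 \<le> order G" using card_mono[OF finite_carrier lc] card_line[OF ac] by (simp add: order_def)
  ultimately show ?thesis by linarith
qed

end

end

section \<open>The three cases combined\<close>

context finite_comm_group
begin

text \<open>A translation of \<open>A\<close> moves a missing element to \<open>\<one>\<close>, the
  normalization assumed by \<open>card_triple_elementary\<close>.\<close>

lemma elementary_not_one_missing:
  assumes exp7: "\<And>x. x \<in> carrier G \<Longrightarrow> x [^] (7::nat) = \<one>"
    and A: "incomplete A" and third: "3 * card A + 1 = order G"
  shows "card (triple A) + 3 \<le> order G"
proof -
  have Ac: "A \<subseteq> carrier G" "A \<noteq> {}" "triple A \<noteq> carrier G" using A by (auto simp: incomplete_iff)
  have Tc: "triple A \<subseteq> carrier G" using Ac(1) by (rule triple_subset)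
  obtain x where x: "x \<in> carrier G" "x \<notin> triple A" using Ac(3) Tc by blast
  \<comment> \<open>The cube of \<open>c\<close> has to be \<open>inv x\<close>, and exponent 7
    makes the square of \<open>x\<close> a solution.\<close>
  define c where "c = x [^] (2::nat)"
  have cc: "c \<in> carrier G" using x by (simp add: c_def)
  have c3: "c \<otimes> c \<otimes> c \<otimes> x = \<one>"
  proof -
    have "c \<otimes> c \<otimes> c \<otimes> x = x [^] (7::nat)" using x by (simp add: c_def eval_nat_numeral m_assoc)
    then show ?thesis using exp7[OF x(1)] by simp
  qed
  define B where "B = (\<lambda>a. c \<otimes> a) ` A"
  have Bc: "B \<subseteq> carrier G" using Ac cc by (auto simp: B_def)
  have cB: "card B = card A" using Ac cc by (simp add: B_def)
  have tB: "triple B = (\<lambda>z. c \<otimes> c \<otimes> c \<otimes> z) ` triple A"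
  proof (intro equalityI subsetI)
    fix z assume "z \<in> triple B"
    then obtain p q r where pqr: "p \<in> A" "q \<in> A" "r \<in> A" "z = (c \<otimes> p) \<otimes> (c \<otimes> q) \<otimes> (c \<otimes> r)"
      by (auto simp: mem_triple_iff B_def)
    have "p \<in> carrier G" "q \<in> carrier G" "r \<in> carrier G" using pqr Ac by auto
    then have "z = c \<otimes> c \<otimes> c \<otimes> (p \<otimes> q \<otimes> r)" using pqr(4) cc by (simp add: m_ac)
    then show "z \<in> (\<lambda>z. c \<otimes> c \<otimes> c \<otimes> z) ` triple A" using tripleI[OF pqr(1-3)] by blast
  next
    fix z assume "z \<in> (\<lambda>z. c \<otimes> c \<otimes> c \<otimes> z) ` triple A"
    then obtain p q r where pqr: "p \<in> A" "q \<in> A" "r \<in> A" "z = c \<otimes> c \<otimes> c \<otimes> (p \<otimes> q \<otimes> r)"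
      by (auto simp: mem_triple_iff)
    have "p \<in> carrier G" "q \<in> carrier G" "r \<in> carrier G" using pqr Ac by auto
    then have "z = (c \<otimes> p) \<otimes> (c \<otimes> q) \<otimes> (c \<otimes> r)" using pqr(4) cc by (simp add: m_ac)
    also have "\<dots> \<in> triple B" using pqr by (intro tripleI) (auto simp: B_def)
    finally show "z \<in> triple B" .
  qed
  have ctB: "card (triple B) = card (triple A)" unfolding tB using cc Tc by simp
  have "\<one> \<notin> triple B"
  proof
    assume "\<one> \<in> triple B"
    then obtain z where z: "z \<in> triple A" "\<one> = c \<otimes> c \<otimes> c \<otimes> z" unfolding tB by blast
    have "z \<in> carrier G" using z Tc by auto
    then have "z = x" using c3 z(2) cc x(1) by (metis l_cancel m_closed)
    then show False using z x by simp
  qed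
  moreover have "B \<noteq> {}" using Ac by (auto simp: B_def)
  ultimately show ?thesis
    using card_triple_elementary[OF exp7 Bc _ _] third cB ctB by simp
qed

lemma ord_eq_relord: "x \<in> carrier G \<Longrightarrow> ord x = relord {\<one>} x"
proof -
  assume x: "x \<in> carrier G"
  have "ord x dvd m \<longleftrightarrow> relord {\<one>} x dvd m" for m
    using pow_eq_id[OF x, of m] pow_mem_iff[OF subgroup_one x, of m] by simp
  then show ?thesis by (metis dvd_antisym dvd_refl)
qed

text \<open>Kneser's bound leaves the sizes \<open>order G - 3\<close> to
  \<open>order G - 1\<close>. The middle one never occurs, and the last one occurs exactly when some
  element other than \<open>\<one>\<close> has an order different from 7.\<close>

theorem incomplete_sizes_1_mod_3:
  assumes n1: "\<And>d. d dvd order G \<Longrightarrow> d mod 3 = 1" and n2: "2 \<le> order G"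
  shows "3 * max_incomplete_size G 3 + 1 = order G"
    "\<not> elementary_abelian 7 G \<Longrightarrow> incomplete_sizes G 3 = {order G - 3, order G - 1}"
    "elementary_abelian 7 G \<Longrightarrow> incomplete_sizes G 3 = {order G - 3}"
proof -
  have "carrier G \<noteq> {\<one>}" using n2 by (auto simp: order_def)
  then obtain t where t: "t \<in> carrier G" "t \<noteq> \<one>" using one_closed by blast
  obtain A where A: "incomplete A" "3 * card A + 1 = order G" "card (triple A) = order G - 3"
    using exists_incomplete_three_missing[OF n1 t] by blast
  define N where "N = card A"
  have N: "3 * N + 1 = order G" using A(2) by (simp add: N_def)
  have ub: "card C \<le> N" if "incomplete C" for C
    using incomplete_card_1_mod_3(1)[OF that n1] N by simp
  have m: "max_incomplete_size G 3 = N"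
    "incomplete_sizes G 3 = {card (triple C) | C. incomplete C \<and> card C = N}"
    by (rule max_incomplete_characterization[OF ub A(1) N_def[symmetric]], assumption)+
  show "3 * max_incomplete_size G 3 + 1 = order G" using m(1) N by simp
  have le: "order G \<le> card (triple C) + 3" "card (triple C) < order G" "card (triple C) + 2 \<noteq> order G"
    if C: "incomplete C" "card C = N" for C
  proof -
    have C3: "3 * card C + 1 = order G" using N C by simp
    show "order G \<le> card (triple C) + 3" using incomplete_card_1_mod_3(2)[OF C(1) n1 C3] by simp
    show "card (triple C) + 2 \<noteq> order G" by (rule no_two_missing[OF C(1) n1 C3])
    have "C \<subseteq> carrier G" "triple C \<noteq> carrier G" using C(1) by (auto simp: incomplete_iff)
    then show "card (triple C) < order G" unfolding order_def
      using triple_subset by (intro psubset_card_mono) auto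
  qed
  have in3: "order G - 3 \<in> incomplete_sizes G 3" unfolding m(2) mem_Collect_eq
    by (intro exI[of _ A]) (simp add: A N_def)
  show "incomplete_sizes G 3 = {order G - 3, order G - 1}" if ne: "\<not> elementary_abelian 7 G"
  proof -
    have "\<not> (\<forall>x\<in>carrier G - {\<one>}. ord x = 7)"
      using ne comm_group_axioms by (auto simp: elementary_abelian_def)
    then obtain x where x: "x \<in> carrier G" "x \<noteq> \<one>" "ord x \<noteq> 7" by blast
    have "relord {\<one>} x \<noteq> 7" using x ord_eq_relord by simp
    then obtain B where B: "incomplete B" "3 * card B + 1 = order G" "card (triple B) = order G - 1"
      using exists_incomplete_one_missing[OF n1 x(1,2)] by blast
    have "card B = N" using B(2) N by simp
    then have in1: "order G - 1 \<in> incomplete_sizes G 3" unfolding m(2) mem_Collect_eq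
      using B by (intro exI[of _ B]) simp
    have "s = order G - 3 \<or> s = order G - 1" if s: "s \<in> incomplete_sizes G 3" for s
    proof -
      obtain C where C: "s = card (triple C)" "incomplete C" "card C = N" using s unfolding m(2) by blast
      show ?thesis using le[OF C(2,3)] unfolding C(1) by linarith
    qed
    then show ?thesis using in1 in3 by blast
  qed
  show "incomplete_sizes G 3 = {order G - 3}" if el: "elementary_abelian 7 G"
  proof -
    have exp7: "x [^] (7::nat) = \<one>" if x: "x \<in> carrier G" for x
    proof (cases "x = \<one>")
      case False
      then have "ord x = 7" using el x by (simp add: elementary_abelian_def)
      then show ?thesis using pow_ord_eq_1[OF x] by simp
    qed simp
    have "s = order G - 3" if s: "s \<in> incomplete_sizes G 3" for s
    proof -
      obtain C where C: "s = card (triple C)" "incomplete C" "card C = N" using s unfolding m(2) by blast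
      have C3: "3 * card C + 1 = order G" using N C by simp
      have "card (triple C) + 3 \<le> order G" by (rule elementary_not_one_missing[OF exp7 C(2) C3])
      then show ?thesis using le(1)[OF C(2,3)] unfolding C(1) by linarith
    qed
    then show ?thesis using in3 by blast
  qed
qed

end

theorem theorem1p2:
  fixes G :: "('a, 'b) monoid_scheme" and n :: nat
  assumes "comm_group G" and "finite (carrier G)" and "order G = n" and "n \<ge> 2"
  shows "(\<forall>p. Factorial_Ring.prime p \<and> p dvd n \<and> p mod 3 = 2 \<and>
              (\<forall>q. Factorial_Ring.prime q \<and> q dvd n \<and> q mod 3 = 2 \<longrightarrow> p \<le> q) \<longrightarrow>
            real (max_incomplete_size G 3) = (real p + 1) * real n / (3 * real p) \<and>
            incomplete_sizes G 3 = {n - n div p})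
       \<and> (3 dvd n \<and> \<not> (\<exists>d. d dvd n \<and> d mod 3 = 2) \<longrightarrow>
            real (max_incomplete_size G 3) = real n / 3 \<and>
            incomplete_sizes G 3 =
              {n - n div d | d. d dvd n \<and> 3 dvd d \<and> d \<noteq> 3} \<union>
              {n - 2 * n div d | d. d dvd n \<and> 1 \<le> multiplicity 3 d \<and>
                 multiplicity 3 d \<le> multiplicity 3 (group_exponent G)})
       \<and> ((\<forall>d. d dvd n \<longrightarrow> d mod 3 = 1) \<longrightarrow>
            real (max_incomplete_size G 3) = (real n - 1) / 3 \<and>
            (\<not> elementary_abelian 7 G \<longrightarrow> incomplete_sizes G 3 = {n - 3, n - 1}) \<and>
            (elementary_abelian 7 G \<longrightarrow> incomplete_sizes G 3 = {n - 3}))"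
proof -
  interpret comm_group G by fact
  interpret finite_comm_group G by unfold_locales fact
  note n = \<open>order G = n\<close>
  show ?thesis
  proof (intro conjI allI impI; (elim conjE)?)
    fix p :: nat
    assume p: "Factorial_Ring.prime p" "p dvd n" "p mod 3 = 2"
      and pmin: "\<forall>q. Factorial_Ring.prime q \<and> q dvd n \<and> q mod 3 = 2 \<longrightarrow> p \<le> q"
    have r: "3 * p * max_incomplete_size G 3 = (p + 1) * n" "incomplete_sizes G 3 = {n - n div p}"
      using incomplete_sizes_2_mod_3[of p] p pmin unfolding n by blast+
    have "0 < p" using p(1) prime_gt_0_nat by blast
    moreover have "real (3 * p * max_incomplete_size G 3) = real ((p + 1) * n)" by (simp only: r(1))
    ultimately show "real (max_incomplete_size G 3) = (real p + 1) * real n / (3 * real p)"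
      by (simp add: field_simps)
    show "incomplete_sizes G 3 = {n - n div p}" by (rule r(2))
  next
    assume d3: "3 dvd n" and "\<not> (\<exists>d. d dvd n \<and> d mod 3 = 2)"
    then have no2: "d mod 3 \<noteq> 2" if "d dvd order G" for d using that n by blast
    have d3': "3 dvd order G" using d3 n by simp
    have "3 * max_incomplete_size G 3 = n" using incomplete_sizes_3_dvd(1)[OF d3' no2] n by simp
    then show "real (max_incomplete_size G 3) = real n / 3" by auto
    show "incomplete_sizes G 3 =
              {n - n div d | d. d dvd n \<and> 3 dvd d \<and> d \<noteq> 3} \<union>
              {n - 2 * n div d | d. d dvd n \<and> 1 \<le> multiplicity 3 d \<and>
                 multiplicity 3 d \<le> multiplicity 3 (group_exponent G)}"
      using incomplete_sizes_3_dvd(2)[OF d3' no2] unfolding n by blast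
  next
    assume "\<forall>d. d dvd n \<longrightarrow> d mod 3 = 1"
    then have n1: "d mod 3 = 1" if "d dvd order G" for d using that n by blast
    have n2: "2 \<le> order G" using \<open>n \<ge> 2\<close> n by simp
    have "3 * max_incomplete_size G 3 + 1 = n" using incomplete_sizes_1_mod_3(1)[OF n1 n2] n by simp
    then show "real (max_incomplete_size G 3) = (real n - 1) / 3" by auto
    show "incomplete_sizes G 3 = {n - 3, n - 1}" if "\<not> elementary_abelian 7 G"
      using incomplete_sizes_1_mod_3(2)[OF n1 n2 that] n by simp
    show "incomplete_sizes G 3 = {n - 3}" if "elementary_abelian 7 G"
      using incomplete_sizes_1_mod_3(3)[OF n1 n2 that] n by simp
  qed
qed

end
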